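(* Let $n,k\in\mathbb{N}$ with $3\leq k\leq n-1$ and let $\{D_I\}_{I\in\binom{[n]}{k}}$ be a family of real numbers. If the family is l-treelike, then there exists exactly one internal-nonzero-weighted essential pseudostar $\mathcal{P}$ of kind $(n,k)$ with leaf set $[n]$ realizing the family, and every other weighted essential tree with leaf set $[n]$ realizing the family can be obtained from $\mathcal{P}$ by $k$-OI operations and by inserting internal edges of weight $0$. If the family is p-l-treelike, then $\mathcal{P}$ is positive-weighted, and every other positive-weighted essential tree with leaf set $[n]$ realizing the family can be obtained from $\mathcal{P}$ by $k$-OI operations.
   Context: All trees are finite; weighted trees with labelled leaves are considered up to isomorphisms preserving leaf labels and weights. A weighted tree $\mathcal{T}=(T,w)$ is a tree with $w:E(T)\to\mathbb{R}$; it is positive-weighted if all weights are positive. $L(T)$ is the set of leaves; $D_I(\mathcal{T})$ is the total weight of the minimal subtree of $T$ containing $I$. A weighted tree with $L(T)=[n]$ realizes $\{D_I\}_I$ if $D_I(\mathcal{T})=D_I$ for all $I\in\binom{[n]}{k}$. The family is l-treelike (resp. p-l-treelike) if there is a weighted (resp. positive-weighted) tree $\mathcal{T}$ and a subset $S$ of its leaves, identified with $[n]$, such that $D_I(\mathcal{T})=D_I$ for all $k$-subsets $I$ of $S$. A node is a vertex of degree $>2$; a tree is essential if it has no vertex of degree $2$. The twig of a leaf $F$ is the path from $F$ to the node $N$ such that the path contains no node other than $N$; an edge is internal if it lies on no twig; internal-nonzero-weighted means all internal edges have nonzero weight. A tree $P$ is a pseudostar of kind $(n,k)$ if $\#L(P)=n$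 and every edge of $P$ divides $L(P)$ into two sets at least one of which has cardinality $\geq k$. Contracting an edge $\{a,b\}$ means identifying $a$ and $b$ and deleting the edge; inserting an edge is the inverse operation. A $k$-IO operation on a weighted tree with leaf set $[n]$: take an edge $e$ of weight $y$ dividing $[n]$ into two sets each of cardinality $<k$, contract $e$, and add $y/k$ to the weight of every twig. A $k$-OI operation is the inverse of a $k$-IO operation (insert an edge $e$ of some weight $y$ dividing $[n]$ into two sets each of cardinality $<k$, and subtract $y/k$ from the weight of every twig). *)

theory Defs
  imports Complex_Main
begin

section \<open>Finite simple graphs and trees\<close>

record 'a ugraph =
  verts :: "'a set"
  edges :: "'a set set"

definition ugraph :: "('a, 'b) ugraph_scheme \<Rightarrow> bool" where
  "ugraph G \<longleftrightarrow> finite (verts G) \<and> (\<forall>e\<in>edges G. e \<subseteq> verts G \<and> card e = 2)"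

text \<open>Paths and cycles are given by their vertex sequences; the sequence \<open>[v]\<close> is a path.\<close>

definition is_path :: "('a, 'b) ugraph_scheme \<Rightarrow> 'a list \<Rightarrow> bool" where
  "is_path G p \<longleftrightarrow> p \<noteq> [] \<and> distinct p \<and> set p \<subseteq> verts G \<and>
     (\<forall>i. Suc i < length p \<longrightarrow> {p ! i, p ! Suc i} \<in> edges G)"

definition path_edges :: "'a list \<Rightarrow> 'a set set" where
  "path_edges p = {{p ! i, p ! Suc i} | i. Suc i < length p}"

definition connects :: "('a, 'b) ugraph_scheme \<Rightarrow> 'a \<Rightarrow> 'a \<Rightarrow> bool" where
  "connects G u v \<longleftrightarrow> (\<exists>p. is_path G p \<and> hd p = u \<and> last p = v)"

definition is_cycle :: "('a, 'b) ugraph_scheme \<Rightarrow> 'a list \<Rightarrow> bool" where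
  "is_cycle G p \<longleftrightarrow> is_path G p \<and> 3 \<le> length p \<and> {last p, hd p} \<in> edges G"

definition is_tree :: "('a, 'b) ugraph_scheme \<Rightarrow> bool" where
  "is_tree T \<longleftrightarrow> ugraph T \<and> verts T \<noteq> {} \<and>
     (\<forall>u\<in>verts T. \<forall>v\<in>verts T. connects T u v) \<and> (\<nexists>p. is_cycle T p)"

definition degree :: "('a, 'b) ugraph_scheme \<Rightarrow> 'a \<Rightarrow> nat" where
  "degree G v = card {e \<in> edges G. v \<in> e}"

definition leaves :: "('a, 'b) ugraph_scheme \<Rightarrow> 'a set" where
  "leaves T = {v \<in> verts T. degree T v = 1}"

definition is_node :: "('a, 'b) ugraph_scheme \<Rightarrow> 'a \<Rightarrow> bool" where
  "is_node T v \<longleftrightarrow> v \<in> verts T \<and> 2 < degree T v"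

definition essential :: "('a, 'b) ugraph_scheme \<Rightarrow> bool" where
  "essential T \<longleftrightarrow> (\<forall>v\<in>verts T. degree T v \<noteq> 2)"

definition twig :: "('a, 'b) ugraph_scheme \<Rightarrow> 'a \<Rightarrow> 'a list \<Rightarrow> bool" where
  "twig T F p \<longleftrightarrow> F \<in> leaves T \<and> is_path T p \<and> hd p = F \<and> is_node T (last p) \<and>
     (\<forall>v\<in>set p. is_node T v \<longrightarrow> v = last p)"

definition internal_edge :: "('a, 'b) ugraph_scheme \<Rightarrow> 'a set \<Rightarrow> bool" where
  "internal_edge T e \<longleftrightarrow> e \<in> edges T \<and> (\<nexists>F p. twig T F p \<and> e \<in> path_edges p)"

definition delete_edge :: "('a, 'b) ugraph_scheme \<Rightarrow> 'a set \<Rightarrow> 'a ugraph" where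
  "delete_edge T e = \<lparr>verts = verts T, edges = edges T - {e}\<rparr>"

text \<open>The leaves of \<open>T\<close> on the side of the endpoint \<open>x\<close> of the edge \<open>e\<close>; an edge
  \<open>{a, b}\<close> divides the leaves of \<open>T\<close> into \<open>leaf_side T {a, b} a\<close> and
  \<open>leaf_side T {a, b} b\<close>.\<close>

definition leaf_side :: "('a, 'b) ugraph_scheme \<Rightarrow> 'a set \<Rightarrow> 'a \<Rightarrow> 'a set" where
  "leaf_side T e x = {l \<in> leaves T. connects (delete_edge T e) x l}"

definition pseudostar :: "nat \<Rightarrow> nat \<Rightarrow> ('a, 'b) ugraph_scheme \<Rightarrow> bool" where
  "pseudostar n k P \<longleftrightarrow> is_tree P \<and> card (leaves P) = n \<and>
     (\<forall>e\<in>edges P. \<exists>x\<in>e. k \<le> card (leaf_side P e x))"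

section \<open>Weighted trees\<close>

text \<open>Only the values of \<open>wt\<close> on the edges are meaningful.\<close>

record 'a wgraph = "'a ugraph" +
  wt :: "'a set \<Rightarrow> real"

definition is_subtree :: "'a ugraph \<Rightarrow> ('a, 'b) ugraph_scheme \<Rightarrow> bool" where
  "is_subtree S T \<longleftrightarrow> is_tree S \<and> verts S \<subseteq> verts T \<and> edges S \<subseteq> edges T"

definition minimal_subtree :: "('a, 'b) ugraph_scheme \<Rightarrow> 'a set \<Rightarrow> 'a ugraph \<Rightarrow> bool" where
  "minimal_subtree T I S \<longleftrightarrow> is_subtree S T \<and> I \<subseteq> verts S \<and>
     (\<forall>S'. is_subtree S' S \<and> I \<subseteq> verts S' \<longrightarrow> S' = S)"

text \<open>The number \<open>D\<^sub>I(T)\<close>; for a tree \<open>T\<close> and nonempty \<open>I \<subseteq> verts T\<close> the minimal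
  subtree is unique.\<close>

definition tree_weight :: "'a wgraph \<Rightarrow> 'a set \<Rightarrow> real" where
  "tree_weight T I = (\<Sum>e \<in> edges (THE S. minimal_subtree T I S). wt T e)"

definition positive_weighted :: "'a wgraph \<Rightarrow> bool" where
  "positive_weighted T \<longleftrightarrow> (\<forall>e\<in>edges T. 0 < wt T e)"

definition internal_nonzero_weighted :: "'a wgraph \<Rightarrow> bool" where
  "internal_nonzero_weighted T \<longleftrightarrow> (\<forall>e. internal_edge T e \<longrightarrow> wt T e \<noteq> 0)"

text \<open>Vertices are natural numbers and a leaf is its own label.  Every finite tree with leaves
  labelled by \<open>1, \<dots>, n\<close> is isomorphic to one of this form.\<close>

definition wtree_on :: "nat \<Rightarrow> nat wgraph \<Rightarrow> bool" where
  "wtree_on n T \<longleftrightarrow> is_tree T \<and> leaves T = {1..n}"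

definition wtree_iso :: "nat wgraph \<Rightarrow> nat wgraph \<Rightarrow> bool" where
  "wtree_iso T T' \<longleftrightarrow> (\<exists>f. bij_betw f (verts T) (verts T') \<and>
     edges T' = (image f) ` edges T \<and>
     (\<forall>e\<in>edges T. wt T' (f ` e) = wt T e) \<and>
     leaves T' = leaves T \<and> (\<forall>l\<in>leaves T. f l = l))"

text \<open>A family is a function on sets of which only the values on the \<open>k\<close>-subsets of
  \<open>{1..n}\<close> are used.\<close>

definition realizes :: "nat \<Rightarrow> nat \<Rightarrow> nat wgraph \<Rightarrow> (nat set \<Rightarrow> real) \<Rightarrow> bool" where
  "realizes n k T D \<longleftrightarrow> wtree_on n T \<and>
     (\<forall>I. I \<subseteq> {1..n} \<and> card I = k \<longrightarrow> tree_weight T I = D I)"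

text \<open>In the next two definitions \<open>\<phi>\<close> is the identification of \<open>{1..n}\<close> with a subset
  \<open>S\<close> of the leaves of \<open>T\<close>.\<close>

definition l_treelike :: "nat \<Rightarrow> nat \<Rightarrow> (nat set \<Rightarrow> real) \<Rightarrow> bool" where
  "l_treelike n k D \<longleftrightarrow> (\<exists>(T :: nat wgraph) S \<phi>. is_tree T \<and>
     S \<subseteq> leaves T \<and> bij_betw \<phi> {1..n} S \<and>
     (\<forall>I. I \<subseteq> {1..n} \<and> card I = k \<longrightarrow> tree_weight T (\<phi> ` I) = D I))"

definition p_l_treelike :: "nat \<Rightarrow> nat \<Rightarrow> (nat set \<Rightarrow> real) \<Rightarrow> bool" where
  "p_l_treelike n k D \<longleftrightarrow> (\<exists>(T :: nat wgraph) S \<phi>. is_tree T \<and> positive_weighted T \<and>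
     S \<subseteq> leaves T \<and> bij_betw \<phi> {1..n} S \<and>
     (\<forall>I. I \<subseteq> {1..n} \<and> card I = k \<longrightarrow> tree_weight T (\<phi> ` I) = D I))"

section \<open>Contraction, insertion, and the operations IO and OI\<close>

text \<open>Contraction of \<open>{a, b}\<close>: the vertex \<open>b\<close> is identified with \<open>a\<close>.  In a tree no two of
  the remaining edges become equal, so each keeps its weight.\<close>

definition contract :: "'a \<Rightarrow> 'a \<Rightarrow> 'a wgraph \<Rightarrow> 'a wgraph" where
  "contract a b T =
     (let r = (\<lambda>x. if x = b then a else x); E = edges T - {{a, b}}
      in \<lparr>verts = r ` verts T, edges = (image r) ` E,
          wt = (\<lambda>f. wt T (the_inv_into E (image r) f))\<rparr>)"

text \<open>\<open>T'\<close> arises from \<open>T\<close> by adding \<open>c\<close> to the weight of every twig.  In an essential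
  tree every twig is a single edge, so this determines the weights of \<open>T'\<close>.\<close>

definition add_to_twigs :: "real \<Rightarrow> 'a wgraph \<Rightarrow> 'a wgraph \<Rightarrow> bool" where
  "add_to_twigs c T T' \<longleftrightarrow> verts T' = verts T \<and> edges T' = edges T \<and>
     (\<forall>F p. twig T F p \<longrightarrow> sum (wt T') (path_edges p) = sum (wt T) (path_edges p) + c) \<and>
     (\<forall>e. internal_edge T e \<longrightarrow> wt T' e = wt T e)"

text \<open>The operations below are relations between trees, closed under \<^const>\<open>wtree_iso\<close>.\<close>

definition k_IO :: "nat \<Rightarrow> nat \<Rightarrow> nat wgraph \<Rightarrow> nat wgraph \<Rightarrow> bool" where
  "k_IO n k T T' \<longleftrightarrow> wtree_on n T \<and> wtree_on n T' \<and>
     (\<exists>a b U. {a, b} \<in> edges T \<and>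
        card (leaf_side T {a, b} a) < k \<and> card (leaf_side T {a, b} b) < k \<and>
        add_to_twigs (wt T {a, b} / real k) (contract a b T) U \<and> wtree_iso U T')"

definition k_OI :: "nat \<Rightarrow> nat \<Rightarrow> nat wgraph \<Rightarrow> nat wgraph \<Rightarrow> bool" where
  "k_OI n k T T' \<longleftrightarrow> k_IO n k T' T"

definition insert_zero_internal :: "nat \<Rightarrow> nat wgraph \<Rightarrow> nat wgraph \<Rightarrow> bool" where
  "insert_zero_internal n T T' \<longleftrightarrow> wtree_on n T \<and> wtree_on n T' \<and>
     (\<exists>a b. internal_edge T' {a, b} \<and> wt T' {a, b} = 0 \<and> wtree_iso (contract a b T') T)"

definition inw_essential_pseudostar ::
    "nat \<Rightarrow> nat \<Rightarrow> (nat set \<Rightarrow> real) \<Rightarrow> nat wgraph \<Rightarrow> bool" where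
  "inw_essential_pseudostar n k D P \<longleftrightarrow> pseudostar n k P \<and> essential P \<and>
     internal_nonzero_weighted P \<and> realizes n k P D"

end

theory Submission
  imports Defs
begin

text \<open>
  The weight \<open>D\<^sub>I(T)\<close> is the sum of the weights of the edges that separate two elements of
  \<open>I\<close>, so a realization amounts to weights on the splits of \<open>{1..n}\<close> induced by the edges.
  Two systems of pairwise compatible weighted splits, each having a side with at least \<open>k\<close>
  elements, that define the same family agree on every split \<open>{A, B}\<close>, by induction on the
  size of the side opposite to a side with at least \<open>k\<close> elements. Suppose that the first
  system contains \<open>{A, B}\<close> and that \<open>A\<close> is minimal. Replacing \<open>i \<in> A\<close> by \<open>j \<in> A\<close> in
  \<open>I\<close> shows that no split with different weights in the two systems separates \<open>i\<close> from
  \<open>j\<close>, trivial splits excepted; then a second difference in \<open>I\<close>, exchanging elements of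
  \<open>A\<close> with elements \<open>b, b'\<close> of \<open>B\<close> that no side of a split properly contained in \<open>B\<close>
  joins, isolates the weight of \<open>{A, B}\<close>. An essential tree is determined by its weighted splits. Finally
  every essential realization becomes a pseudostar of the required kind by contracting the
  edges without a side of \<open>k\<close> leaves and the internal edges of weight \<open>0\<close>.
\<close>

section \<open>Split systems determined by their values on k-subsets\<close>

text \<open>A split with fewer than \<open>k\<close> leaves on both sides is cut by every k-subset,
  so its weight \<open>y\<close> only adds a constant to the family. Adding \<open>y / k\<close> to
  each leaf edge does the same, because a k-subset is cut by exactly \<open>k\<close> of these
  edges. Such splits are therefore invisible in the family, which explains both the pseudostar
  condition and the constant in the IO operation. The obstacle to uniqueness is that splits of the
  two systems need not be compatible with each other, so the set of all differing splits has no tree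
  structure. Structure is recovered locally: a nontrivial differing split that cuts the minimal
  \<open>A\<close> can only belong to the second system, and outside \<open>A\<close> the pair
  \<open>b, b'\<close> is chosen apart in both systems at once. The bound \<open>3 \<le> k\<close>
  makes room for the auxiliary elements: two that neutralize a chain of splits, and a common one
  outside \<open>A\<close> in the second difference. Exchanges see trivial splits only through
  differences of their weights, so these are settled last, by a single evaluation.\<close>

definition cuts :: "'a set \<Rightarrow> 'a set \<Rightarrow> bool" where
  "cuts C I \<longleftrightarrow> I \<inter> C \<noteq> {} \<and> I - C \<noteq> {}"

lemma cuts_compl: "I \<subseteq> X \<Longrightarrow> cuts (X - C) I \<longleftrightarrow> cuts C I"
  unfolding cuts_def by blast

lemma subset_between_card:
  assumes "finite Y" "S \<subseteq> Y" "card S \<le> m" "m \<le> card Y"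
  obtains I where "S \<subseteq> I" "I \<subseteq> Y" "card I = m"
proof -
  have "finite S" using assms finite_subset by blast
  then have "m - card S \<le> card (Y - S)"
    using assms by (simp add: card_Diff_subset)
  then obtain J where J: "J \<subseteq> Y - S" "card J = m - card S" "finite J"
    using obtain_subset_with_card_n by metis
  have "card (S \<union> J) = m"
    using J \<open>finite S\<close> assms by (subst card_Un_disjoint) auto
  then show ?thesis using that[of "S \<union> J"] J assms by auto
qed

locale null_split_sum =
  fixes X :: "'a set" and k :: nat and h :: "'a set \<Rightarrow> real"
  assumes fin: "finite X" and k3: "3 \<le> k" and kX: "k < card X"
    and symm: "\<And>C. C \<subseteq> X \<Longrightarrow> h (X - C) = h C"
    and null: "\<And>I. I \<subseteq> X \<Longrightarrow> card I = k \<Longrightarrow> (\<Sum>C\<in>Pow X. h C * of_bool (cuts C I)) = 0"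
begin

text \<open>Subtracting the conditions for \<open>insert i I\<close> and \<open>insert j I\<close>
  leaves only sets that separate \<open>i\<close> from \<open>j\<close>, and complementation folds
  those containing \<open>j\<close> onto those containing \<open>i\<close>. Such a set counts only
  if it misses \<open>I\<close> or contains it, with opposite signs.\<close>

lemma exchange_sum:
  assumes ij: "i \<in> X" "j \<in> X" "i \<noteq> j" and I: "I \<subseteq> X - {i, j}" "card I = k - 1"
  shows "(\<Sum>C | C \<in> Pow X \<and> i \<in> C \<and> j \<notin> C.
            h C * (of_bool (I \<inter> C = {}) - of_bool (I \<subseteq> C))) = 0"
proof -
  let ?P = "{C \<in> Pow X. i \<in> C \<and> j \<notin> C}" and ?Q = "{C \<in> Pow X. j \<in> C \<and> i \<notin> C}"
  define g where "g C = h C * (of_bool (cuts C (insert i I)) - of_bool (cuts C (insert j I)))" for C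
  have finI: "finite I" using I fin finite_subset by blast
  have c: "card (insert i I) = k" "card (insert j I) = k" "insert i I \<subseteq> X" "insert j I \<subseteq> X"
    using I ij k3 finI by (auto simp: card_insert_if)
  have "(\<Sum>C\<in>Pow X. g C) = 0"
    using null[OF c(3,1)] null[OF c(4,2)] unfolding g_def
    by (simp add: right_diff_distrib sum_subtractf)
  moreover have "(\<Sum>C\<in>Pow X. g C) = (\<Sum>C\<in>?P \<union> ?Q. g C)"
    using fin by (intro sum.mono_neutral_right) (auto simp: g_def cuts_def)
  moreover have "(\<Sum>C\<in>?P \<union> ?Q. g C) = (\<Sum>C\<in>?P. g C) + (\<Sum>C\<in>?Q. g C)"
    using fin by (intro sum.union_disjoint) auto
  moreover have "(\<Sum>C\<in>?Q. g C) = (\<Sum>C\<in>?P. g C)"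
  proof (rule sum.reindex_bij_witness[of _ "\<lambda>C. X - C" "\<lambda>C. X - C"])
    fix C assume "C \<in> ?Q"
    then have "C \<subseteq> X" by auto
    then show "g (X - C) = g C" 
      using cuts_compl[OF c(3), of C] cuts_compl[OF c(4), of C] symm[of C] by (simp add: g_def)
  qed (use ij in auto)
  ultimately have "(\<Sum>C\<in>?P. g C) = 0" by linarith
  moreover have gP: "g C = h C * (of_bool (I \<inter> C = {}) - of_bool (I \<subseteq> C))" if "C \<in> ?P" for C
  proof -
    have "cuts C (insert i I) \<longleftrightarrow> \<not> I \<subseteq> C" "cuts C (insert j I) \<longleftrightarrow> \<not> I \<inter> C = {}"
      using that unfolding cuts_def by auto
    then show ?thesis unfolding g_def by (auto simp: of_bool_def)
  qed
  moreover have "(\<Sum>C\<in>?P. h C * (of_bool (I \<inter> C = {}) - of_bool (I \<subseteq> C))) = (\<Sum>C\<in>?P. g C)"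
    by (rule sum.cong[OF refl]) (rule gP[symmetric])
  ultimately show ?thesis by simp
qed

text \<open>One orientation of each split is listed. The trivial splits \<open>{i}\<close> and
  \<open>X - {j}\<close> are left out because an exchange sees them only through
  \<open>h {i} - h {j}\<close>.\<close>

definition separating :: "'a \<Rightarrow> 'a \<Rightarrow> 'a set set" where
  "separating i j = {C \<in> Pow X. h C \<noteq> 0 \<and> i \<in> C \<and> j \<notin> C \<and> C \<noteq> {i} \<and> C \<noteq> X - {j}}"

lemma separatingD:
  assumes "C \<in> separating i j"
  shows "C \<subseteq> X" "h C \<noteq> 0" "i \<in> C" "j \<notin> C" "C \<noteq> {i}" "C \<noteq> X - {j}"
  using assms unfolding separating_def by auto

lemma finite_separating: "finite (separating i j)"
  unfolding separating_def using fin by auto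

lemma separating_compl: "i \<in> X \<Longrightarrow> j \<in> X \<Longrightarrow> C \<in> separating i j \<Longrightarrow> X - C \<in> separating j i"
  unfolding separating_def using symm by auto

lemma exchange_sum_separating:
  assumes ij: "i \<in> X" "j \<in> X" "i \<noteq> j" and I: "I \<subseteq> X - {i, j}" "card I = k - 1"
  shows "h {i} - h {j} +
    (\<Sum>C\<in>separating i j. h C * (of_bool (I \<inter> C = {}) - of_bool (I \<subseteq> C))) = 0"
proof -
  let ?P = "{C \<in> Pow X. i \<in> C \<and> j \<notin> C}"
  let ?g = "\<lambda>C. h C * (of_bool (I \<inter> C = {}) - of_bool (I \<subseteq> C)) :: real"
  \<comment> \<open>If the two trivial sets coincided, they would be a single summand and the terms
    \<open>h {i}\<close> and \<open>h {j}\<close> could not be split off separately.\<close>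
  have ne: "{i} \<noteq> X - {j}"
  proof
    assume "{i} = X - {j}"
    then have "X = {i, j}" using ij by auto
    then have "card X = 2" using ij by simp
    then show False using kX k3 by simp
  qed
  have finI: "finite I" "I \<noteq> {}" using I fin finite_subset k3 by auto
  have "(\<Sum>C\<in>?P. ?g C) = (\<Sum>C\<in>{{i}, X - {j}} \<union> separating i j. ?g C)"
    using fin ij by (intro sum.mono_neutral_right) (auto simp: separating_def)
  also have "\<dots> = (\<Sum>C\<in>{{i}, X - {j}}. ?g C) + (\<Sum>C\<in>separating i j. ?g C)"
    using finite_separating by (intro sum.union_disjoint) (auto simp: separating_def)
  also have "(\<Sum>C\<in>{{i}, X - {j}}. ?g C) = ?g {i} + ?g (X - {j})"
    using ne by simp
  also have "?g {i} = h {i}" using I finI by auto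
  also have "?g (X - {j}) = - h {j}"
  proof -
    have "I \<inter> (X - {j}) \<noteq> {}" "I \<subseteq> X - {j}" using I finI by auto
    then show ?thesis using symm[of "{j}"] ij by simp
  qed
  finally show ?thesis using exchange_sum[OF assms] by simp
qed

text \<open>All nontrivial terms vanish for an \<open>I\<close> that meets every member of the chain
  and is contained in none. It is enough that \<open>I\<close> contains some \<open>p\<close> of the
  smallest member and some \<open>q\<close> outside the largest. Choices with
  \<open>p \<noteq> i\<close> and \<open>q \<noteq> j\<close> exist because \<open>{i}\<close> and
  \<open>X - {j}\<close> are not members, and \<open>k - 1 \<ge> 2\<close> leaves room for
  both.\<close>

lemma separating_singletons_eq:
  assumes ij: "i \<in> X" "j \<in> X" "i \<noteq> j"
    and chain: "\<And>C D. C \<in> separating i j \<Longrightarrow> D \<in> separating i j \<Longrightarrow> C \<subseteq> D \<or> D \<subseteq> C"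
  shows "h {i} = h {j}"
proof -
  obtain p q where pq: "p \<in> X - {i, j}" "q \<in> X - {i, j}"
    "\<forall>C\<in>separating i j. p \<in> C \<and> q \<notin> C"
  proof (cases "separating i j = {}")
    case True
    have "card (X - {i, j}) \<ge> 2" using kX k3 ij fin by (simp add: card_Diff_subset)
    then have "X - {i, j} \<noteq> {}" by (metis card.empty not_numeral_le_zero)
    then show ?thesis using True that by blast
  next
    case False
    note f = finite_separating[of i j]
    have "subset.chain (separating i j) (separating i j)"
      using chain unfolding subset.chain_def by blast
    with f False have m: "\<Inter> (separating i j) \<in> separating i j" "\<Union> (separating i j) \<in> separating i j"
      by (auto intro: Inter_in_chain Union_in_chain)
    obtain p where p: "p \<in> \<Inter> (separating i j)" "p \<noteq> i"
      using separatingD(3,5)[OF m(1)] by blast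
    obtain q where q: "q \<in> X - \<Union> (separating i j)" "q \<noteq> j"
      using separatingD(1,4,6)[OF m(2)] by blast
    have "\<Inter> (separating i j) \<subseteq> X - {j}" "i \<in> \<Union> (separating i j)"
      using separatingD(1,4)[OF m(1)] separatingD(3)[OF m(2)] by blast+
    then have "p \<in> X - {i, j}" "q \<in> X - {i, j}" using p q by auto
    moreover have "\<forall>C\<in>separating i j. p \<in> C \<and> q \<notin> C" using p(1) q(1) by blast
    ultimately show ?thesis by (rule that)
  qed
  have "card {p, q} \<le> 2" by (simp add: card_insert_if)
  then have "card {p, q} \<le> k - 1" using k3 by linarith
  moreover have "k - 1 \<le> card (X - {i, j})" using kX ij fin by (simp add: card_Diff_subset)
  ultimately obtain I where I: "{p, q} \<subseteq> I" "I \<subseteq> X - {i, j}" "card I = k - 1"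
    using subset_between_card[of "X - {i, j}" "{p, q}" "k - 1"] fin pq by auto
  have "(\<Sum>C\<in>separating i j. h C * (of_bool (I \<inter> C = {}) - of_bool (I \<subseteq> C))) = 0"
    using I pq by (intro sum.neutral) auto
  then show ?thesis using exchange_sum_separating[OF ij I(2,3)] by simp
qed

text \<open>A set \<open>I\<close> that misses the smallest member of the chain, meets all the others and is
  contained in none isolates the weight of the smallest member.\<close>

lemma separating_empty_aux:
  assumes ij: "i \<in> X" "j \<in> X" "i \<noteq> j"
    and chain: "\<And>C D. C \<in> separating i j \<Longrightarrow> D \<in> separating i j \<Longrightarrow> C \<subseteq> D \<or> D \<subseteq> C"
    and ne: "separating i j \<noteq> {}"
    and big: "k \<le> card (X - \<Inter> (separating i j))"
  shows False
proof -
  let ?K = "separating i j" and ?A = "\<Inter> (separating i j)"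
  note f = finite_separating[of i j]
  have ch: "subset.chain ?K ?K" "subset.chain ?K (?K - {?A})"
    using chain unfolding subset.chain_def by blast+
  have A: "?A \<in> ?K" using Inter_in_chain[OF f ne ch(1)] .
  have U: "\<Union> ?K \<in> ?K" using Union_in_chain[OF f ne ch(1)] .
  obtain q where q: "q \<in> X - \<Union> ?K" "q \<noteq> j"
    using separatingD(1,4,6)[OF U] by blast
  have "i \<in> ?A" "j \<notin> ?A" "?A \<subseteq> X" using separatingD[OF A] by blast+
  \<comment> \<open>\<open>p\<close> is taken from the second smallest member and so lies in every
    member but \<open>?A\<close>. Without a second member the condition is void and \<open>q\<close>
    serves.\<close>
  obtain p where p: "p \<in> X - ?A - {j}" "\<And>C. C \<in> ?K \<Longrightarrow> C \<noteq> ?A \<Longrightarrow> p \<in> C"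
  proof (cases "?K - {?A} = {}")
    case True
    have "q \<in> X - ?A - {j}" using q A by auto
    moreover have "q \<in> C" if "C \<in> ?K" "C \<noteq> ?A" for C using True that by blast
    ultimately show ?thesis by (rule that)
  next
    case False
    have "finite (?K - {?A})" using f by simp
    then have B: "\<Inter> (?K - {?A}) \<in> ?K - {?A}" by (rule Inter_in_chain[OF _ False ch(2)])
    then have "\<Inter> (?K - {?A}) \<in> ?K" by blast
    note B' = separatingD(1,4)[OF this]
    have "?A \<subset> \<Inter> (?K - {?A})" using B by blast
    with B' obtain p where "p \<in> X - ?A - {j}" "p \<in> \<Inter> (?K - {?A})" by blast
    then show ?thesis using that[of p] by blast
  qed
  have "card {p, q} \<le> 2" by (simp add: card_insert_if)
  then have "card {p, q} \<le> k - 1" using k3 by linarith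
  \<comment> \<open>Avoiding \<open>j\<close> costs one element, so \<open>k\<close> elements
    outside \<open>?A\<close> are just enough.\<close>
  moreover have "k - 1 \<le> card (X - ?A - {j})"
    using big fin ij \<open>j \<notin> ?A\<close> by (subst card_Diff_singleton) auto
  moreover have "{p, q} \<subseteq> X - ?A - {j}" using p q A by auto
  ultimately obtain I where I: "{p, q} \<subseteq> I" "I \<subseteq> X - ?A - {j}" "card I = k - 1"
    using subset_between_card[of "X - ?A - {j}" "{p, q}" "k - 1"] fin by auto
  have "(\<Sum>C\<in>?K. h C * (of_bool (I \<inter> C = {}) - of_bool (I \<subseteq> C)))
      = (\<Sum>C\<in>{?A}. h C * (of_bool (I \<inter> C = {}) - of_bool (I \<subseteq> C)))"
  proof (rule sum.mono_neutral_right[OF f])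
    show "{?A} \<subseteq> ?K" using A by simp
    show "\<forall>C\<in>?K - {?A}. h C * (of_bool (I \<inter> C = {}) - of_bool (I \<subseteq> C)) = 0"
    proof
      fix C assume C: "C \<in> ?K - {?A}"
      then have "p \<in> C" "q \<notin> C" using p(2) q by auto
      then have "I \<inter> C \<noteq> {}" "\<not> I \<subseteq> C" using I(1) by auto
      then show "h C * (of_bool (I \<inter> C = {}) - of_bool (I \<subseteq> C)) = 0" by simp
    qed
  qed
  also have "\<dots> = h ?A"
  proof -
    have "I \<inter> ?A = {}" "\<not> I \<subseteq> ?A" using I(1,2) by auto
    then show ?thesis by simp
  qed
  finally have "h {i} - h {j} + h ?A = 0"
    using exchange_sum_separating[OF ij _ I(3)] I(2) \<open>i \<in> ?A\<close> by auto
  moreover have "h ?A \<noteq> 0" using separatingD(2)[OF A] .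
  ultimately show False using separating_singletons_eq[OF ij chain] by simp
qed

text \<open>If the smallest member has a large complement, \<open>separating_empty_aux\<close>
  applies at once. Otherwise the smallest member is itself large, hence so is the largest. The
  complement of the largest is the smallest member of \<open>separating j i\<close>, so the same
  lemma applies with \<open>i\<close> and \<open>j\<close> exchanged.\<close>

lemma separating_empty:
  assumes ij: "i \<in> X" "j \<in> X" "i \<noteq> j"
    and chain: "\<And>C D. C \<in> separating i j \<Longrightarrow> D \<in> separating i j \<Longrightarrow> C \<subseteq> D \<or> D \<subseteq> C"
    and big: "\<And>C. C \<in> separating i j \<Longrightarrow> k \<le> card C \<or> k \<le> card (X - C)"
  shows "separating i j = {}"
proof (rule ccontr)
  assume ne: "separating i j \<noteq> {}"
  let ?K = "separating i j" and ?L = "separating j i"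
  note f = finite_separating
  have ch: "subset.chain ?K ?K" using chain unfolding subset.chain_def by blast
  have A: "\<Inter> ?K \<in> ?K" using Inter_in_chain[OF f ne ch] .
  have sub: "C \<subseteq> X" if "C \<in> separating i j" for C i j using that unfolding separating_def by auto
  have chain': "C \<subseteq> D \<or> D \<subseteq> C" if "C \<in> ?L" "D \<in> ?L" for C D
    using chain[OF separating_compl[OF ij(2,1) that(1)] separating_compl[OF ij(2,1) that(2)]]
      sub[OF that(1)] sub[OF that(2)] by blast
  have ne': "?L \<noteq> {}" using separating_compl[OF ij(1,2) A] by auto
  have "subset.chain ?L ?L" using chain' unfolding subset.chain_def by blast
  then have B: "\<Inter> ?L \<in> ?L" using Inter_in_chain[OF f ne'] by blast
  have "X - (X - \<Inter> ?L) = \<Inter> ?L" using sub[OF B] by blast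
  have "k \<le> card (\<Inter> ?K)"
    using big[OF A] separating_empty_aux[OF ij chain ne] by blast
  also have "card (\<Inter> ?K) \<le> card (X - \<Inter> ?L)"
  proof (rule card_mono)
    have "X - \<Inter> ?L \<in> ?K" using separating_compl[OF ij(2,1) B] .
    then show "\<Inter> ?K \<subseteq> X - \<Inter> ?L" by blast
  qed (use fin in simp)
  finally show False
    using separating_empty_aux[OF ij(2,1) _ chain' ne'] ij(3) by blast
qed

end

section \<open>Laminar families of proper subsets\<close>

definition together :: "'a set set \<Rightarrow> 'a \<Rightarrow> 'a \<Rightarrow> bool" where
  "together \<Z> x y \<longleftrightarrow> x = y \<or> (\<exists>C\<in>\<Z>. x \<in> C \<and> y \<in> C)"

definition laminar_below :: "'a set \<Rightarrow> 'a set set \<Rightarrow> bool" where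
  "laminar_below B \<Z> \<longleftrightarrow> (\<forall>C\<in>\<Z>. C \<subset> B) \<and> (\<forall>C\<in>\<Z>. \<forall>D\<in>\<Z>. C \<inter> D = {} \<or> C \<subseteq> D \<or> D \<subseteq> C)"

lemma together_sym: "together \<Z> x y \<longleftrightarrow> together \<Z> y x"
  unfolding together_def by blast

text \<open>Two members through \<open>y\<close> are nested, and the larger one joins
  \<open>x\<close> to \<open>z\<close>. So \<open>together\<close> is an equivalence relation on a
  laminar family.\<close>

lemma together_trans:
  assumes "laminar_below B \<Z>" "together \<Z> x y" "together \<Z> y z"
  shows "together \<Z> x z"
proof (cases "x = y \<or> y = z")
  case False
  then obtain C D where "C \<in> \<Z>" "D \<in> \<Z>" "x \<in> C" "y \<in> C" "y \<in> D" "z \<in> D"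
    using assms(2,3) unfolding together_def by blast
  moreover from this have "C \<subseteq> D \<or> D \<subseteq> C"
    using assms(1) unfolding laminar_below_def by blast
  ultimately show ?thesis unfolding together_def by blast
qed (use assms in auto)

text \<open>The members through \<open>x\<close> form a finite chain, so their union is itself a
  member and hence not all of \<open>B\<close>.\<close>

lemma together_proper:
  assumes "finite B" "2 \<le> card B" "laminar_below B \<Z>" "x \<in> B"
  obtains y where "y \<in> B" "\<not> together \<Z> x y"
proof (cases "{C \<in> \<Z>. x \<in> C} = {}")
  case True
  have "B - {x} \<noteq> {}"
  proof
    assume "B - {x} = {}"
    then have "B = {x}" using assms by auto
    then show False using assms by simp
  qed
  then show ?thesis using that True unfolding together_def by blast
next
  case False
  let ?Y = "{C \<in> \<Z>. x \<in> C}"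
  have "subset.chain ?Y ?Y"
    using assms(3) unfolding laminar_below_def subset.chain_def by blast
  moreover have "finite ?Y"
    using assms(1,3) unfolding laminar_below_def by (auto intro: finite_subset[of _ "Pow B"])
  ultimately have U: "\<Union> ?Y \<in> ?Y" using Union_in_chain False by blast
  then have "\<Union> ?Y \<in> \<Z>" "x \<in> \<Union> ?Y" by simp_all
  moreover have "\<forall>C\<in>\<Z>. C \<subset> B" using assms(3) unfolding laminar_below_def by simp
  ultimately have "\<Union> ?Y \<subset> B" by (simp only: Ball_def)
  then obtain y where "y \<in> B" "y \<notin> \<Union> ?Y" by (meson psubset_imp_ex_mem DiffD1 DiffD2)
  then show ?thesis using that[of y] \<open>x \<in> \<Union> ?Y\<close> unfolding together_def by blast
qed

text \<open>The argument is the one showing that a group is not the union of two proper subgroups.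
  If \<open>y\<close> is apart from \<open>x\<close> only in the first relation and \<open>z\<close>
  only in the second, then \<open>y\<close> and \<open>z\<close> are apart in both.\<close>

lemma apart_in_both:
  assumes "finite B" "2 \<le> card B" "laminar_below B \<Z>" "laminar_below B \<Z>'"
  obtains x y where "x \<in> B" "y \<in> B" "\<not> together \<Z> x y" "\<not> together \<Z>' x y"
proof -
  obtain x where x: "x \<in> B" using assms(2) by fastforce
  obtain y where y: "y \<in> B" "\<not> together \<Z> x y" using together_proper[OF assms(1-3) x] .
  obtain z where z: "z \<in> B" "\<not> together \<Z>' x z" using together_proper[OF assms(1,2,4) x] .
  show ?thesis
  proof (cases "together \<Z>' x y \<and> together \<Z> x z")
    case True
    then have "\<not> together \<Z>' y z" "\<not> together \<Z> y z"
      using y z together_trans[OF assms(3)] together_trans[OF assms(4)] together_sym by metis+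
    then show ?thesis using that y z by blast
  qed (use that x y z in blast)
qed

text \<open>A split is represented by both of its sides, which carry the same value; the value 0
  means that the split is absent. The second clause is compatibility: some side of one split is
  disjoint from some side of the other.\<close>

definition split_system :: "'a set \<Rightarrow> nat \<Rightarrow> ('a set \<Rightarrow> real) \<Rightarrow> bool" where
  "split_system X k w \<longleftrightarrow> (\<forall>C\<subseteq>X. w (X - C) = w C) \<and>
     (\<forall>C\<subseteq>X. \<forall>D\<subseteq>X. w C \<noteq> 0 \<longrightarrow> w D \<noteq> 0 \<longrightarrow> C \<inter> D = {} \<or> C \<subseteq> D \<or> D \<subseteq> C \<or> C \<union> D = X) \<and>
     (\<forall>C\<subseteq>X. w C \<noteq> 0 \<longrightarrow> k \<le> card C \<or> k \<le> card (X - C))"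

lemma split_system_compat:
  "split_system X k w \<Longrightarrow> C \<subseteq> X \<Longrightarrow> D \<subseteq> X \<Longrightarrow> w C \<noteq> 0 \<Longrightarrow> w D \<noteq> 0 \<Longrightarrow>
    C \<inter> D = {} \<or> C \<subseteq> D \<or> D \<subseteq> C \<or> C \<union> D = X"
  unfolding split_system_def by blast

lemma split_system_big:
  "split_system X k w \<Longrightarrow> C \<subseteq> X \<Longrightarrow> w C \<noteq> 0 \<Longrightarrow> k \<le> card C \<or> k \<le> card (X - C)"
  unfolding split_system_def by blast

lemma laminar_below_split_system:
  assumes "split_system X k w" "B \<subset> X"
  shows "laminar_below B {C. C \<subset> B \<and> w C \<noteq> 0}"
  unfolding laminar_below_def
proof (intro conjI ballI)
  fix C D assume "C \<in> {C. C \<subset> B \<and> w C \<noteq> 0}" "D \<in> {C. C \<subset> B \<and> w C \<noteq> 0}"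
  then show "C \<inter> D = {} \<or> C \<subseteq> D \<or> D \<subseteq> C"
    using split_system_compat[OF assms(1), of C D] assms(2) by blast
qed auto

text \<open>Differing splits in the support of \<open>w\<close> are controlled by their
  compatibility with \<open>A\<close>. The others lie in the support of \<open>w'\<close> and are
  compatible among themselves. The two halves of the argument combine these facts inside and outside
  \<open>A\<close>. Singletons are exempt from minimality because they cancel in the second
  difference anyway.\<close>

lemma minimal_difference_False:
  fixes w w' :: "'a set \<Rightarrow> real" and X :: "'a set"
  assumes "null_split_sum X k (\<lambda>C. w C - w' C)"
    and S: "split_system X k w" and S': "split_system X k w'"
    and A: "A \<subseteq> X" "2 \<le> card A" "k \<le> card (X - A)" "w A \<noteq> 0" "w A \<noteq> w' A"
    and min: "\<And>C. C \<subset> A \<Longrightarrow> 2 \<le> card C \<Longrightarrow> w C = w' C"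
  shows False
proof -
  define h where "h = (\<lambda>C. w C - w' C)"
  have "null_split_sum X k h" using assms(1) by (simp only: h_def)
  then interpret null_split_sum X k h .
  have small: "\<exists>c. C = {c}" if "C \<subset> A" "C \<noteq> {}" "h C \<noteq> 0" for C
  proof -
    have "finite C" using that(1) A(1) finite_subset[OF _ fin, of C] by auto
    then have "card C \<noteq> 0" using that by auto
    moreover have "\<not> 2 \<le> card C" using min[OF that(1)] that(3) by (auto simp: h_def)
    ultimately have "card C = 1" by linarith
    then show ?thesis by (rule card_1_singletonE) blast
  qed
  have cross_w: "\<exists>c. C = {c} \<or> C = X - {c}"
    if C: "C \<subseteq> X" "h C \<noteq> 0" "w C \<noteq> 0" "C \<inter> A \<noteq> {}" "A - C \<noteq> {}" for C
  proof -
    consider "C \<subset> A" | "A \<union> C = X" using split_system_compat[OF S A(1) C(1) A(4) C(3)] C by blast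
    then show ?thesis
    proof cases
      case 1
      then show ?thesis using small C by blast
    next
      case 2
      then have "X - C \<subset> A" "X - C \<noteq> {}" using C A(1) by blast+
      then obtain c where "X - C = {c}" using small[of "X - C"] symm C by auto
      then have "C = X - {c}" using C(1) by blast
      then show ?thesis by blast
    qed
  qed
  \<comment> \<open>If \<open>i\<close> and \<open>j\<close> are elements of \<open>A\<close> on
    different sides of a nontrivial differing split, every member of \<open>separating i j\<close>
    also cuts \<open>A\<close>. By \<open>cross_w\<close> it then has \<open>w\<close>-weight 0 and
    belongs to \<open>w'\<close>. Compatible sets of one system that contain \<open>i\<close> and
    omit \<open>j\<close> are nested, so \<open>separating_empty\<close> applies.\<close>
  have cross: "\<exists>c. C = {c} \<or> C = X - {c}"
    if C: "C \<subseteq> X" "h C \<noteq> 0" "C \<inter> A \<noteq> {}" "A - C \<noteq> {}" for C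
  proof (rule ccontr)
    assume nex: "\<not> ?thesis"
    obtain i j where ij: "i \<in> C" "i \<in> A" "j \<in> A" "j \<notin> C" using C by blast
    then have ijX: "i \<in> X" "j \<in> X" "i \<noteq> j" using A by auto
    have sep: "D \<subseteq> X \<and> w' D \<noteq> 0 \<and> i \<in> D \<and> j \<notin> D" if D: "D \<in> separating i j" for D
    proof -
      have D': "D \<subseteq> X" "h D \<noteq> 0" "i \<in> D" "j \<notin> D" "D \<noteq> {i}" "D \<noteq> X - {j}"
        using D unfolding separating_def by auto
      have "D = {i}" if "D = {c}" for c using that D' by auto
      moreover have "D = X - {j}" if "D = X - {c}" for c using that D' ijX by auto
      ultimately have "\<nexists>c. D = {c} \<or> D = X - {c}" using D' by blast
      then have "w D = 0" using cross_w[of D] D' ij by blast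
      then show ?thesis using D' by (auto simp: h_def)
    qed
    have "C' \<subseteq> D \<or> D \<subseteq> C'" if "C' \<in> separating i j" "D \<in> separating i j" for C' D
      using split_system_compat[OF S', of C' D] sep[OF that(1)] sep[OF that(2)] ijX by blast
    moreover have "k \<le> card D \<or> k \<le> card (X - D)" if "D \<in> separating i j" for D
      using split_system_big[OF S'] sep[OF that] by simp
    ultimately have "separating i j = {}" using separating_empty[OF ijX] by blast
    moreover have "C \<in> separating i j" using C nex ij unfolding separating_def by blast
    ultimately show False by blast
  qed
  obtain i j where ij: "i \<in> A" "j \<in> A" "i \<noteq> j"
  proof -
    obtain I where "I \<subseteq> A" "card I = 2" using obtain_subset_with_card_n[OF A(2)] by blast
    then show ?thesis using that by (auto simp: card_2_iff)
  qed
  define B where "B = X - A"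
  have B: "B \<subset> X" "finite B" "k \<le> card B" "A \<inter> B = {}" "A \<union> B = X"
    using A(1,3) fin ij(1) unfolding B_def by auto
  \<comment> \<open>Splits inside \<open>B\<close> are not controlled by \<open>A\<close>. They are
    neutralized by a pair that no side strictly inside \<open>B\<close>, from either system,
    contains entirely.\<close>
  obtain b b' where b: "b \<in> B" "b' \<in> B" "\<not> together {C. C \<subset> B \<and> w C \<noteq> 0} b b'"
      "\<not> together {C. C \<subset> B \<and> w' C \<noteq> 0} b b'"
  proof (rule apart_in_both[OF B(2) _ laminar_below_split_system[OF S B(1)]
        laminar_below_split_system[OF S' B(1)]])
    show "2 \<le> card B" using B(3) k3 by linarith
  qed
  have bb: "b \<noteq> b'" using b(3) unfolding together_def by blast
  have apart: "\<not> (b \<in> C \<and> b' \<in> C)" if "C \<subset> B" "h C \<noteq> 0" for C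
  proof -
    have "w C \<noteq> 0 \<or> w' C \<noteq> 0" using that(2) by (auto simp: h_def)
    then show ?thesis using b(3,4) that(1) unfolding together_def by blast
  qed
  have "k - 2 \<le> card (B - {b, b'})" using B b bb by (simp add: card_Diff_subset)
  then obtain K where K: "K \<subseteq> B - {b, b'}" "card K = k - 2" "finite K"
    by (rule obtain_subset_with_card_n)
  have "K \<noteq> {}" using K(2) k3 by auto
  have nin: "i \<notin> K" "j \<notin> K" "b \<notin> K" "b' \<notin> K" "i \<noteq> b" "i \<noteq> b'" "j \<noteq> b" "j \<noteq> b'"
    using K(1) ij b B(4) by auto
  have sub: "insert i (insert b K) \<subseteq> X" "insert j (insert b' K) \<subseteq> X"
      "insert i (insert j K) \<subseteq> X" "insert b (insert b' K) \<subseteq> X"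
    using K(1) ij b B(5) by auto
  \<comment> \<open>Every element occurs equally often with either sign, which cancels the trivial
    splits. A set that misses \<open>A\<close> and does not contain both \<open>b\<close> and
    \<open>b'\<close> cancels too. The split \<open>{A, B}\<close> survives because only
    \<open>insert b (insert b' K)\<close> lies on one side of it;
    \<open>insert i (insert j K)\<close> is cut because \<open>K\<close> is nonempty.\<close>
  define q :: "'a set \<Rightarrow> real" where
    "q C = of_bool (cuts C (insert i (insert b K))) + of_bool (cuts C (insert j (insert b' K)))
      - of_bool (cuts C (insert i (insert j K))) - of_bool (cuts C (insert b (insert b' K)))" for C
  have q_compl: "q (X - C) = q C" for C
    unfolding q_def using sub by (simp add: cuts_compl)
  have cd: "card (insert i (insert b K)) = k" "card (insert j (insert b' K)) = k"
      "card (insert i (insert j K)) = k" "card (insert b (insert b' K)) = k"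
    using K nin bb ij(3) k3 by auto
  have "(\<Sum>C\<in>Pow X. h C * q C) = 0"
    using null[OF sub(1) cd(1)] null[OF sub(2) cd(2)] null[OF sub(3) cd(3)] null[OF sub(4) cd(4)]
    unfolding q_def by (simp add: algebra_simps sum.distrib sum_subtractf)
  moreover have "(\<Sum>C\<in>Pow X. h C * q C) = (\<Sum>C\<in>{A, B}. h C * q C)"
  proof (rule sum.mono_neutral_right)
    show "finite (Pow X)" using fin by simp
    show "{A, B} \<subseteq> Pow X" using A B by auto
    show "\<forall>C\<in>Pow X - {A, B}. h C * q C = 0"
    proof
      fix C assume C: "C \<in> Pow X - {A, B}"
      have single: "q {c} = 0" for c
        using nin bb ij(3) \<open>K \<noteq> {}\<close> unfolding q_def cuts_def by (auto simp: of_bool_def)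
      have disj: "q D = 0" if "D \<inter> A = {}" "\<not> (b \<in> D \<and> b' \<in> D)" for D
      proof -
        have "i \<notin> D" "j \<notin> D" using that ij by auto
        then show ?thesis using that(2) unfolding q_def cuts_def by (auto simp: of_bool_def)
      qed
      have "q C = 0" if hC: "h C \<noteq> 0"
      proof -
        consider c where "C = {c}" | c where "C = X - {c}" | "C \<inter> A = {}" | "A \<subseteq> C"
          using cross[of C] C hC by blast
        then show ?thesis
        proof cases
          case 3
          then have "C \<subset> B" using C B by auto
          then show ?thesis using disj[OF 3] apart hC by blast
        next
          case 4
          then have "X - C \<subset> B" "(X - C) \<inter> A = {}" using C B by auto
          then show ?thesis using disj[of "X - C"] apart[of "X - C"] hC symm[of C] C q_compl by auto
        qed (auto simp: single q_compl)
      qed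
      then show "h C * q C = 0" by auto
    qed
  qed
  moreover have "q A = 1"
  proof -
    have "b \<notin> A" "b' \<notin> A" "K \<inter> A = {}" using b K B(4) by auto
    then show ?thesis using ij \<open>K \<noteq> {}\<close> unfolding q_def cuts_def by (auto simp: of_bool_def)
  qed
  moreover have "q B = q A" "h B = h A" unfolding B_def using q_compl symm A(1) by auto
  moreover have "A \<noteq> B" using B(4) ij by auto
  ultimately have "h A = 0" by simp
  then show False using A(5) by (simp add: h_def)
qed

text \<open>\<open>{}\<close> and \<open>X\<close> are never cut, so the sums say nothing about
  their values; this is why \<open>C\<close> is assumed to be proper and nonempty.\<close>

theorem split_system_unique:
  fixes w w' :: "'a set \<Rightarrow> real" and X :: "'a set"
  assumes fin: "finite X" and k3: "3 \<le> k" and kX: "k < card X"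
    and S: "split_system X k w" and S': "split_system X k w'"
    and eq: "\<And>I. I \<subseteq> X \<Longrightarrow> card I = k \<Longrightarrow>
      (\<Sum>C\<in>Pow X. w C * of_bool (cuts C I)) = (\<Sum>C\<in>Pow X. w' C * of_bool (cuts C I))"
    and C: "C \<subseteq> X" "C \<noteq> {}" "C \<noteq> X"
  shows "w C = w' C"
proof -
  have symm: "w (X - C) = w C" "w' (X - C) = w' C" if "C \<subseteq> X" for C
    using S S' that unfolding split_system_def by auto
  have N': "null_split_sum X k (\<lambda>C. w' C - w C)"
    by unfold_locales (simp_all add: fin k3 kX symm eq left_diff_distrib sum_subtractf del: sum_mult_of_bool_eq)
  interpret null_split_sum X k "\<lambda>C. w C - w' C"
    by unfold_locales (simp_all add: fin k3 kX symm eq left_diff_distrib sum_subtractf del: sum_mult_of_bool_eq)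
  have small: "w A = w' A" if "A \<subseteq> X" "2 \<le> card A" "k \<le> card (X - A)" for A
    using that
  proof (induction "card A" arbitrary: A rule: less_induct)
    case less
    have finA: "finite A" using less.prems(1) fin finite_subset by blast
    have min: "w C = w' C" if "C \<subset> A" "2 \<le> card C" for C
    proof (rule less.hyps)
      show "card C < card A" using that(1) finA psubset_card_mono by blast
      have "card (X - A) \<le> card (X - C)" using that(1) fin by (intro card_mono) auto
      then show "k \<le> card (X - C)" using less.prems by linarith
    qed (use that less.prems in auto)
    show ?case
    proof (rule ccontr)
      assume ne: "w A \<noteq> w' A"
      then consider "w A \<noteq> 0" | "w' A \<noteq> 0" by fastforce
      then show False
      proof cases
        case 1
        then show False
          using minimal_difference_False[OF null_split_sum_axioms S S' less.prems 1 ne] min by blast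
      next
        \<comment> \<open>\<open>minimal_difference_False\<close> wants \<open>A\<close> in the
          support of its first system, so the two systems trade places here.\<close>
        case 2
        then show False
          using minimal_difference_False[OF N' S' S less.prems 2] ne[symmetric] min[symmetric] by blast
      qed
    qed
  qed
  have nonsingleton: "w A = w' A" if A: "A \<subseteq> X" "2 \<le> card A" "2 \<le> card (X - A)" for A
  proof -
    have XA: "X - (X - A) = A" using A(1) by blast
    consider "k \<le> card (X - A)" | "k \<le> card A" | "w A = 0 \<and> w' A = 0"
      using split_system_big[OF S A(1)] split_system_big[OF S' A(1)] by metis
    then show ?thesis
    proof cases
      case 2
      then show ?thesis using small[of "X - A"] A symm[of A] by (simp add: XA)
    qed (use small A in auto)
  qed
  have sep_empty: "separating i j = {}" if "i \<in> X" "j \<in> X" "i \<noteq> j" for i j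
  proof (rule ccontr)
    assume "separating i j \<noteq> {}"
    then obtain D where D: "D \<subseteq> X" "w D \<noteq> w' D" "i \<in> D" "j \<notin> D" "D \<noteq> {i}" "D \<noteq> X - {j}"
      unfolding separating_def by auto
    have two: "2 \<le> card Y" if "finite Y" "x \<in> Y" "Y \<noteq> {x}" for Y and x :: 'a
    proof -
      have "card Y \<noteq> 0" "card Y \<noteq> 1" using that by (auto simp: card_1_singleton_iff)
      then show ?thesis by linarith
    qed
    have "X - D \<noteq> {j}" using D that by blast
    then have "2 \<le> card D" "2 \<le> card (X - D)"
      using two[of D i] two[of "X - D" j] D that fin finite_subset[of D X] by auto
    then show False using nonsingleton D by blast
  qed
  \<comment> \<open>With all nontrivial differences gone, an exchange compares just two trivial
    splits and shows that their errors agree.\<close>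
  have const: "w {i} - w' {i} = w {j} - w' {j}" if "i \<in> X" "j \<in> X" for i j
    using separating_singletons_eq[of i j] sep_empty that by (cases "i = j") auto
  \<comment> \<open>The common error occurs once for each element of \<open>I\<close> and each side
    of its split, so one k-subset forces \<open>2 * k\<close> times the error to vanish.\<close>
  have singleton: "w {c} = w' {c}" if c: "c \<in> X" for c
  proof -
    obtain I where I: "I \<subseteq> X" "card I = k" "finite I"
      using obtain_subset_with_card_n[of k X] kX by auto
    let ?S = "(\<lambda>c. {c}) ` X" and ?T = "(\<lambda>c. X - {c}) ` X"
    have card1: "card (X - {c}) = card X - 1" if "c \<in> X" for c using that fin by simp
    have "(\<Sum>C\<in>Pow X. (w C - w' C) * of_bool (cuts C I)) =
        (\<Sum>C\<in>?S \<union> ?T. (w C - w' C) * of_bool (cuts C I))"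
    proof (rule sum.mono_neutral_right)
      show "\<forall>C\<in>Pow X - (?S \<union> ?T). (w C - w' C) * of_bool (cuts C I) = 0"
      proof
        fix C assume C: "C \<in> Pow X - (?S \<union> ?T)"
        have "w C = w' C" if "cuts C I"
        proof (rule ccontr)
          assume ne: "w C \<noteq> w' C"
          obtain i j where "i \<in> C" "j \<in> X - C" using \<open>cuts C I\<close> I(1) unfolding cuts_def by blast
          then have "C \<in> separating i j" using C ne unfolding separating_def by auto
          then show False using sep_empty \<open>i \<in> C\<close> \<open>j \<in> X - C\<close> C by blast
        qed
        then show "(w C - w' C) * of_bool (cuts C I) = 0" by auto
      qed
    qed (use fin in auto)
    also have "\<dots> = (\<Sum>C\<in>?S. (w C - w' C) * of_bool (cuts C I)) + (\<Sum>C\<in>?T. (w C - w' C) * of_bool (cuts C I))"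
    proof (rule sum.union_disjoint)
      have "{i} \<noteq> X - {j}" if "i \<in> X" "j \<in> X" for i j
      proof
        assume "{i} = X - {j}"
        then have "card {i} = card X - 1" using card1[OF that(2)] by simp
        then show False using kX k3 by simp
      qed
      then show "?S \<inter> ?T = {}" by auto
    qed (use fin in auto)
    also have "(\<Sum>C\<in>?T. (w C - w' C) * of_bool (cuts C I)) =
        (\<Sum>C\<in>?S. (w C - w' C) * of_bool (cuts C I))"
    proof (rule sum.reindex_bij_witness[of _ "\<lambda>C. X - C" "\<lambda>C. X - C"])
      fix C assume "C \<in> ?T"
      then have "C \<subseteq> X" by auto
      then show "(w (X - C) - w' (X - C)) * of_bool (cuts (X - C) I) = (w C - w' C) * of_bool (cuts C I)"
        using symm cuts_compl[OF I(1)] by simp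
    qed auto
    also have "(\<Sum>C\<in>?S. (w C - w' C) * of_bool (cuts C I)) =
        (\<Sum>i\<in>X. (w {i} - w' {i}) * of_bool (cuts {i} I))"
      by (subst sum.reindex) auto
    also have "\<dots> = (\<Sum>i\<in>X. (w {c} - w' {c}) * of_bool (i \<in> I))"
    proof (rule sum.cong[OF refl])
      fix i assume "i \<in> X"
      have "I - {i} \<noteq> {}"
      proof
        assume "I - {i} = {}"
        then have "card I \<le> card {i}" by (intro card_mono) auto
        then show False using I(2) k3 by simp
      qed
      then have "cuts {i} I \<longleftrightarrow> i \<in> I" unfolding cuts_def by blast
      then show "(w {i} - w' {i}) * of_bool (cuts {i} I) = (w {c} - w' {c}) * of_bool (i \<in> I)"
        using const[OF \<open>i \<in> X\<close> c] by simp
    qed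
    also have "\<dots> = (w {c} - w' {c}) * real k"
    proof -
      have "X \<inter> I = I" using I(1) by blast
      then show ?thesis using fin I by (simp add: sum_distrib_left[symmetric] of_bool_def sum.If_cases Int_def)
    qed
    finally show ?thesis using null[OF I(1,2)] k3 by simp
  qed
  have finC: "finite C" "finite (X - C)" using C fin finite_subset by auto
  consider "2 \<le> card C \<and> 2 \<le> card (X - C)" | "card C = 1" | "card (X - C) = 1"
  proof -
    have "card C \<noteq> 0" "card (X - C) \<noteq> 0" using C finC by auto
    then show ?thesis using that by linarith
  qed
  then show ?thesis
  proof cases
    case 2
    then show ?thesis using singleton C(1) by (auto simp: card_1_singleton_iff)
  next
    case 3
    then obtain c where "X - C = {c}" by (auto simp: card_1_singleton_iff)
    moreover from this have "c \<in> X" by blast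
    ultimately show ?thesis using singleton[of c] symm[OF C(1)] by auto
  qed (use nonsingleton C in auto)
qed

section \<open>Connectivity and trees\<close>

text \<open>Reachability over a bare edge set, without vertex set or path lists. Deleting an edge
  becomes set difference, and enlarging the edge set is plain monotonicity.\<close>

definition conn :: "'a set set \<Rightarrow> 'a \<Rightarrow> 'a \<Rightarrow> bool" where
  "conn F = (\<lambda>x y. {x, y} \<in> F)\<^sup>*\<^sup>*"

lemma conn_refl [simp]: "conn F x x"
  unfolding conn_def by simp

lemma conn_edge: "{x, y} \<in> F \<Longrightarrow> conn F x y"
  unfolding conn_def by auto

lemma conn_trans: "conn F x y \<Longrightarrow> conn F y z \<Longrightarrow> conn F x z"
  unfolding conn_def by (rule rtranclp_trans)

lemma conn_sym: "conn F x y \<Longrightarrow> conn F y x"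
  unfolding conn_def
  by (rule sympD[OF symp_rtranclp]) (auto simp: symp_def insert_commute)

lemma conn_commute: "conn F x y \<longleftrightarrow> conn F y x"
  using conn_sym by metis

lemma conn_induct [consumes 1, case_names base step]:
  assumes "conn F x y" "P x"
    "\<And>y z. conn F x y \<Longrightarrow> {y, z} \<in> F \<Longrightarrow> P y \<Longrightarrow> P z"
  shows "P y"
  using assms(1) unfolding conn_def
proof (induction rule: rtranclp_induct)
  case (step y z)
  then show ?case using assms(3) unfolding conn_def by blast
qed (rule assms(2))

lemma conn_mono: "conn F x y \<Longrightarrow> F \<subseteq> G \<Longrightarrow> conn G x y"
proof (induction rule: conn_induct)
  case (step y z)
  then show ?case using conn_trans[of G x y z] conn_edge[of y z G] by blast
qed simp

lemma conn_first_edge: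
  assumes "conn F x y" "x \<noteq> y"
  obtains z where "{x, z} \<in> F"
proof -
  have "x \<noteq> y \<longrightarrow> (\<exists>z. {x, z} \<in> F)"
    using assms(1)
  proof (induction rule: conn_induct)
    case (step y z)
    then show ?case by (cases "x = y") auto
  qed simp
  then show ?thesis using assms(2) that by blast
qed

text \<open>Up to the first use of \<open>g\<close> the connection avoids \<open>g\<close>, and
  there it stands at an end of \<open>g\<close>.\<close>

lemma conn_remove:
  assumes "conn F x y"
  shows "conn (F - {g}) x y \<or> (\<exists>c\<in>g. conn (F - {g}) x c)"
  using assms
proof (induction rule: conn_induct)
  case (step y z)
  show ?case
  proof (cases "conn (F - {g}) x y \<and> {y, z} \<noteq> g")
    case True
    then have "{y, z} \<in> F - {g}" using step(2) by simp
    then show ?thesis using True conn_trans conn_edge by metis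
  next
    case False
    show ?thesis
    proof (cases "conn (F - {g}) x y")
      case True
      then have "y \<in> g" using False by auto
      then show ?thesis using True by blast
    qed (use step in simp)
  qed
qed simp

lemma ugraph_edgeE:
  assumes "ugraph G" "e \<in> edges G"
  obtains a b where "e = {a, b}" "a \<noteq> b" "a \<in> verts G" "b \<in> verts G"
proof -
  have "e \<subseteq> verts G" "card e = 2" using assms unfolding ugraph_def by auto
  then show ?thesis using that by (auto simp: card_2_iff)
qed

lemma ugraph_edgeD:
  assumes "ugraph G" "{a, b} \<in> edges G"
  shows "a \<noteq> b" "a \<in> verts G" "b \<in> verts G"
proof -
  have "{a, b} \<subseteq> verts G" "card {a, b} = 2" using assms unfolding ugraph_def by auto
  then show "a \<noteq> b" "a \<in> verts G" "b \<in> verts G" by auto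
qed

lemma ugraph_finite: "ugraph G \<Longrightarrow> finite (verts G)" "ugraph G \<Longrightarrow> finite (edges G)"
proof -
  assume G: "ugraph G"
  show "finite (verts G)" using G unfolding ugraph_def by simp
  moreover have "edges G \<subseteq> Pow (verts G)" using G unfolding ugraph_def by auto
  ultimately show "finite (edges G)" by (auto intro: finite_subset)
qed

lemma path_conn:
  assumes "is_path G p" "i < length p"
  shows "conn (edges G) (p ! 0) (p ! i)"
  using assms(2)
proof (induction i)
  case (Suc i)
  then have "{p ! i, p ! Suc i} \<in> edges G" using assms(1) unfolding is_path_def by simp
  then show ?case using Suc by (auto intro: conn_trans conn_edge)
qed simp

lemma conn_path:
  assumes "ugraph G" "conn (edges G) u v" "u \<in> verts G"
  shows "\<exists>p. is_path G p \<and> hd p = u \<and> last p = v"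
  using assms(2,3)
proof (induction rule: conn_induct)
  case base
  then show ?case by (intro exI[of _ "[u]"]) (simp add: is_path_def)
next
  case (step y z)
  then obtain p where p: "is_path G p" "hd p = u" "last p = y" by blast
  then have ne: "p \<noteq> []" unfolding is_path_def by blast
  show ?case
  \<comment> \<open>If the new vertex already lies on the path, the path is cut there instead of
    being extended, which keeps it free of repetitions.\<close>
  proof (cases "z \<in> set p")
    case True
    then obtain i where i: "i < length p" "p ! i = z" by (auto simp: in_set_conv_nth)
    have "is_path G (take (Suc i) p)"
      using p(1) i(1) unfolding is_path_def by (auto dest: in_set_takeD)
    moreover have "hd (take (Suc i) p) = u" using p(2) ne by simp
    moreover have "last (take (Suc i) p) = z" using i by (simp add: take_Suc_conv_app_nth)
    ultimately show ?thesis by blast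
  next
    case False
    have "{p ! (length p - 1), z} \<in> edges G" using step(2) p(3) ne by (simp add: last_conv_nth)
    moreover have "z \<in> verts G" using ugraph_edgeD[OF assms(1) step(2)] by simp
    ultimately have "is_path G (p @ [z])"
      using p(1) False ne unfolding is_path_def
      by (auto simp: nth_append less_Suc_eq)
        (metis One_nat_def diff_Suc_1 less_antisym not_less_eq)+
    moreover have "hd (p @ [z]) = u" "last (p @ [z]) = z" using p(2) ne by auto
    ultimately show ?thesis by blast
  qed
qed

lemma connects_iff:
  assumes "ugraph G"
  shows "connects G u v \<longleftrightarrow> u \<in> verts G \<and> conn (edges G) u v"
proof
  assume "connects G u v"
  then obtain p where p: "is_path G p" "hd p = u" "last p = v" unfolding connects_def by blast
  then have "p \<noteq> []" "set p \<subseteq> verts G" unfolding is_path_def by auto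
  then show "u \<in> verts G \<and> conn (edges G) u v"
    using path_conn[OF p(1), of "length p - 1"] p by (auto simp: hd_conv_nth last_conv_nth)
next
  assume "u \<in> verts G \<and> conn (edges G) u v"
  then show "connects G u v" using conn_path[OF assms] unfolding connects_def by blast
qed

lemma ugraph_delete_edge: "ugraph G \<Longrightarrow> ugraph (delete_edge G e)"
  unfolding ugraph_def delete_edge_def by auto

text \<open>A cycle without its closing edge is a path between the ends of that edge. Conversely, a
  path joining the ends of an edge without using it has at least three vertices and closes up.
  Acyclicity thus becomes the condition that every edge is a bridge.\<close>

lemma is_cycle_bridge:
  assumes "ugraph G"
  shows "(\<exists>p. is_cycle G p) \<longleftrightarrow> (\<exists>a b. {a, b} \<in> edges G \<and> conn (edges G - {{a, b}}) a b)"
proof (intro iffI; elim exE conjE)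
  fix p assume "is_cycle G p"
  then have p: "is_path G p" "3 \<le> length p" "{last p, hd p} \<in> edges G"
    unfolding is_cycle_def by auto
  then have d: "distinct p" "p \<noteq> []" unfolding is_path_def by auto
  let ?e = "{p ! 0, p ! (length p - 1)}"
  have "is_path (delete_edge G ?e) p"
    unfolding is_path_def
  proof (intro conjI allI impI)
    fix i assume i: "Suc i < length p"
    have "{p ! i, p ! Suc i} \<noteq> ?e"
    proof
      assume "{p ! i, p ! Suc i} = ?e"
      then consider "p ! i = p ! 0" "p ! Suc i = p ! (length p - 1)"
        | "p ! i = p ! (length p - 1)" "p ! Suc i = p ! 0"
        by (auto simp: doubleton_eq_iff)
      then show False
        by cases (use d i p(2) in \<open>auto simp: nth_eq_iff_index_eq\<close>)
    qed
    then show "{p ! i, p ! Suc i} \<in> edges (delete_edge G ?e)"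
      using p(1) i unfolding is_path_def delete_edge_def by simp
  qed (use p(1) in \<open>auto simp: is_path_def delete_edge_def\<close>)
  then have "conn (edges (delete_edge G ?e)) (p ! 0) (p ! (length p - 1))"
    using path_conn d(2) by (metis diff_less length_greater_0_conv zero_less_one)
  then have "conn (edges G - {?e}) (p ! 0) (p ! (length p - 1))" by (simp add: delete_edge_def)
  moreover have "?e \<in> edges G"
    using p(3) d(2) by (simp add: hd_conv_nth last_conv_nth insert_commute)
  ultimately show "\<exists>a b. {a, b} \<in> edges G \<and> conn (edges G - {{a, b}}) a b" by blast
next
  fix a b assume ab: "{a, b} \<in> edges G" "conn (edges G - {{a, b}}) a b"
  let ?G = "delete_edge G {a, b}"
  have "a \<in> verts G" "a \<noteq> b" using ugraph_edgeD[OF assms ab(1)] by auto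
  then obtain p where p: "is_path ?G p" "hd p = a" "last p = b"
    using conn_path[OF ugraph_delete_edge[OF assms], of "{a, b}" a b] ab(2)
    by (auto simp: delete_edge_def)
  then have ne: "p \<noteq> []" unfolding is_path_def by blast
  have "length p \<noteq> 1"
    using p \<open>a \<noteq> b\<close> by (auto simp: length_Suc_conv)
  moreover have "length p \<noteq> 2"
  proof
    assume l: "length p = 2"
    then have "{p ! 0, p ! 1} \<in> edges ?G" using p(1) unfolding is_path_def by simp
    then show False using p(2,3) ne l by (simp add: delete_edge_def hd_conv_nth last_conv_nth)
  qed
  ultimately have "3 \<le> length p" using ne by (cases p rule: remdups_adj.cases) (auto simp: Suc_le_eq)
  moreover have "is_path G p" using p(1) unfolding is_path_def delete_edge_def by auto
  ultimately have "is_cycle G p" using ab(1) p unfolding is_cycle_def by (simp add: insert_commute)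
  then show "\<exists>p. is_cycle G p" by blast
qed

lemma is_tree_iff:
  "is_tree T \<longleftrightarrow> ugraph T \<and> verts T \<noteq> {} \<and>
     (\<forall>u\<in>verts T. \<forall>v\<in>verts T. conn (edges T) u v) \<and>
     (\<forall>a b. {a, b} \<in> edges T \<longrightarrow> \<not> conn (edges T - {{a, b}}) a b)"
  unfolding is_tree_def by (rule conj_cong[OF refl]) (simp add: is_cycle_bridge connects_iff)

section \<open>The two sides of an edge of a tree\<close>

locale tree =
  fixes T :: "('a, 'b) ugraph_scheme"
  assumes tree: "is_tree T"
begin

abbreviation "V \<equiv> verts T"
abbreviation "E \<equiv> edges T"
abbreviation "same e \<equiv> conn (E - {e})"

lemma ugraph: "ugraph T"
  and nonempty: "V \<noteq> {}"
  and connected: "u \<in> V \<Longrightarrow> v \<in> V \<Longrightarrow> conn E u v"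
  and bridge: "{a, b} \<in> E \<Longrightarrow> \<not> same {a, b} a b"
  using tree unfolding is_tree_iff by simp_all

lemmas finite_verts = ugraph_finite(1)[OF ugraph]
lemmas finite_edges = ugraph_finite(2)[OF ugraph]
lemmas edgeE = ugraph_edgeE[OF ugraph]
lemmas edgeD = ugraph_edgeD[OF ugraph]

lemma edge_other_end:
  assumes "e \<in> E" "x \<in> e"
  obtains y where "e = {x, y}" "x \<noteq> y" "x \<in> V" "y \<in> V"
proof -
  obtain a b where "e = {a, b}" "a \<noteq> b" "a \<in> V" "b \<in> V" using edgeE[OF assms(1)] .
  then show ?thesis using assms(2) that[of a] that[of b] by auto
qed

lemma edge_same: "{u, v} \<in> E \<Longrightarrow> {u, v} \<noteq> g \<Longrightarrow> same g u v"
  by (intro conn_edge) simp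

lemma edge_ends_same:
  assumes "e \<in> E" "e \<noteq> g" "u \<in> e" "v \<in> e"
  shows "same g u v"
proof (cases "u = v")
  case False
  obtain y where "e = {u, y}" using edge_other_end[OF assms(1,3)] .
  then have "e = {u, v}" using False assms(4) by auto
  then show ?thesis using edge_same assms(1,2) by simp
qed simp

lemma two_sides:
  assumes "{a, b} \<in> E" "v \<in> V"
  shows "same {a, b} a v \<or> same {a, b} b v"
proof -
  have "conn E v a" by (rule connected[OF assms(2) edgeD(2)[OF assms(1)]])
  then have "same {a, b} v a \<or> (\<exists>c\<in>{a, b}. same {a, b} v c)" by (rule conn_remove)
  then show ?thesis using conn_commute[of _ v] by simp
qed

lemma third_side:
  assumes "e \<in> E" "u \<in> V" "v \<in> V" "w \<in> V" "\<not> same e u v" "\<not> same e v w"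
  shows "same e u w"
proof -
  obtain a b where e: "e = {a, b}" using edgeE[OF assms(1)] by metis
  have s: "same e a x \<or> same e b x" if "x \<in> V" for x
    using two_sides[of a b x] that assms(1) e by simp
  show ?thesis
    using s[OF assms(2)] s[OF assms(3)] s[OF assms(4)] assms(5,6)
      conn_trans[of "E - {e}"] conn_sym[of "E - {e}"] by metis
qed

text \<open>One end of \<open>g\<close> outside the component of \<open>x\<close> left by deleting
  \<open>e\<close> puts all of \<open>g\<close> outside it. That component is therefore untouched
  when \<open>g\<close> is deleted instead. Comparisons of two edges rest on this.\<close>

lemma nest:
  assumes "g \<in> E" "e \<noteq> g" "c \<in> g" "\<not> same e x c" "same e x u"
  shows "same g x u"
proof -
  have "conn (E - {e} - {g}) x u \<or> (\<exists>c'\<in>g. conn (E - {e} - {g}) x c')"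
    using assms(5) by (rule conn_remove)
  then show ?thesis
  proof
    assume "conn (E - {e} - {g}) x u"
    then show ?thesis by (rule conn_mono) auto
  next
    assume "\<exists>c'\<in>g. conn (E - {e} - {g}) x c'"
    then obtain c' where c': "c' \<in> g" "conn (E - {e} - {g}) x c'" by blast
    have "same e x c'" using c'(2) by (rule conn_mono) auto
    moreover have "same e c' c" using edge_ends_same[OF assms(1) _ c'(1) assms(3)] assms(2) by auto
    ultimately have "same e x c" by (rule conn_trans)
    then show ?thesis using assms(4) by simp
  qed
qed

section \<open>The subtree spanned by a set of vertices\<close>

definition separates :: "'a set \<Rightarrow> 'a set \<Rightarrow> bool" where
  "separates e I \<longleftrightarrow> (\<exists>i\<in>I. \<exists>j\<in>I. \<not> same e i j)"

text \<open>These edges form the path from \<open>i\<close> to \<open>j\<close>, described without a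
  path. In the induction, a step along \<open>?e\<close> either leaves the side of \<open>i\<close>,
  and then \<open>?e\<close> becomes separating, or it returns across \<open>?e\<close>. In the
  second case the connection built so far is cut off before its first use of
  \<open>?e\<close>.\<close>

lemma conn_separating_edges:
  assumes "i \<in> V" "j \<in> V"
  shows "conn {e \<in> E. \<not> same e i j} i j"
proof -
  have "conn E i j" using connected assms by simp
  then show ?thesis
  proof (induction rule: conn_induct)
    case (step j k)
    let ?e = "{j, k}" and ?H = "\<lambda>j. {e \<in> E. \<not> same e i j}"
    have jV: "j \<in> V" "k \<in> V" "i \<in> V" using edgeD[OF step(2)] assms(1) by auto
    have other: "same g i j \<longleftrightarrow> same g i k" if "g \<noteq> ?e" for g
    proof -
      have "same g j k" using edge_same[OF step(2)] that by blast
      then show ?thesis using conn_trans[of "E - {g}"] conn_sym[of "E - {g}"] by metis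
    qed
    show ?case
    proof (cases "same ?e i j")
      case True
      have "\<not> same ?e i k"
      proof
        assume "same ?e i k"
        then have "same ?e j k" using True conn_trans conn_sym by metis
        then show False using bridge[OF step(2)] by simp
      qed
      then have "?e \<in> ?H k" using step(2) by simp
      moreover have "?H j \<subseteq> ?H k"
      proof
        fix g assume g: "g \<in> ?H j"
        then have "g \<noteq> ?e" using True by auto
        then show "g \<in> ?H k" using g other by simp
      qed
      ultimately show ?thesis
        using conn_mono[OF step(3), of "?H k"] conn_edge[of j k "?H k"] conn_trans[of "?H k" i j k]
        by simp
    next
      case False
      have "conn (?H j - {?e}) i j \<or> (\<exists>c\<in>?e. conn (?H j - {?e}) i c)"
        using step(3) by (rule conn_remove)
      moreover have "\<not> conn (?H j - {?e}) i j"
      proof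
        assume "conn (?H j - {?e}) i j"
        then have "same ?e i j" by (rule conn_mono) auto
        then show False using False by simp
      qed
      ultimately have "conn (?H j - {?e}) i k" by blast
      moreover have "?H j - {?e} \<subseteq> ?H k" using other by auto
      ultimately show ?thesis by (rule conn_mono)
    qed
  qed simp
qed

text \<open>The set \<open>I\<close> is added to the vertices because no edge separates a
  one-element \<open>I\<close>.\<close>

definition spanned :: "'a set \<Rightarrow> 'a ugraph" where
  "spanned I = \<lparr>verts = I \<union> \<Union> {e \<in> E. separates e I}, edges = {e \<in> E. separates e I}\<rparr>"

lemma conn_spanned:
  assumes "I \<subseteq> V" "i \<in> I" "j \<in> I"
  shows "conn {e \<in> E. separates e I} i j"
proof (rule conn_mono[OF conn_separating_edges])
  show "{e \<in> E. \<not> same e i j} \<subseteq> {e \<in> E. separates e I}"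
    using assms(2,3) unfolding separates_def by blast
qed (use assms in auto)

lemma is_tree_spanned:
  assumes I: "I \<subseteq> V" "I \<noteq> {}"
  shows "is_tree (spanned I)"
proof -
  let ?H = "{e \<in> E. separates e I}"
  have ev: "e \<subseteq> V" if "e \<in> E" for e using that ugraph unfolding ugraph_def by blast
  have sub: "verts (spanned I) \<subseteq> V" using I(1) ev unfolding spanned_def by auto
  have u: "ugraph (spanned I)"
    using ugraph finite_subset[OF sub] unfolding ugraph_def spanned_def by auto
  obtain i0 where i0: "i0 \<in> I" using I(2) by blast
  have c0: "conn ?H i0 v" if v: "v \<in> verts (spanned I)" for v
  proof (cases "v \<in> I")
    case True
    then show ?thesis using conn_spanned[OF I(1) i0] by simp
  next
    case False
    then obtain e where e: "v \<in> e" "e \<in> E" "separates e I" using v unfolding spanned_def by auto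
    then obtain i j where ij: "i \<in> I" "j \<in> I" "\<not> same e i j" unfolding separates_def by blast
    let ?S = "{e \<in> E. \<not> same e i j}"
    have "conn ?S i j" using conn_separating_edges ij I(1) by blast
    then have "conn (?S - {e}) i j \<or> (\<exists>c\<in>e. conn (?S - {e}) i c)" by (rule conn_remove)
    moreover have "\<not> conn (?S - {e}) i j"
    proof
      assume "conn (?S - {e}) i j"
      then have "same e i j" by (rule conn_mono) auto
      then show False using ij by simp
    qed
    ultimately obtain c where c: "c \<in> e" "conn (?S - {e}) i c" by blast
    have ic: "conn ?H i c"
      using c(2) by (rule conn_mono) (use ij in \<open>auto simp: separates_def\<close>)
    have cv: "conn ?H c v"
    proof -
      obtain y where "e = {c, y}" using edge_other_end[OF e(2) c(1)] by metis
      then show ?thesis using e by (cases "v = c") (auto intro: conn_edge)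
    qed
    show ?thesis by (rule conn_trans[OF conn_trans[OF conn_spanned[OF I(1) i0 ij(1)] ic] cv])
  qed
  have "conn ?H u v" if "u \<in> verts (spanned I)" "v \<in> verts (spanned I)" for u v
    by (rule conn_trans[OF conn_sym[OF c0[OF that(1)]] c0[OF that(2)]])
  moreover have "\<not> conn (?H - {{a, b}}) a b" if "{a, b} \<in> ?H" for a b
  proof
    assume "conn (?H - {{a, b}}) a b"
    then have "same {a, b} a b" by (rule conn_mono) auto
    then show False using bridge that by blast
  qed
  moreover have "verts (spanned I) \<noteq> {}" using I(2) unfolding spanned_def by simp
  moreover have "edges (spanned I) = ?H" unfolding spanned_def by simp
  ultimately show ?thesis unfolding is_tree_iff using u by simp
qed

text \<open>A subtree joins \<open>i\<close> and \<open>j\<close> by its own edges, so it cannot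
  lack an edge that separates them.\<close>

lemma spanned_le_subtree:
  assumes I: "I \<subseteq> V" and S: "is_subtree S T" "I \<subseteq> verts S"
  shows "edges (spanned I) \<subseteq> edges S" "verts (spanned I) \<subseteq> verts S"
proof -
  have tS: "is_tree S" "edges S \<subseteq> E" using S(1) unfolding is_subtree_def by auto
  show *: "edges (spanned I) \<subseteq> edges S"
  proof
    fix e assume "e \<in> edges (spanned I)"
    then obtain i j where ij: "i \<in> I" "j \<in> I" "\<not> same e i j" unfolding spanned_def separates_def by auto
    have "conn (edges S) i j" using tS(1) ij S(2) unfolding is_tree_iff by blast
    then have "same e i j" if "e \<notin> edges S" by (rule conn_mono) (use tS that in auto)
    then show "e \<in> edges S" using ij by blast
  qed
  have "e \<subseteq> verts S" if "e \<in> edges S" for e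
    using that tS(1) unfolding is_tree_iff ugraph_def by blast
  then show "verts (spanned I) \<subseteq> verts S" using * S(2) unfolding spanned_def by auto
qed

lemma minimal_subtree_iff:
  assumes I: "I \<subseteq> V" "I \<noteq> {}"
  shows "minimal_subtree T I S \<longleftrightarrow> S = spanned I"
proof -
  have hv: "I \<subseteq> verts (spanned I)" unfolding spanned_def by simp
  have ev: "e \<subseteq> V" if "e \<in> E" for e using that ugraph unfolding ugraph_def by blast
  have hT: "is_subtree (spanned I) T"
    using is_tree_spanned[OF I] I ev unfolding is_subtree_def spanned_def by auto
  show ?thesis
  proof
    assume m: "minimal_subtree T I S"
    then have "is_subtree (spanned I) S"
      using spanned_le_subtree[OF I(1)] is_tree_spanned[OF I] unfolding minimal_subtree_def is_subtree_def
      by simp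
    then show "S = spanned I" using m hv unfolding minimal_subtree_def by blast
  next
    assume S: "S = spanned I"
    have "S' = spanned I" if S': "is_subtree S' (spanned I)" "I \<subseteq> verts S'" for S'
    proof -
      have "is_subtree S' T" using S'(1) hT unfolding is_subtree_def by auto
      then have "edges S' = edges (spanned I)" "verts S' = verts (spanned I)"
        using spanned_le_subtree[OF I(1) _ S'(2)] S'(1) unfolding is_subtree_def by auto
      then show ?thesis by (intro ugraph.equality) auto
    qed
    then show "minimal_subtree T I S" using S hT hv unfolding minimal_subtree_def by blast
  qed
qed

end

text \<open>This replaces the definite description in \<open>tree_weight\<close> by a sum over
  separating edges, on which all later computations of weights rest.\<close>

lemma tree_weight_eq:
  assumes "is_tree T" "I \<subseteq> verts T" "I \<noteq> {}"
  shows "tree_weight T I = (\<Sum>e | e \<in> edges T \<and> tree.separates T e I. wt T e)"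
proof -
  interpret tree T using assms(1) by unfold_locales
  have "(THE S. minimal_subtree T I S) = spanned I"
    using minimal_subtree_iff[OF assms(2,3)] by simp
  then show ?thesis unfolding tree_weight_def by (simp add: spanned_def)
qed

lemma card_ge_2_obtain:
  assumes "2 \<le> card S"
  obtains x y where "x \<in> S" "y \<in> S" "x \<noteq> y"
proof -
  obtain S' where "S' \<subseteq> S" "card S' = 2" using obtain_subset_with_card_n[OF assms] by blast
  then show ?thesis using that by (auto simp: card_2_iff)
qed

section \<open>Leaves and the splits induced by edges\<close>

context tree
begin

abbreviation "L \<equiv> leaves T"
abbreviation "edges_at v \<equiv> {e \<in> E. v \<in> e}"

lemma finite_edges_at: "finite (edges_at v)"
  using finite_edges by simp

lemma leaves_subset: "L \<subseteq> V"
  unfolding leaves_def by blast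

lemma leafD: "l \<in> L \<Longrightarrow> l \<in> V" "l \<in> L \<Longrightarrow> card (edges_at l) = 1"
  unfolding leaves_def degree_def by auto

lemma leaf_edge_unique:
  assumes "l \<in> L" "e \<in> E" "l \<in> e" "f \<in> E" "l \<in> f"
  shows "e = f"
proof -
  obtain g where "edges_at l = {g}" using leafD(2)[OF assms(1)] by (rule card_1_singletonE)
  moreover have "e \<in> edges_at l" "f \<in> edges_at l" using assms by simp_all
  ultimately show ?thesis by simp
qed

lemma leaf_edge:
  assumes "l \<in> L"
  obtains y where "{l, y} \<in> E"
proof -
  obtain e where "edges_at l = {e}" using leafD(2)[OF assms] by (rule card_1_singletonE)
  then have "e \<in> E" "l \<in> e" by blast+
  then obtain y where "e = {l, y}" by (rule edge_other_end)
  then show ?thesis using \<open>e \<in> E\<close> by (intro that) simp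
qed

lemma same_leaf_edge:
  assumes "l \<in> L" "e \<in> E" "l \<in> e"
  shows "same e l v \<longleftrightarrow> v = l"
proof
  assume c: "same e l v"
  show "v = l"
  proof (rule ccontr)
    assume "v \<noteq> l"
    then obtain z where z: "{l, z} \<in> E - {e}" using conn_first_edge[OF c] by metis
    then show False using leaf_edge_unique[OF assms, of "{l, z}"] by simp
  qed
qed simp

text \<open>If \<open>x\<close> is no leaf, a second edge at \<open>x\<close> leads away from
  \<open>e\<close>. The component beyond it lacks \<open>x\<close> and is strictly smaller, so
  moving outwards ends in a leaf.\<close>

lemma leaf_in_side:
  assumes "e \<in> E" "x \<in> e"
  shows "\<exists>l\<in>L. same e x l"
  using assms
proof (induction "card {v \<in> V. same e x v}" arbitrary: e x rule: less_induct)
  case less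
  obtain y where e: "e = {x, y}" "x \<in> V" using edge_other_end[OF less.prems] .
  show ?case
  proof (cases "x \<in> L")
    case True
    then show ?thesis by (intro bexI[of _ x] conn_refl)
  next
    case False
    have "edges_at x \<noteq> {e}"
    proof
      assume "edges_at x = {e}"
      then have "degree T x = 1" unfolding degree_def by simp
      then show False using False e(2) unfolding leaves_def by simp
    qed
    moreover have "e \<in> edges_at x" using less.prems by simp
    ultimately have "\<exists>f. f \<in> edges_at x \<and> f \<noteq> e" by blast
    then obtain f where f: "f \<in> E" "x \<in> f" "f \<noteq> e" by auto
    obtain c where c: "f = {x, c}" "c \<in> V" using edge_other_end[OF f(1,2)] .
    have cf: "\<not> same f c x" using bridge[of c x] f(1) unfolding c(1) by (simp add: insert_commute)
    have xc: "same e x c" by (rule edge_ends_same[OF f(1,3,2)]) (simp add: c)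
    have sub: "same e x u" if "same f c u" for u
    proof -
      have "same e c u" by (rule nest[OF less.prems(1) f(3) less.prems(2) cf that])
      then show ?thesis by (rule conn_trans[OF xc])
    qed
    have "{v \<in> V. same f c v} \<subset> {v \<in> V. same e x v}"
    proof (rule psubsetI)
      show "{v \<in> V. same f c v} \<subseteq> {v \<in> V. same e x v}" using sub by blast
      have "x \<in> {v \<in> V. same e x v}" "x \<notin> {v \<in> V. same f c v}" using e(2) cf by auto
      then show "{v \<in> V. same f c v} \<noteq> {v \<in> V. same e x v}" by blast
    qed
    then have "card {v \<in> V. same f c v} < card {v \<in> V. same e x v}"
      using finite_verts by (intro psubset_card_mono) auto
    then have "\<exists>l\<in>L. same f c l" by (rule less.hyps) (use f c in auto)
    then show ?thesis using sub by blast
  qed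
qed

lemma leaf_side_eq: "x \<in> V \<Longrightarrow> leaf_side T e x = {l \<in> L. same e x l}"
  using connects_iff[OF ugraph_delete_edge[OF ugraph], of e x]
  unfolding leaf_side_def by (simp add: delete_edge_def)

lemma edge_endD: "e \<in> E \<Longrightarrow> x \<in> e \<Longrightarrow> x \<in> V"
  using ugraph unfolding ugraph_def by blast

lemma leaf_side_subset: "leaf_side T e x \<subseteq> L"
  unfolding leaf_side_def by blast

lemma leaf_side_nonempty: "e \<in> E \<Longrightarrow> x \<in> e \<Longrightarrow> leaf_side T e x \<noteq> {}"
  using leaf_in_side[of e x] leaf_side_eq[OF edge_endD, of e x] by auto

lemma same_other_end:
  assumes "{x, y} \<in> E" "v \<in> V"
  shows "same {x, y} y v \<longleftrightarrow> \<not> same {x, y} x v"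
proof
  assume a: "same {x, y} y v"
  show "\<not> same {x, y} x v"
  proof
    assume "same {x, y} x v"
    then have "same {x, y} x y" using conn_sym[OF a] by (rule conn_trans)
    then show False using bridge[OF assms(1)] by simp
  qed
qed (use two_sides[OF assms] in simp)

lemma leaf_side_other:
  assumes "{x, y} \<in> E"
  shows "leaf_side T {x, y} y = L - leaf_side T {x, y} x"
  using same_other_end[OF assms] leaves_subset leaf_side_eq edgeD[OF assms] by auto

lemma leaf_side_leaf: "l \<in> L \<Longrightarrow> e \<in> E \<Longrightarrow> l \<in> e \<Longrightarrow> leaf_side T e l = {l}"
  using same_leaf_edge[of l e] leafD(1)[of l] by (auto simp: leaf_side_eq)

lemma leaf_side_same:
  assumes "e \<in> E" "x \<in> e" "y \<in> e" "l \<in> L"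
  shows "l \<in> leaf_side T e x \<longleftrightarrow> same e x l"
  using assms leaf_side_eq[OF edge_endD[OF assms(1,2)]] by simp

text \<open>\<open>a\<close> is the end of \<open>e\<close> turned away from \<open>g\<close>, and
  \<open>y\<close> the end of \<open>g\<close> turned towards \<open>e\<close>. Everything behind
  \<open>e\<close> lies on the same side of \<open>g\<close> as \<open>e\<close> itself.\<close>

lemma leaf_side_nested:
  assumes "e \<in> E" "g \<in> E" "e \<noteq> g"
  obtains a y where "a \<in> e" "y \<in> g" "leaf_side T e a \<subseteq> leaf_side T g y"
    "\<And>c. c \<in> g \<Longrightarrow> \<not> same e a c"
proof -
  obtain a b where e: "e = {a, b}" "a \<in> V" "b \<in> V" using edgeE[OF assms(1)] by metis
  obtain c d where g: "g = {c, d}" "c \<in> V" "d \<in> V" using edgeE[OF assms(2)] by metis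
  obtain x where x: "x \<in> e" "\<not> same e x c"
    using same_other_end[of a b c] assms(1) e g by auto
  have xg: "\<not> same e x z" if "z \<in> g" for z
  proof
    assume "same e x z"
    moreover have "same e z c" by (rule edge_ends_same[OF assms(2) assms(3)[symmetric] that]) (simp add: g)
    ultimately have "same e x c" by (rule conn_trans)
    then show False using x by simp
  qed
  have xV: "x \<in> V" using edge_endD assms(1) x by blast
  obtain y where y: "y \<in> g" "same g y x"
    using two_sides[of c d x] assms(2) g xV by auto
  have "leaf_side T e x \<subseteq> leaf_side T g y"
  proof
    fix l assume "l \<in> leaf_side T e x"
    then have l: "l \<in> L" "same e x l" using leaf_side_eq[OF xV] by auto
    have "same g x l" by (rule nest[OF assms(2,3) y(1) xg[OF y(1)] l(2)])
    then have "same g y l" by (rule conn_trans[OF y(2)])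
    then show "l \<in> leaf_side T g y" using l leaf_side_same[OF assms(2) y(1) y(1)] by simp
  qed
  then show ?thesis using that x y xg by blast
qed

definition is_cluster :: "'a set \<Rightarrow> bool" where
  "is_cluster C \<longleftrightarrow> (\<exists>e\<in>E. \<exists>x\<in>e. C = leaf_side T e x)"

lemma cluster_ends:
  assumes "e \<in> E" "x \<in> e" "a \<in> e"
  shows "leaf_side T e a = leaf_side T e x \<or> leaf_side T e a = L - leaf_side T e x"
proof (cases "a = x")
  case False
  obtain y where "e = {x, y}" using edge_other_end[OF assms(1,2)] .
  then have "e = {x, a}" using False assms(3) by auto
  then show ?thesis using leaf_side_other assms(1) by simp
qed simp

lemma cluster_subset: "is_cluster C \<Longrightarrow> C \<subseteq> L"
  unfolding is_cluster_def using leaf_side_subset by blast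

lemma cluster_compat:
  assumes "is_cluster C" "is_cluster D"
  shows "C \<inter> D = {} \<or> C \<subseteq> D \<or> D \<subseteq> C \<or> C \<union> D = L"
proof -
  obtain e x where e: "e \<in> E" "x \<in> e" "C = leaf_side T e x" using assms(1) unfolding is_cluster_def by blast
  obtain g z where g: "g \<in> E" "z \<in> g" "D = leaf_side T g z" using assms(2) unfolding is_cluster_def by blast
  have sub: "C \<subseteq> L" "D \<subseteq> L" using assms cluster_subset by auto
  show ?thesis
  proof (cases "e = g")
    case True
    then show ?thesis using cluster_ends[OF e(1,2), of z] g e by auto
  next
    case False
    obtain a y where ay: "a \<in> e" "y \<in> g" "leaf_side T e a \<subseteq> leaf_side T g y"
      using leaf_side_nested[OF e(1) g(1) False] .
    have "leaf_side T e a = C \<or> leaf_side T e a = L - C" "leaf_side T g y = D \<or> leaf_side T g y = L - D"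
      using cluster_ends[OF e(1,2) ay(1)] cluster_ends[OF g(1,2) ay(2)] e g by auto
    then have "C \<subseteq> D \<or> C \<subseteq> L - D \<or> L - C \<subseteq> D \<or> L - C \<subseteq> L - D" using ay(3) by metis
    then show ?thesis using sub by blast
  qed
qed

text \<open>The two edges at a vertex of degree 2 induce the same split, hence a sum. The weights
  enter as a parameter \<open>f\<close> because the locale also covers graphs without
  weights.\<close>

definition split_weight :: "('a set \<Rightarrow> real) \<Rightarrow> 'a set \<Rightarrow> real" where
  "split_weight f C = (\<Sum>e | e \<in> E \<and> (\<exists>x\<in>e. C = leaf_side T e x). f e)"

lemma split_weight_nonzero: "split_weight f C \<noteq> 0 \<Longrightarrow> is_cluster C"
proof (rule ccontr)
  assume "split_weight f C \<noteq> 0" "\<not> is_cluster C"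
  then have "{e \<in> E. \<exists>x\<in>e. C = leaf_side T e x} = {}" unfolding is_cluster_def by blast
  then have "split_weight f C = 0" unfolding split_weight_def by (simp only: sum.empty)
  then show False using \<open>split_weight f C \<noteq> 0\<close> by simp
qed

lemma split_weight_compl:
  assumes "C \<subseteq> L"
  shows "split_weight f (L - C) = split_weight f C"
proof -
  have 1: "\<exists>x\<in>e. L - C = leaf_side T e x" if C: "e \<in> E" "x \<in> e" "C = leaf_side T e x" for C e x
  proof -
    obtain y where "e = {x, y}" using edge_other_end[OF C(1,2)] .
    then show ?thesis using C leaf_side_other[of x y] by auto
  qed
  have "L - (L - C) = C" using assms by blast
  then have "(\<exists>x\<in>e. L - C = leaf_side T e x) \<longleftrightarrow> (\<exists>x\<in>e. C = leaf_side T e x)" if "e \<in> E" for e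
    using 1[OF that, of _ C] 1[OF that, of _ "L - C"] by metis
  then show ?thesis unfolding split_weight_def by (intro sum.cong) auto
qed

lemma separates_iff_cuts:
  assumes "I \<subseteq> L" "e \<in> E" "x \<in> e"
  shows "separates e I \<longleftrightarrow> cuts (leaf_side T e x) I"
proof -
  have xV: "x \<in> V" using edge_endD assms by blast
  have m: "i \<in> leaf_side T e x \<longleftrightarrow> same e x i" if "i \<in> I" for i
    using leaf_side_same[OF assms(2,3,3)] that assms(1) by blast
  have IV: "i \<in> V" if "i \<in> I" for i using that assms(1) leaves_subset by blast
  show ?thesis
  proof
    assume "separates e I"
    then obtain i j where ij: "i \<in> I" "j \<in> I" "\<not> same e i j" unfolding separates_def by blast
    have "\<not> (same e x i \<and> same e x j)" using ij(3) conn_trans[of "E - {e}" i x j] conn_sym[of _ x i] by blast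
    moreover have "same e x i \<or> same e x j"
      using third_side[OF assms(2) xV IV[OF ij(1)] IV[OF ij(2)] _ ij(3)] by blast
    ultimately show "cuts (leaf_side T e x) I" using ij m unfolding cuts_def by blast
  next
    assume "cuts (leaf_side T e x) I"
    then obtain i j where ij: "i \<in> I" "j \<in> I" "same e x i" "\<not> same e x j"
      using m unfolding cuts_def by blast
    then have "\<not> same e i j" using conn_trans[of _ x i j] by blast
    then show "separates e I" using ij unfolding separates_def by blast
  qed
qed

text \<open>The factor 2 arises because \<open>Pow L\<close> contains both leaf sides of every
  edge.\<close>

lemma weight_as_split_sum:
  assumes I: "I \<subseteq> L"
  shows "(\<Sum>C\<in>Pow L. split_weight f C * of_bool (cuts C I)) = 2 * (\<Sum>e | e \<in> E \<and> separates e I. f e)"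
proof -
  let ?s = "\<lambda>C e. \<exists>x\<in>e. C = leaf_side T e x"
  have finL: "finite (Pow L)" using finite_subset[OF leaves_subset finite_verts] by simp
  have "(\<Sum>C\<in>Pow L. split_weight f C * of_bool (cuts C I))
      = (\<Sum>C\<in>Pow L. \<Sum>e\<in>E. f e * (of_bool (?s C e) * of_bool (cuts C I)))"
    unfolding split_weight_def
  proof (rule sum.cong[OF refl])
    fix C
    have "(\<Sum>e | e \<in> E \<and> ?s C e. f e) = (\<Sum>e\<in>E. if ?s C e then f e else 0)"
      using finite_edges by (rule sum.inter_filter)
    then show "(\<Sum>e | e \<in> E \<and> ?s C e. f e) * of_bool (cuts C I)
        = (\<Sum>e\<in>E. f e * (of_bool (?s C e) * of_bool (cuts C I)))"
      by (simp only: sum_distrib_right) (rule sum.cong, auto)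
  qed
  also have "\<dots> = (\<Sum>e\<in>E. \<Sum>C\<in>Pow L. f e * (of_bool (?s C e) * of_bool (cuts C I)))"
    by (rule sum.swap)
  also have "\<dots> = (\<Sum>e\<in>E. 2 * (if separates e I then f e else 0))"
  proof (rule sum.cong[OF refl])
    fix e assume e: "e \<in> E"
    obtain a b where ab: "e = {a, b}" using edgeE[OF e] by metis
    let ?A = "leaf_side T e a" and ?B = "leaf_side T e b"
    have B: "?B = L - ?A" using leaf_side_other e ab by simp
    have "?A \<noteq> {}" using leaf_side_nonempty e ab by simp
    then have ne: "?A \<noteq> ?B" using B leaf_side_subset[of e a] by blast
    have s: "?s C e \<longleftrightarrow> C = ?A \<or> C = ?B" for C unfolding ab by blast
    have "(\<Sum>C\<in>Pow L. f e * (of_bool (?s C e) * of_bool (cuts C I)))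
        = (\<Sum>C\<in>{?A, ?B}. f e * (of_bool (?s C e) * of_bool (cuts C I)))"
      using finL leaf_side_subset by (intro sum.mono_neutral_right) (auto simp: s)
    also have "\<dots> = f e * of_bool (cuts ?A I) + f e * of_bool (cuts ?B I)"
      using ne by (simp add: s)
    also have "\<dots> = 2 * (if separates e I then f e else 0)"
      using separates_iff_cuts[OF I e, of a] separates_iff_cuts[OF I e, of b] ab by simp
    finally show "(\<Sum>C\<in>Pow L. f e * (of_bool (?s C e) * of_bool (cuts C I)))
        = 2 * (if separates e I then f e else 0)" .
  qed
  also have "\<dots> = 2 * (\<Sum>e\<in>E. if separates e I then f e else 0)"
    by (rule sum_distrib_left[symmetric])
  also have "(\<Sum>e\<in>E. if separates e I then f e else 0) = (\<Sum>e | e \<in> E \<and> separates e I. f e)"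
    using finite_edges by (rule sum.inter_filter[symmetric])
  finally show ?thesis .
qed

end

lemma complementary_eq:
  assumes "A \<subseteq> L" "Y \<subseteq> L" "A \<noteq> {}" "L - A \<noteq> {}" "A \<subseteq> Y \<or> L - A \<subseteq> Y"
    "A \<subseteq> L - Y \<or> L - A \<subseteq> L - Y"
  shows "A = Y \<or> L - A = Y"
  using assms(5,6)
proof (elim disjE)
  assume "L - A \<subseteq> Y" "L - A \<subseteq> L - Y"
  then show ?thesis using assms(4) by auto
qed (use assms(1-3) in blast)+

section \<open>Edges of essential trees are determined by their leaf sides\<close>

locale essential_tree = tree +
  assumes essential: "essential T"
begin

lemma three_edges:
  assumes "v \<in> V" "e \<in> E" "f \<in> E" "e \<noteq> f" "v \<in> e" "v \<in> f"
  shows "3 \<le> card (edges_at v)"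
proof -
  have "card {e, f} \<le> card (edges_at v)"
    using finite_edges_at by (rule card_mono) (use assms in auto)
  moreover have "card (edges_at v) \<noteq> 2"
    using essential assms(1) unfolding essential_def degree_def by simp
  ultimately show ?thesis using assms(4) by simp
qed

text \<open>\<open>b\<close> is the end of \<open>e\<close> facing \<open>g\<close>, and
  \<open>d\<close> the far end of \<open>g\<close>. As \<open>b\<close> is not of degree 2, at least
  two further edges leave it. Not both lead to \<open>d\<close>, and a leaf behind the other one
  hangs between \<open>e\<close> and \<open>g\<close>.\<close>

lemma leaf_between:
  assumes "e \<in> E" "g \<in> E" "e \<noteq> g" "b \<in> e" "d \<in> g" "same e b d" "\<not> same g b d"
  shows "\<exists>l\<in>L. same e b l \<and> same g b l"
proof -
  have bV: "b \<in> V" and dV: "d \<in> V" using edge_endD assms by blast+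
  have "b \<noteq> d" using assms(7) by auto
  then obtain z where z: "{b, z} \<in> E - {e}" using conn_first_edge[OF assms(6)] by metis
  have "3 \<le> card (edges_at b)"
    by (rule three_edges[OF bV assms(1), of "{b, z}"]) (use z assms in auto)
  then have "2 \<le> card (edges_at b - {e})"
    using finite_edges_at assms by (simp add: card_Diff_singleton)
  then obtain f1 f2 where f: "f1 \<in> edges_at b - {e}" "f2 \<in> edges_at b - {e}" "f1 \<noteq> f2"
    by (rule card_ge_2_obtain)
  have "same f1 b d \<or> same f2 b d"
  proof (rule ccontr)
    assume "\<not> ?thesis"
    then have n: "\<not> same f1 b d" "\<not> same f2 b d" by auto
    obtain z where z: "f1 = {b, z}" using edge_other_end[of f1 b] f by blast
    have f1: "{b, z} \<in> E" using f z by auto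
    have zd: "same f1 z d" using same_other_end[OF f1 dV] n z by simp
    have zb: "\<not> same f1 z b" using bridge[of z b] f1 unfolding z by (simp add: insert_commute)
    have "same f2 z d"
      by (rule nest[OF _ f(3) _ zb zd]) (use f in auto)
    moreover have "same f2 b z" by (rule edge_ends_same[of f1]) (use f z in auto)
    ultimately have "same f2 b d" using conn_trans by fast
    then show False using n by simp
  qed
  then obtain f where f: "f \<in> E" "b \<in> f" "f \<noteq> e" "same f b d" using f by auto
  have fg: "f \<noteq> g" using assms f by auto
  obtain z where z: "f = {b, z}" using edge_other_end[OF f(1,2)] .
  have zb: "\<not> same f z b" using bridge[of z b] f(1) unfolding z by (simp add: insert_commute)
  have zd: "\<not> same f z d"
  proof
    assume "same f z d"
    then have "same f z b" using conn_sym[OF f(4)] by (rule conn_trans)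
    then show False using zb by simp
  qed
  obtain l where l: "l \<in> L" "same f z l" using leaf_in_side[OF f(1), of z] z by auto
  have zl: "same e z l" by (rule nest[OF assms(1) f(3) assms(4) zb l(2)])
  have zl': "same g z l" by (rule nest[OF assms(2) fg assms(5) zd l(2)])
  have "same e b z" "same g b z" using edge_ends_same[OF f(1) _ f(2), of _ z] f fg z by auto
  then have "same e b l" "same g b l" using conn_trans zl zl' by fast+
  then show ?thesis using l by blast
qed

text \<open>Two leaves tell distinct edges apart: \<open>l\<close>, hanging between them, and
  \<open>la\<close>, behind \<open>e\<close>, are on the same side of \<open>g\<close> but on
  different sides of \<open>e\<close>.\<close>

lemma leaf_side_inj:
  assumes "e \<in> E" "x \<in> e" "g \<in> E" "y \<in> g" "leaf_side T e x = leaf_side T g y"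
  shows "e = g \<and> x = y"
proof (cases "e = g")
  case True
  have "x = y"
  proof (rule ccontr)
    assume "x \<noteq> y"
    then have "e = {x, y}" using edge_other_end[OF assms(1,2)] assms(4) True by auto
    then have "leaf_side T e y = L - leaf_side T e x" using leaf_side_other assms(1) by simp
    then show False
      using assms(5) True leaf_side_nonempty[OF assms(1,2)] leaf_side_subset[of e x] by auto
  qed
  then show ?thesis using True by simp
next
  case False
  obtain a b where ab: "e = {a, b}" "a \<noteq> b" "same e b y"
  proof -
    obtain x' where x': "e = {x, x'}" "x \<noteq> x'" using edge_other_end[OF assms(1,2)] .
    have "same e x y \<or> same e x' y" using two_sides[of x x' y] assms edge_endD x'(1) by blast
    then show ?thesis
    proof
      assume "same e x y"
      then show ?thesis using that[of x' x] x' by (simp add: insert_commute)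
    qed (use that[of x x'] x' in simp)
  qed
  have V: "a \<in> V" "b \<in> V" "y \<in> V" using edge_endD[OF assms(1)] edge_endD[OF assms(3,4)] ab by auto
  obtain y' where y': "g = {y, y'}" "y' \<in> V" using edge_other_end[OF assms(3,4)] .
  obtain d where d: "d \<in> g" "\<not> same g b d"
  proof -
    have "same g y b \<longleftrightarrow> \<not> same g y' b" using same_other_end[of y y' b] assms(3) V y' by auto
    then show ?thesis using that[of y] that[of y'] y' conn_sym[of _ b] by blast
  qed
  have bd: "same e b d"
    using edge_ends_same[OF assms(3) False[symmetric] assms(4) d(1)] by (rule conn_trans[OF ab(3)])
  obtain l where l: "l \<in> L" "same e b l" "same g b l"
    using leaf_between[OF assms(1,3) False _ d(1) bd d(2)] ab by auto
  obtain la where la: "la \<in> L" "same e a la" using leaf_in_side[OF assms(1), of a] ab by auto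
  obtain ld where ld: "ld \<in> L" "same g d ld" using leaf_in_side[OF assms(3) d(1)] by auto
  have nab: "\<not> same e b a" using bridge[of b a] assms(1) ab by (simp add: insert_commute)
  have ba: "same g b a" by (rule edge_ends_same[OF assms(1) False]) (use ab in auto)
  have nad: "\<not> same e a d"
  proof
    assume "same e a d"
    then have "same e b a" using conn_sym conn_trans[OF bd] by fast
    then show False using nab by simp
  qed
  have ala: "same g a la" by (rule nest[OF assms(3) False d(1) nad la(2)])
  have gla: "same g b la" by (rule conn_trans[OF ba ala])
  have ela: "\<not> same e b la"
  proof
    assume "same e b la"
    then have "same e b a" using conn_sym[OF la(2)] by (rule conn_trans)
    then show False using nab by simp
  qed
  have ndb: "\<not> same g d b" using d(2) conn_sym[of _ d b] by blast
  have dld: "same e d ld"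
    by (rule nest[OF assms(1) False[symmetric] _ ndb ld(2)]) (use ab in simp)
  have eld: "same e b ld" by (rule conn_trans[OF bd dld])
  have gld: "\<not> same g b ld"
  proof
    assume "same g b ld"
    then have "same g b d" using conn_sym[OF ld(2)] by (rule conn_trans)
    then show False using d by simp
  qed
  have ex: "v \<in> leaf_side T e x \<longleftrightarrow> (same e b v \<longleftrightarrow> x = b)" if "v \<in> L" for v
  proof (cases "x = b")
    case False
    then have "x = a" using ab assms(2) by auto
    then show ?thesis
      using leaf_side_same[OF assms(1,2,2) that] same_other_end[of a b v] assms(1) ab that leaves_subset
      by auto
  qed (use leaf_side_same[OF assms(1,2,2) that] in simp)
  have "same g y l \<longleftrightarrow> same g y la" "same g y ld \<longleftrightarrow> \<not> same g y l"
  proof -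
    show "same g y l \<longleftrightarrow> same g y la"
      using l(3) gla conn_trans[of _ y l b] conn_trans[of _ y la b] conn_trans[of _ y b] conn_sym[of _ b] by blast
    have "\<not> same g l ld" using conn_trans[OF l(3), of ld] gld by blast
    moreover have "same g y ld" if "\<not> same g y l"
      using third_side[OF assms(3) V(3), of l ld] that \<open>\<not> same g l ld\<close> l ld leaves_subset by blast
    ultimately show "same g y ld \<longleftrightarrow> \<not> same g y l"
      using conn_trans[of _ l y ld] conn_sym[of _ y l] by blast
  qed
  then have "l \<in> leaf_side T g y \<longleftrightarrow> la \<in> leaf_side T g y"
    using leaf_side_same[OF assms(3,4,4)] l la by simp
  then have "l \<in> leaf_side T e x \<longleftrightarrow> la \<in> leaf_side T e x" using assms(5) by simp
  then show ?thesis using ex l la ela by simp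
qed

text \<open>The position of a vertex relative to \<open>g\<close> is expressed by leaf sets alone,
  so it can be transported to another tree with the same clusters.\<close>

lemma end_in_side_iff:
  assumes "e \<in> E" "x \<in> e" "g \<in> E" "y \<in> g" "e \<noteq> g"
  shows "same g y x \<longleftrightarrow> leaf_side T e x \<subseteq> leaf_side T g y \<or> L - leaf_side T e x \<subseteq> leaf_side T g y"
proof -
  have key: "leaf_side T e x \<subseteq> leaf_side T g z \<or> L - leaf_side T e x \<subseteq> leaf_side T g z"
    if z: "z \<in> g" "same g z x" for z
  proof -
    obtain a z' where a: "a \<in> e" "z' \<in> g" "leaf_side T e a \<subseteq> leaf_side T g z'"
      "\<And>c. c \<in> g \<Longrightarrow> \<not> same e a c"
      using leaf_side_nested[OF assms(1,3,5)] by metis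
    obtain l where l: "l \<in> L" "same e a l" using leaf_in_side[OF assms(1) a(1)] by blast
    have "same g a l" by (rule nest[OF assms(3,5) z(1) a(4)[OF z(1)] l(2)])
    moreover have "same g x a" by (rule edge_ends_same[OF assms(1,5,2) a(1)])
    ultimately have "same g z l" using conn_trans[OF z(2)] conn_trans by fast
    then have "l \<in> leaf_side T g z" using leaf_side_same[OF assms(3) z(1,1) l(1)] by simp
    moreover have "l \<in> leaf_side T e a" using leaf_side_same[OF assms(1) a(1,1) l(1)] l by simp
    ultimately have "z = z'"
    proof -
      have "z = z' \<or> leaf_side T g z = L - leaf_side T g z'"
      proof (cases "z = z'")
        case False
        then have "g = {z', z}" using edge_other_end[OF assms(3) a(2)] z(1) by auto
        then show ?thesis using leaf_side_other[of z' z] assms(3) by simp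
      qed simp
      then show ?thesis using \<open>l \<in> leaf_side T g z\<close> \<open>l \<in> leaf_side T e a\<close> a(3) by blast
    qed
    then show ?thesis using cluster_ends[OF assms(1,2) a(1)] a(3) by metis
  qed
  show ?thesis
  proof
    assume "same g y x"
    then show "leaf_side T e x \<subseteq> leaf_side T g y \<or> L - leaf_side T e x \<subseteq> leaf_side T g y"
      using key assms(4) by blast
  next
    assume r: "leaf_side T e x \<subseteq> leaf_side T g y \<or> L - leaf_side T e x \<subseteq> leaf_side T g y"
    show "same g y x"
    \<comment> \<open>Otherwise the split of \<open>e\<close> would have a side inside each side of
      \<open>g\<close>. The two splits would then coincide, against
      \<open>leaf_side_inj\<close>.\<close>
    proof (rule ccontr)
      assume n: "\<not> same g y x"
      obtain y' where y': "g = {y, y'}" using edge_other_end[OF assms(3,4)] .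
      have xV: "x \<in> V" using edge_endD[OF assms(1,2)] .
      have "same g y' x" using same_other_end[of y y' x] assms(3) y' n xV by simp
      then have r': "leaf_side T e x \<subseteq> leaf_side T g y' \<or> L - leaf_side T e x \<subseteq> leaf_side T g y'"
        using key[of y'] y' by simp
      have o: "leaf_side T g y' = L - leaf_side T g y" using leaf_side_other[of y y'] assms(3) y' by simp
      obtain x' where x': "e = {x, x'}" using edge_other_end[OF assms(1,2)] .
      have ox: "leaf_side T e x' = L - leaf_side T e x" using leaf_side_other[of x x'] assms(1) x' by simp
      have ne: "leaf_side T e x \<noteq> {}" "leaf_side T e x' \<noteq> {}"
        using leaf_side_nonempty[OF assms(1)] x' by auto
      have sub: "leaf_side T e x \<subseteq> L" "leaf_side T g y \<subseteq> L" using leaf_side_subset by auto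
      have "leaf_side T e x = leaf_side T g y \<or> leaf_side T e x' = leaf_side T g y"
        using complementary_eq[OF sub ne(1) ne(2)[unfolded ox] r r'[unfolded o]] ox by simp
      then show False
        using leaf_side_inj[OF assms(1) _ assms(3,4), of x] leaf_side_inj[OF assms(1) _ assms(3,4), of x']
          x' assms(5) by auto
    qed
  qed
qed

end

section \<open>Essential trees with the same clusters are isomorphic\<close>

text \<open>Having two leaves guarantees that every vertex is an end of some edge, so that clusters
  can locate it.\<close>

locale cluster_equal_trees = A: essential_tree T + B: essential_tree T'
  for T :: "('a, 'b) ugraph_scheme" and T' :: "('a, 'c) ugraph_scheme" +
  assumes leaves_eq: "leaves T' = leaves T"
    and clusters_eq: "A.is_cluster C \<longleftrightarrow> B.is_cluster C"
    and leaves_ne: "2 \<le> card (leaves T)"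
begin

lemma swapped: "cluster_equal_trees T' T"
  using leaves_eq clusters_eq leaves_ne by unfold_locales auto

text \<open>Inner vertices carry no labels. A vertex is recognized by the side of each edge on which
  it lies, where edges of the two trees are identified through their leaf sides.\<close>

definition matches :: "'a \<Rightarrow> 'a \<Rightarrow> bool" where
  "matches u u' \<longleftrightarrow> u \<in> verts T \<and> u' \<in> verts T' \<and>
    (\<forall>e\<in>edges T. \<forall>y\<in>e. \<forall>e'\<in>edges T'. \<forall>y'\<in>e'.
       leaf_side T e y = leaf_side T' e' y' \<longrightarrow> (A.same e y u \<longleftrightarrow> B.same e' y' u'))"

lemma matchesD:
  assumes "matches u u'" "e \<in> edges T" "y \<in> e" "e' \<in> edges T'" "y' \<in> e'"
    "leaf_side T e y = leaf_side T' e' y'"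
  shows "A.same e y u \<longleftrightarrow> B.same e' y' u'"
  using assms unfolding matches_def by blast

lemma matches_swap:
  assumes "matches u u'"
  shows "cluster_equal_trees.matches T' T u' u"
proof -
  have "u \<in> verts T" "u' \<in> verts T'" using assms unfolding matches_def by auto
  then show ?thesis
    unfolding cluster_equal_trees.matches_def[OF swapped]
    using matchesD[OF assms, symmetric] by simp
qed

lemma matches_swapped: "cluster_equal_trees.matches T' T u' u \<longleftrightarrow> matches u u'"
  using matches_swap cluster_equal_trees.matches_swap[OF swapped] by blast

lemma partner:
  assumes "e \<in> edges T" "x \<in> e"
  obtains e' x' where "e' \<in> edges T'" "x' \<in> e'" "leaf_side T e x = leaf_side T' e' x'"
proof -
  have "B.is_cluster (leaf_side T e x)"
    using assms clusters_eq[of "leaf_side T e x"] unfolding A.is_cluster_def by blast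
  then show ?thesis using that unfolding B.is_cluster_def by blast
qed

lemma other_ends:
  assumes "{x, y} \<in> edges T" "{x', y'} \<in> edges T'"
    "leaf_side T {x, y} x = leaf_side T' {x', y'} x'"
  shows "leaf_side T {x, y} y = leaf_side T' {x', y'} y'"
  using A.leaf_side_other[OF assms(1)] B.leaf_side_other[OF assms(2)] assms(3) leaves_eq by simp

lemma same_edge:
  assumes e: "e \<in> edges T" "x \<in> e" "e' \<in> edges T'" "x' \<in> e'" "leaf_side T e x = leaf_side T' e' x'"
    and y: "y \<in> e" "g' \<in> edges T'" "y' \<in> g'" "leaf_side T e y = leaf_side T' g' y'"
  shows "e' = g'"
proof (cases "x = y")
  case True
  then show ?thesis using B.leaf_side_inj[OF e(3,4) y(2,3)] e(5) y(4) by simp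
next
  case False
  have ee: "e = {x, y}" using A.edge_other_end[OF e(1,2)] y(1) False by auto
  obtain z where z: "e' = {x', z}" using B.edge_other_end[OF e(3,4)] .
  have "leaf_side T e y = leaf_side T' e' z" using other_ends[of x y x' z] e ee z by simp
  then have "leaf_side T' e' z = leaf_side T' g' y'" using y(4) by simp
  then show ?thesis using B.leaf_side_inj[OF e(3) _ y(2,3), of z] z by blast
qed

text \<open>Relative to another edge, the position of an end depends only on leaf sides, by
  \<open>end_in_side_iff\<close>. Relative to its own edge, an end is on its own side and not on the
  opposite one.\<close>

lemma matches_ends:
  assumes e: "e \<in> edges T" "x \<in> e" "e' \<in> edges T'" "x' \<in> e'" "leaf_side T e x = leaf_side T' e' x'"
  shows "matches x x'"
  unfolding matches_def
proof (intro conjI ballI impI)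
  interpret S: cluster_equal_trees T' T by (rule swapped)
  show "x \<in> verts T" "x' \<in> verts T'" using A.edge_endD B.edge_endD e by auto
  fix g y g' y'
  assume g: "g \<in> edges T" "y \<in> g" "g' \<in> edges T'" "y' \<in> g'" "leaf_side T g y = leaf_side T' g' y'"
  have xy: "x = y \<longleftrightarrow> x' = y'" if "e = g" "e' = g'"
    using A.leaf_side_inj[OF e(1,2) g(1,2)] B.leaf_side_inj[OF e(3,4) g(3,4)] that e(5) g(5) by metis
  have eg: "e = g \<longleftrightarrow> e' = g'"
  proof
    assume "e = g"
    then show "e' = g'" using same_edge[OF e, of y g' y'] g by simp
  next
    assume "e' = g'"
    then show "e = g" using S.same_edge[OF e(3,4,1,2) e(5)[symmetric], of y' g y] g by simp
  qed
  show "A.same g y x \<longleftrightarrow> B.same g' y' x'"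
  proof (cases "e = g")
    case True
    have "A.same g y x \<longleftrightarrow> x = y"
    proof (cases "x = y")
      case False
      then have "g = {y, x}" using A.edge_other_end[OF g(1,2)] e(2) True by auto
      then show ?thesis using False A.bridge[of y x] g(1) by simp
    qed simp
    moreover have "B.same g' y' x' \<longleftrightarrow> x' = y'"
    proof (cases "x' = y'")
      case False
      then have "g' = {y', x'}" using B.edge_other_end[OF g(3,4)] e(4) True eg by auto
      then show ?thesis using False B.bridge[of y' x'] g(3) by simp
    qed simp
    ultimately show ?thesis using xy True eg by simp
  next
    case False
    then show ?thesis
      using A.end_in_side_iff[OF e(1,2) g(1,2)] B.end_in_side_iff[OF e(3,4) g(3,4)] eg
      by (simp add: e(5) g(5) leaves_eq)
  qed
qed

text \<open>Some edge of \<open>T'\<close> separates distinct vertices, and its partner in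
  \<open>T\<close> would put \<open>u\<close> on both sides.\<close>

lemma matches_unique:
  assumes "matches u u'" "matches u v'"
  shows "u' = v'"
proof (rule ccontr)
  interpret S: cluster_equal_trees T' T by (rule swapped)
  assume ne: "u' \<noteq> v'"
  have V: "u' \<in> verts T'" "v' \<in> verts T'" using assms unfolding matches_def by auto
  obtain z where "{u', z} \<in> {e \<in> edges T'. \<not> B.same e u' v'}"
    using conn_first_edge[OF B.conn_separating_edges[OF V] ne] .
  then obtain e where e: "e \<in> edges T'" "\<not> B.same e u' v'" by blast
  obtain a b where ab: "e = {a, b}" using B.edgeE[OF e(1)] by metis
  obtain c where c: "c \<in> e" "B.same e c u'" using B.two_sides[of a b u'] e(1) ab V by auto
  obtain g y where g: "g \<in> edges T" "y \<in> g" "leaf_side T' e c = leaf_side T g y"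
    using S.partner[OF e(1) c(1)] .
  have "A.same g y u \<longleftrightarrow> B.same e c u'" "A.same g y u \<longleftrightarrow> B.same e c v'"
    using assms g e(1) c(1) unfolding matches_def by metis+
  then have "B.same e c v'" using c(2) by simp
  then have "B.same e u' v'" using conn_trans[OF conn_sym[OF c(2)]] by blast
  then show False using e(2) by simp
qed

lemma matches_exists:
  assumes "u \<in> verts T"
  shows "\<exists>u'. matches u u'"
proof -
  obtain l l' where l: "l \<in> leaves T" "l' \<in> leaves T" "l \<noteq> l'" using leaves_ne by (rule card_ge_2_obtain)
  obtain w where w: "w \<in> leaves T" "u \<noteq> w" using l by metis
  obtain z where z: "{u, z} \<in> edges T"
    using conn_first_edge[OF A.connected[OF assms] w(2)] w(1) A.leaves_subset by blast
  obtain e' x' where "e' \<in> edges T'" "x' \<in> e'" "leaf_side T {u, z} u = leaf_side T' e' x'"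
    using partner[OF z, of u] by auto
  then show ?thesis using matches_ends[OF z] by blast
qed

definition vertex_map :: "'a \<Rightarrow> 'a" where
  "vertex_map u = (SOME u'. matches u u')"

lemma vertex_map_eq: "matches u u' \<Longrightarrow> vertex_map u = u'"
  unfolding vertex_map_def using matches_unique someI[of "matches u" u'] by blast

lemma vertex_map_edge:
  assumes "e \<in> edges T" "x \<in> e" "e' \<in> edges T'" "x' \<in> e'" "leaf_side T e x = leaf_side T' e' x'"
  shows "vertex_map ` e = e'"
proof -
  obtain y where y: "e = {x, y}" using A.edge_other_end[OF assms(1,2)] .
  obtain y' where y': "e' = {x', y'}" using B.edge_other_end[OF assms(3,4)] .
  have "leaf_side T e y = leaf_side T' e' y'" using other_ends[of x y x' y'] assms y y' by simp
  then have "matches y y'" using matches_ends[OF assms(1) _ assms(3)] y y' by simp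
  moreover have "matches x x'" using matches_ends[OF assms] .
  ultimately show ?thesis using vertex_map_eq y y' by simp
qed

lemma bij_betw_vertex_map: "bij_betw vertex_map (verts T) (verts T')"
proof -
  interpret S: cluster_equal_trees T' T by (rule swapped)
  have m: "matches u (vertex_map u)" if "u \<in> verts T" for u
    using matches_exists[OF that] vertex_map_eq by blast
  show ?thesis
  proof (rule bij_betwI')
    fix x y assume xy: "x \<in> verts T" "y \<in> verts T"
    show "vertex_map x = vertex_map y \<longleftrightarrow> x = y"
    proof
      assume eq: "vertex_map x = vertex_map y"
      have "S.matches (vertex_map x) x" using m[OF xy(1)] by (simp add: matches_swapped)
      moreover have "S.matches (vertex_map x) y" using m[OF xy(2)] by (simp add: matches_swapped eq)
      ultimately show "x = y" by (rule S.matches_unique)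
    qed simp
  next
    fix x assume "x \<in> verts T"
    then show "vertex_map x \<in> verts T'" using m unfolding matches_def by blast
  next
    fix y assume y: "y \<in> verts T'"
    then obtain x where "S.matches y x" using S.matches_exists by blast
    then have "matches x y" by (simp add: matches_swapped)
    then show "\<exists>x\<in>verts T. y = vertex_map x" using vertex_map_eq[of x y] unfolding matches_def by blast
  qed
qed

lemma edges_vertex_map: "edges T' = image vertex_map ` edges T"
proof (intro equalityI subsetI)
  interpret S: cluster_equal_trees T' T by (rule swapped)
  fix e' assume e': "e' \<in> edges T'"
  obtain a b where "e' = {a, b}" using B.edgeE[OF e'] by metis
  then have a: "a \<in> e'" by simp
  obtain e x where "e \<in> edges T" "x \<in> e" "leaf_side T' e' a = leaf_side T e x"
    using S.partner[OF e' a] .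
  then have "vertex_map ` e = e'" using vertex_map_edge e' a by simp
  then show "e' \<in> image vertex_map ` edges T" using \<open>e \<in> edges T\<close> by blast
next
  fix e' assume "e' \<in> image vertex_map ` edges T"
  then obtain e where e: "e \<in> edges T" "e' = vertex_map ` e" by blast
  obtain a b where "e = {a, b}" using A.edgeE[OF e(1)] by metis
  then have a: "a \<in> e" by simp
  obtain g x where "g \<in> edges T'" "x \<in> g" "leaf_side T e a = leaf_side T' g x"
    using partner[OF e(1) a] .
  then show "e' \<in> edges T'" using vertex_map_edge[OF e(1) a] e(2) by simp
qed

lemma vertex_map_leaf:
  assumes "l \<in> leaves T"
  shows "vertex_map l = l"
proof -
  obtain y where y: "{l, y} \<in> edges T" using A.leaf_edge[OF assms] .
  have l': "l \<in> leaves T'" using assms leaves_eq by simp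
  obtain y' where y': "{l, y'} \<in> edges T'" using B.leaf_edge[OF l'] .
  have "leaf_side T {l, y} l = leaf_side T' {l, y'} l"
    using A.leaf_side_leaf[OF assms y] B.leaf_side_leaf[OF l' y'] by simp
  then have "matches l l" using matches_ends[OF y _ y'] by simp
  then show ?thesis by (rule vertex_map_eq)
qed

end

lemma wtree_iso_of_clusters:
  fixes T T' :: "nat wgraph"
  assumes "cluster_equal_trees T T'"
    and wt: "\<And>e x e' x'. e \<in> edges T \<Longrightarrow> x \<in> e \<Longrightarrow> e' \<in> edges T' \<Longrightarrow> x' \<in> e' \<Longrightarrow>
      leaf_side T e x = leaf_side T' e' x' \<Longrightarrow> wt T e = wt T' e'"
  shows "wtree_iso T T'"
proof -
  interpret cluster_equal_trees T T' by (rule assms)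
  have "wt T' (vertex_map ` e) = wt T e" if e: "e \<in> edges T" for e
  proof -
    obtain a b where "e = {a, b}" using A.edgeE[OF e] by metis
    then have a: "a \<in> e" by simp
    obtain g x where g: "g \<in> edges T'" "x \<in> g" "leaf_side T e a = leaf_side T' g x"
      using partner[OF e a] .
    then show ?thesis using vertex_map_edge[OF e a g] wt[OF e a g] by simp
  qed
  then show ?thesis
    unfolding wtree_iso_def
    using bij_betw_vertex_map edges_vertex_map vertex_map_leaf leaves_eq by blast
qed

section \<open>Quotients of trees: contraction and relabelling\<close>

text \<open>The map \<open>r\<close> collapses each component of \<open>(V, E - F0)\<close> to a point; contraction is the
  case of a single edge outside \<open>F0\<close>, relabelling the case \<open>F0 = E\<close>.\<close>

locale tree_quotient = tree T for T :: "('a, 'b) ugraph_scheme" +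
  fixes F0 :: "'a set set" and r :: "'a \<Rightarrow> 'c" and G :: "('c, 'd) ugraph_scheme"
  assumes F0: "F0 \<subseteq> E"
    and fibre: "u \<in> V \<Longrightarrow> v \<in> V \<Longrightarrow> r u = r v \<longleftrightarrow> conn (E - F0) u v"
    and vertsG: "verts G = r ` V"
    and edgesG: "edges G = image r ` F0"
begin

text \<open>Edges of the quotient lift to edges of \<open>F\<close>; consecutive lifts need not
  share a vertex, but collapsed edges bridge the gap.\<close>

lemma conn_image_iff:
  assumes "F \<subseteq> F0" "u \<in> V" "v \<in> V"
  shows "conn (image r ` F) (r u) (r v) \<longleftrightarrow> conn (F \<union> (E - F0)) u v"
proof
  have lift: "\<exists>v\<in>V. r v = z \<and> conn (F \<union> (E - F0)) u v" if "conn (image r ` F) (r u) z" for z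
    using that
  proof (induction rule: conn_induct)
    case base
    then show ?case using assms(2) by (intro bexI[of _ u]) simp_all
  next
    case (step y z)
    obtain v where v: "v \<in> V" "r v = y" "conn (F \<union> (E - F0)) u v" using step(3) by blast
    obtain f where f: "f \<in> F" "{y, z} = r ` f" using step(2) by blast
    have fE: "f \<in> E" using f(1) assms(1) F0 by blast
    have "y \<in> r ` f" using f(2) by blast
    then obtain p where p: "p \<in> f" "r p = y" by blast
    obtain q where q: "f = {p, q}" "p \<in> V" "q \<in> V" using edge_other_end[OF fE p(1)] .
    have "conn (E - F0) v p" using fibre[OF v(1) q(2)] v(2) p(2) by simp
    then have "conn (F \<union> (E - F0)) v p" by (rule conn_mono) blast
    then have up: "conn (F \<union> (E - F0)) u p" by (rule conn_trans[OF v(3)])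
    have "conn (F \<union> (E - F0)) p q" using f(1) q(1) by (intro conn_edge) simp
    then have uq: "conn (F \<union> (E - F0)) u q" by (rule conn_trans[OF up])
    have "{y, z} = {r p, r q}" using f(2) q(1) by simp
    then have "z = r p \<or> z = r q" by (auto simp: doubleton_eq_iff)
    then show ?case using up uq q by blast
  qed
  assume "conn (image r ` F) (r u) (r v)"
  then obtain v0 where v0: "v0 \<in> V" "r v0 = r v" "conn (F \<union> (E - F0)) u v0" using lift by blast
  have "conn (E - F0) v0 v" using fibre[OF v0(1) assms(3)] v0(2) by simp
  then have "conn (F \<union> (E - F0)) v0 v" by (rule conn_mono) blast
  then show "conn (F \<union> (E - F0)) u v" by (rule conn_trans[OF v0(3)])
next
  assume "conn (F \<union> (E - F0)) u v"
  then show "conn (image r ` F) (r u) (r v)"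
  proof (induction rule: conn_induct)
    case (step y z)
    have yz: "{y, z} \<in> E" using step(2) assms(1) F0 by blast
    have "conn (image r ` F) (r y) (r z)"
    proof (cases "{y, z} \<in> F")
      case True
      have "{r y, r z} = r ` {y, z}" by simp
      then have "{r y, r z} \<in> image r ` F" using True by blast
      then show ?thesis by (rule conn_edge)
    next
      case False
      then have "conn (E - F0) y z" using step(2) by (intro conn_edge) simp
      then show ?thesis using fibre[of y z] edgeD[OF yz] by simp
    qed
    then show ?case by (rule conn_trans[OF step(3)])
  qed simp
qed

lemma collapse_same: "e \<in> F0 \<Longrightarrow> u \<in> V \<Longrightarrow> v \<in> V \<Longrightarrow> r u = r v \<Longrightarrow> same e u v"
proof -
  assume a: "e \<in> F0" "u \<in> V" "v \<in> V" "r u = r v"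
  then have "conn (E - F0) u v" using fibre by simp
  then show "same e u v" by (rule conn_mono) (use a in blast)
qed

text \<open>If two edges had the same image, collapsed edges together with \<open>g\<close> would
  join the ends of \<open>e\<close> without using \<open>e\<close>. Hence each surviving edge can
  keep its weight.\<close>

lemma image_inj: "inj_on (image r) F0"
proof (rule inj_onI, rule ccontr)
  fix e g assume eg: "e \<in> F0" "g \<in> F0" "r ` e = r ` g" "e \<noteq> g"
  have E: "e \<in> E" "g \<in> E" using eg F0 by auto
  obtain a b where e: "e = {a, b}" "a \<in> V" "b \<in> V" using edgeE[OF E(1)] by metis
  have "r a \<in> r ` g" "r b \<in> r ` g" using eg(3) e by auto
  then obtain c d where cd: "c \<in> g" "d \<in> g" "r a = r c" "r b = r d" by blast
  have V: "c \<in> V" "d \<in> V" using edge_endD[OF E(2)] cd by auto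
  have "same e a c" by (rule collapse_same[OF eg(1) e(2) V(1) cd(3)])
  moreover have "same e c d" by (rule edge_ends_same[OF E(2) eg(4)[symmetric] cd(1,2)])
  moreover have "same e d b" by (rule collapse_same[OF eg(1) V(2) e(3) cd(4)[symmetric]])
  ultimately have "same e a b" using conn_trans[of _ a c d] conn_trans[of _ a d b] by blast
  then show False using bridge[of a b] E(1) e(1) by simp
qed

lemma conn_delete_iff:
  assumes "e \<in> F0" "u \<in> V" "v \<in> V"
  shows "conn (edges G - {r ` e}) (r u) (r v) \<longleftrightarrow> same e u v"
proof -
  have 1: "edges G - {r ` e} = image r ` (F0 - {e})"
    using inj_on_image_set_diff[OF image_inj, of F0 "{e}"] assms(1) unfolding edgesG by auto
  have 2: "F0 - {e} \<union> (E - F0) = E - {e}" using assms(1) F0 by blast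
  show ?thesis using conn_image_iff[of "F0 - {e}" u v] assms(2,3) unfolding 1 2 by blast
qed

lemma edge_image_distinct: "{a, b} \<in> F0 \<Longrightarrow> r a \<noteq> r b"
proof
  assume a: "{a, b} \<in> F0" "r a = r b"
  then have E: "{a, b} \<in> E" using F0 by auto
  show False using collapse_same[OF a(1) edgeD(2,3)[OF E] a(2)] bridge[OF E] by simp
qed

lemma is_tree_quotient: "is_tree G"
  unfolding is_tree_iff
proof (intro conjI ballI allI impI)
  show "verts G \<noteq> {}" using nonempty vertsG by simp
  show "ugraph G"
    unfolding ugraph_def
  proof (intro conjI ballI)
    show "finite (verts G)" using finite_verts vertsG by simp
    fix e assume "e \<in> edges G"
    then obtain f where f: "f \<in> F0" "e = r ` f" unfolding edgesG by blast
    then have fE: "f \<in> E" using F0 by blast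
    obtain a b where ab: "f = {a, b}" "a \<in> V" "b \<in> V" using edgeE[OF fE] by metis
    show "e \<subseteq> verts G" using f ab vertsG by auto
    have "r a \<noteq> r b" using edge_image_distinct f ab by simp
    then show "card e = 2" using f ab by simp
  qed
next
  fix x y assume "x \<in> verts G" "y \<in> verts G"
  then obtain u v where uv: "u \<in> V" "v \<in> V" "x = r u" "y = r v" unfolding vertsG by blast
  have "F0 \<union> (E - F0) = E" using F0 by blast
  then show "conn (edges G) x y"
    using conn_image_iff[OF subset_refl uv(1,2)] connected[OF uv(1,2)] uv(3,4) edgesG by simp
next
  fix x y assume xy: "{x, y} \<in> edges G"
  then obtain f where f: "f \<in> F0" "{x, y} = r ` f" unfolding edgesG by blast
  then have fE: "f \<in> E" using F0 by blast
  have "x \<in> r ` f" using f(2) by blast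
  then obtain p where p: "p \<in> f" "x = r p" by blast
  obtain q where q: "f = {p, q}" "p \<in> V" "q \<in> V" using edge_other_end[OF fE p(1)] .
  have "r p \<noteq> r q" using edge_image_distinct f q by simp
  then have y: "y = r q" using f(2) q p by (auto simp: doubleton_eq_iff)
  have "\<not> same f p q" using bridge[of p q] fE q by simp
  then show "\<not> conn (edges G - {{x, y}}) x y"
    using conn_delete_iff[OF f(1) q(2,3)] f(2) p(2) y by simp
qed

lemma separates_quotient:
  assumes "e \<in> F0" "I \<subseteq> V"
  shows "tree.separates G (r ` e) (r ` I) \<longleftrightarrow> separates e I"
proof -
  interpret G: tree G using is_tree_quotient by unfold_locales
  have "conn (G.E - {r ` e}) (r i) (r j) \<longleftrightarrow> same e i j" if "i \<in> I" "j \<in> I" for i j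
    using conn_delete_iff[OF assms(1), of i j] that assms(2) by blast
  then show ?thesis unfolding G.separates_def separates_def by auto
qed

lemma degree_quotient: "degree G (r v) = card {e \<in> F0. r v \<in> r ` e}"
proof -
  have "{e \<in> edges G. r v \<in> e} = image r ` {e \<in> F0. r v \<in> r ` e}" unfolding edgesG by blast
  moreover have "inj_on (image r) {e \<in> F0. r v \<in> r ` e}" using image_inj by (rule inj_on_subset) blast
  ultimately show ?thesis unfolding degree_def by (simp add: card_image)
qed

lemma sum_quotient:
  assumes "I \<subseteq> V"
  shows "(\<Sum>e | e \<in> edges G \<and> tree.separates G e (r ` I). f e) = (\<Sum>e | e \<in> F0 \<and> separates e I. f (r ` e))"
proof -
  have "{e. e \<in> edges G \<and> tree.separates G e (r ` I)} = image r ` {e. e \<in> F0 \<and> separates e I}"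
    unfolding edgesG using separates_quotient[OF _ assms] by auto
  moreover have "inj_on (image r) {e. e \<in> F0 \<and> separates e I}"
    using image_inj by (rule inj_on_subset) blast
  ultimately show ?thesis by (simp add: sum.reindex)
qed

end

lemma conn_empty: "conn {} u v \<longleftrightarrow> u = v"
proof
  assume "conn {} u v"
  then show "u = v" by (induction rule: conn_induct) auto
qed simp

lemma conn_single_edge: "conn {{a, b}} u v \<longleftrightarrow> u = v \<or> {u, v} = {a, b}"
proof
  assume "conn {{a, b}} u v"
  then show "u = v \<or> {u, v} = {a, b}"
    by (induction rule: conn_induct) (auto simp: doubleton_eq_iff)
next
  assume "u = v \<or> {u, v} = {a, b}"
  then show "conn {{a, b}} u v" by (auto intro: conn_edge)
qed

definition merge :: "'a \<Rightarrow> 'a \<Rightarrow> 'a \<Rightarrow> 'a" where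
  "merge a b = (\<lambda>x. if x = b then a else x)"

lemma contract_simps:
  "verts (contract a b T) = merge a b ` verts T"
  "edges (contract a b T) = image (merge a b) ` (edges T - {{a, b}})"
  "wt (contract a b T) = (\<lambda>f. wt T (the_inv_into (edges T - {{a, b}}) (image (merge a b)) f))"
  unfolding contract_def merge_def Let_def by simp_all

text \<open>The weights of \<open>G\<close> are left free, so that \<open>contract a b T\<close> and
  its reweighted copies are covered alike.\<close>

locale contraction = tree T for T :: "('a, 'b) ugraph_scheme" +
  fixes a b :: 'a and G :: "('a, 'd) ugraph_scheme"
  assumes ab: "{a, b} \<in> E"
    and vertsC: "verts G = merge a b ` V"
    and edgesC: "edges G = image (merge a b) ` (E - {{a, b}})"

sublocale contraction \<subseteq> tree_quotient T "E - {{a, b}}" "merge a b" G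
proof
  fix u v assume "u \<in> V" "v \<in> V"
  have "E - (E - {{a, b}}) = {{a, b}}" using ab by blast
  then show "merge a b u = merge a b v \<longleftrightarrow> conn (E - (E - {{a, b}})) u v"
    using conn_single_edge[of a b u v] by (auto simp: merge_def doubleton_eq_iff)
qed (use vertsC edgesC in auto)

context contraction
begin

lemma verts_contraction: "verts G = V - {b}"
  unfolding vertsC using edgeD[OF ab] by (auto simp: merge_def)

lemma degree_contraction: "v \<noteq> a \<Longrightarrow> v \<noteq> b \<Longrightarrow> degree G v = degree T v"
proof -
  assume v: "v \<noteq> a" "v \<noteq> b"
  have "{e \<in> E - {{a, b}}. merge a b v \<in> merge a b ` e} = edges_at v"
    using v by (auto simp: merge_def split: if_splits)
  then show ?thesis using degree_quotient[of v] v by (simp add: merge_def degree_def)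
qed

text \<open>The contracted edge is lost at both ends; the form with \<open>+ 2\<close> avoids
  truncated subtraction.\<close>

lemma degree_merged: "degree G a + 2 = degree T a + degree T b"
proof -
  have "a \<noteq> b" using edgeD[OF ab] by simp
  have "{e \<in> E - {{a, b}}. merge a b a \<in> merge a b ` e} = (edges_at a - {{a, b}}) \<union> (edges_at b - {{a, b}})"
    by (auto simp: merge_def split: if_splits)
  then have "degree G a = card ((edges_at a - {{a, b}}) \<union> (edges_at b - {{a, b}}))"
    using degree_quotient[of a] \<open>a \<noteq> b\<close> by (simp add: merge_def)
  also have "\<dots> = card (edges_at a - {{a, b}}) + card (edges_at b - {{a, b}})"
  proof (rule card_Un_disjoint)
    have False if "e \<in> edges_at a - {{a, b}}" "e \<in> edges_at b" for e
    proof -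
      have "e \<in> E" "a \<in> e" using that by auto
      then obtain y where "e = {a, y}" by (rule edge_other_end)
      then show False using that \<open>a \<noteq> b\<close> by auto
    qed
    then show "(edges_at a - {{a, b}}) \<inter> (edges_at b - {{a, b}}) = {}" by blast
  qed (use finite_edges_at in auto)
  also have "card (edges_at a - {{a, b}}) = card (edges_at a) - 1"
    using ab finite_edges_at by (subst card_Diff_singleton) auto
  also have "card (edges_at b - {{a, b}}) = card (edges_at b) - 1"
    using ab finite_edges_at by (subst card_Diff_singleton) auto
  moreover have "0 < card (edges_at a)" "0 < card (edges_at b)"
    using ab finite_edges_at by (auto simp: card_gt_0_iff)
  ultimately show ?thesis unfolding degree_def by simp
qed

lemma merge_image: "b \<notin> I \<Longrightarrow> merge a b ` I = I"
  by (auto simp: merge_def)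

lemma card_edges_contraction: "card (edges G) < card E"
proof -
  have "card (edges G) = card (E - {{a, b}})" unfolding edgesC using image_inj by (rule card_image)
  also have "\<dots> < card E" using ab finite_edges by (intro psubset_card_mono) auto
  finally show ?thesis .
qed

end

text \<open>The sum runs over edges of the original tree, so applications need not reason about
  separation in \<open>G\<close>. The condition \<open>b \<notin> I\<close> makes
  \<open>merge a b\<close> fix \<open>I\<close>.\<close>

lemma tree_weight_contraction:
  fixes T G :: "'a wgraph"
  assumes "contraction T a b G" and I: "I \<subseteq> verts T" "b \<notin> I" "I \<noteq> {}"
  shows "tree_weight G I = (\<Sum>e | e \<in> edges T - {{a, b}} \<and> tree.separates T e I. wt G (merge a b ` e))"
proof -
  interpret contraction T a b G by (rule assms(1))
  have "I \<subseteq> verts G" using I verts_contraction by auto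
  then show ?thesis
    using tree_weight_eq[OF is_tree_quotient _ I(3)] sum_quotient[OF I(1), of "wt G"] merge_image[OF I(2)]
    by simp
qed

lemma contraction_contract: "is_tree T \<Longrightarrow> {a, b} \<in> edges T \<Longrightarrow> contraction T a b (contract a b T)"
  by unfold_locales (simp_all add: contract_simps)

lemma wt_contract:
  assumes "is_tree T" "{a, b} \<in> edges T" "e \<in> edges T" "e \<noteq> {a, b}"
  shows "wt (contract a b T) (merge a b ` e) = wt T e"
proof -
  interpret contraction T a b "contract a b T" by (rule contraction_contract[OF assms(1,2)])
  show ?thesis unfolding contract_simps using the_inv_into_f_f[OF image_inj] assms(3,4) by simp
qed

section \<open>Twigs and internal edges of essential trees\<close>

context tree
begin

lemma adjacent_leaves:
  assumes "F \<in> L" "y \<in> L" "{F, y} \<in> E"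
  shows "L \<subseteq> {F, y}"
proof
  fix w assume w: "w \<in> L"
  have "same {F, y} F w \<or> same {F, y} y w" using two_sides[OF assms(3)] w leaves_subset by blast
  then show "w \<in> {F, y}"
    using same_leaf_edge[OF assms(1,3), of w] same_leaf_edge[OF assms(2,3), of w] by auto
qed

end

context essential_tree
begin

lemma leaf_neighbour_node:
  assumes "3 \<le> card L" "F \<in> L" "{F, y} \<in> E"
  shows "is_node T y"
proof -
  have V: "y \<in> V" "F \<noteq> y" using edgeD[OF assms(3)] by auto
  have "degree T y \<noteq> 1"
  proof
    assume "degree T y = 1"
    then have y: "y \<in> L" using V unfolding leaves_def by simp
    have "L \<subseteq> {F, y}" by (rule adjacent_leaves[OF assms(2) y assms(3)])
    then have "card L \<le> card {F, y}" by (intro card_mono) auto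
    then show False using assms(1) V by simp
  qed
  moreover have "degree T y \<noteq> 2" using essential V unfolding essential_def by simp
  moreover have "degree T y \<noteq> 0"
    unfolding degree_def using assms(3) finite_edges_at by (auto simp: card_eq_0_iff)
  ultimately show ?thesis using V unfolding is_node_def by simp
qed

lemma leaf_not_node: "F \<in> L \<Longrightarrow> \<not> is_node T F"
  unfolding leaves_def is_node_def by simp

text \<open>With three leaves, the neighbour of a leaf is no leaf, and its degree is not 2. It is
  therefore already the node where the twig ends.\<close>

lemma twig_iff:
  assumes "3 \<le> card L"
  shows "twig T F p \<longleftrightarrow> (\<exists>N. p = [F, N] \<and> F \<in> L \<and> {F, N} \<in> E)"
proof
  assume t: "twig T F p"
  then have p: "F \<in> L" "is_path T p" "hd p = F" "is_node T (last p)"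
    "\<forall>v\<in>set p. is_node T v \<longrightarrow> v = last p" unfolding twig_def by auto
  then have "p \<noteq> []" "distinct p" unfolding is_path_def by auto
  have "last p \<noteq> F" using leaf_not_node p by blast
  then obtain N q where q: "p = F # N # q"
    using p(3) \<open>p \<noteq> []\<close> by (cases p; cases "tl p") auto
  have edge: "{p ! 0, p ! Suc 0} \<in> E" using p(2) q unfolding is_path_def by auto
  then have FN: "{F, N} \<in> E" using q by simp
  have "is_node T N" using leaf_neighbour_node[OF assms p(1) FN] .
  then have "N = last p" using p(5) q by simp
  have "q = []"
  proof (rule ccontr)
    assume "q \<noteq> []"
    then have "N \<in> set q" using \<open>N = last p\<close> q by auto
    then show False using q \<open>distinct p\<close> by simp
  qed
  then show "\<exists>N. p = [F, N] \<and> F \<in> L \<and> {F, N} \<in> E" using q p(1) FN by blast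
next
  assume "\<exists>N. p = [F, N] \<and> F \<in> L \<and> {F, N} \<in> E"
  then obtain N where N: "p = [F, N]" "F \<in> L" "{F, N} \<in> E" by blast
  then show "twig T F p"
    using leaf_neighbour_node[OF assms N(2,3)] leaf_not_node[OF N(2)] edgeD[OF N(3)]
    unfolding twig_def is_path_def by auto
qed

lemma path_edges_twig: "path_edges [F, N] = {{F, N}}"
  unfolding path_edges_def by auto

lemma internal_edge_iff:
  assumes "3 \<le> card L"
  shows "internal_edge T e \<longleftrightarrow> e \<in> E \<and> e \<inter> L = {}"
proof -
  have "(\<exists>F p. twig T F p \<and> e \<in> path_edges p) \<longleftrightarrow> e \<inter> L \<noteq> {}" if e: "e \<in> E"
  proof
    assume "\<exists>F p. twig T F p \<and> e \<in> path_edges p"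
    then obtain F N where "F \<in> L" "e \<in> path_edges [F, N]" unfolding twig_iff[OF assms] by blast
    then show "e \<inter> L \<noteq> {}" unfolding path_edges_twig by blast
  next
    assume "e \<inter> L \<noteq> {}"
    then obtain F where F: "F \<in> e" "F \<in> L" by blast
    obtain N where N: "e = {F, N}" using edge_other_end[OF e F(1)] .
    then have "twig T F [F, N]" unfolding twig_iff[OF assms] using F e by simp
    moreover have "e \<in> path_edges [F, N]" unfolding path_edges_twig N by simp
    ultimately show "\<exists>F p. twig T F p \<and> e \<in> path_edges p" by blast
  qed
  then show ?thesis unfolding internal_edge_def by blast
qed

end

section \<open>Uniqueness of the pseudostar\<close>

lemma (in essential_tree) split_weight_leaf_side:
  assumes "e \<in> E" "x \<in> e"
  shows "split_weight f (leaf_side T e x) = f e"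
proof -
  have "{g \<in> E. \<exists>y\<in>g. leaf_side T e x = leaf_side T g y} = {e}"
    using leaf_side_inj[OF assms] assms by blast
  then show ?thesis unfolding split_weight_def by simp
qed

lemma (in tree) leaf_side_proper:
  assumes "e \<in> E" "x \<in> e"
  shows "leaf_side T e x \<noteq> L"
proof -
  obtain y where y: "e = {x, y}" using edge_other_end[OF assms] .
  then have "leaf_side T e y = L - leaf_side T e x" using leaf_side_other assms by simp
  moreover have "leaf_side T e y \<noteq> {}" using leaf_side_nonempty assms y by simp
  ultimately show ?thesis by auto
qed

lemma realizes_tree:
  assumes "realizes n k T D"
  shows "is_tree T" "leaves T = {1..n}"
  using assms unfolding realizes_def wtree_on_def by auto

lemma realizes_weight:
  "realizes n k T D \<Longrightarrow> I \<subseteq> {1..n} \<Longrightarrow> card I = k \<Longrightarrow> tree_weight T I = D I"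
  unfolding realizes_def by blast

lemma inwD:
  assumes "inw_essential_pseudostar n k D P"
  shows "essential_tree P" "leaves P = {1..n}" "realizes n k P D" "pseudostar n k P"
    "internal_nonzero_weighted P"
proof -
  have i: "pseudostar n k P" "essential P" "internal_nonzero_weighted P" "realizes n k P D"
    using assms unfolding inw_essential_pseudostar_def by auto
  then show "leaves P = {1..n}" "realizes n k P D" "pseudostar n k P" "internal_nonzero_weighted P"
    using realizes_tree by auto
  show "essential_tree P" using i realizes_tree(1)[OF i(4)] by unfold_locales
qed

lemma inw_split_system:
  assumes "inw_essential_pseudostar n k D P"
  shows "split_system {1..n} k (tree.split_weight P (wt P))"
proof -
  note P = inwD[OF assms]
  interpret P: essential_tree P by (rule P(1))
  show ?thesis
    unfolding split_system_def
  proof (intro conjI allI impI)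
    fix C assume C: "C \<subseteq> {1..n}"
    then show "P.split_weight (wt P) ({1..n} - C) = P.split_weight (wt P) C"
      using P.split_weight_compl P(2) by simp
    assume "P.split_weight (wt P) C \<noteq> 0"
    then have "P.is_cluster C" by (rule P.split_weight_nonzero)
    then obtain e x where e: "e \<in> P.E" "x \<in> e" "C = leaf_side P e x" unfolding P.is_cluster_def by blast
    then obtain y where y: "y \<in> e" "k \<le> card (leaf_side P e y)"
      using P(4) unfolding pseudostar_def by blast
    then show "k \<le> card C \<or> k \<le> card ({1..n} - C)"
      using P.cluster_ends[OF e(1,2) y(1)] e(3) P(2) by auto
  next
    fix C D assume "P.split_weight (wt P) C \<noteq> 0" "P.split_weight (wt P) D \<noteq> 0"
    then show "C \<inter> D = {} \<or> C \<subseteq> D \<or> D \<subseteq> C \<or> C \<union> D = {1..n}"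
      using P.cluster_compat[OF P.split_weight_nonzero P.split_weight_nonzero] P(2) by simp
  qed
qed

lemma realizes_split_sum:
  assumes "realizes n k T D" "I \<subseteq> {1..n}" "card I = k" "0 < k"
  shows "(\<Sum>C\<in>Pow {1..n}. tree.split_weight T (wt T) C * of_bool (cuts C I)) = 2 * D I"
proof -
  interpret tree T using realizes_tree(1)[OF assms(1)] by unfold_locales
  have L: "L = {1..n}" using realizes_tree(2)[OF assms(1)] .
  have I: "I \<subseteq> L" "I \<noteq> {}" using assms L by auto
  then have "I \<subseteq> V" using leaves_subset by blast
  have "D I = (\<Sum>e | e \<in> E \<and> separates e I. wt T e)"
    using tree_weight_eq[OF tree \<open>I \<subseteq> V\<close> I(2)] realizes_weight[OF assms(1-3)] by simp
  then show ?thesis using weight_as_split_sum[OF I(1), of "wt T"] L by simp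
qed

lemma inw_split_weight_eq:
  assumes "3 \<le> k" "k < n" "inw_essential_pseudostar n k D P" "inw_essential_pseudostar n k D P'"
    "C \<subseteq> {1..n}" "C \<noteq> {}" "C \<noteq> {1..n}"
  shows "tree.split_weight P (wt P) C = tree.split_weight P' (wt P') C"
proof (rule split_system_unique[where X = "{1..n}" and k = k])
  show "split_system {1..n} k (tree.split_weight P (wt P))"
    "split_system {1..n} k (tree.split_weight P' (wt P'))"
    using inw_split_system assms(3,4) by blast+
  fix I :: "nat set" assume I: "I \<subseteq> {1..n}" "card I = k"
  have "0 < k" using assms by simp
  then show "(\<Sum>C\<in>Pow {1..n}. tree.split_weight P (wt P) C * of_bool (cuts C I)) =
    (\<Sum>C\<in>Pow {1..n}. tree.split_weight P' (wt P') C * of_bool (cuts C I))"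
    using realizes_split_sum[OF inwD(3)[OF assms(3)] I] realizes_split_sum[OF inwD(3)[OF assms(4)] I]
    by simp
qed (use assms in auto)

text \<open>A nonzero weight makes the split of an internal edge visible in
  \<open>split_weight\<close>, which the family determines. A leaf edge may have weight 0, but its
  split occurs in every tree with that leaf.\<close>

lemma inw_cluster_imp:
  assumes "3 \<le> k" "k < n" "inw_essential_pseudostar n k D P" "inw_essential_pseudostar n k D P'"
    and C: "tree.is_cluster P C"
  shows "tree.is_cluster P' C"
proof -
  note P = inwD[OF assms(3)] and P' = inwD[OF assms(4)]
  interpret P: essential_tree P by (rule P(1))
  interpret P': essential_tree P' by (rule P'(1))
  obtain e x where e: "e \<in> P.E" "x \<in> e" "C = leaf_side P e x" using C unfolding P.is_cluster_def by blast
  show ?thesis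
  proof (cases "e \<inter> P.L = {}")
    case True
    then have "internal_edge P e" using P.internal_edge_iff e(1) assms(1,2) P(2) by simp
    then have "wt P e \<noteq> 0" using P(5) unfolding internal_nonzero_weighted_def by blast
    then have "P.split_weight (wt P) C \<noteq> 0" using P.split_weight_leaf_side e by simp
    moreover have "C \<subseteq> {1..n}" "C \<noteq> {}" "C \<noteq> {1..n}"
      using P.leaf_side_subset[of e x] P.leaf_side_nonempty[OF e(1,2)] P.leaf_side_proper[OF e(1,2)]
        e(3) P(2) by simp_all
    ultimately have "P'.split_weight (wt P') C \<noteq> 0" using inw_split_weight_eq[OF assms(1-4)] by simp
    then show ?thesis by (rule P'.split_weight_nonzero)
  next
    case False
    then obtain l where l: "l \<in> e" "l \<in> P.L" by blast
    then have l': "l \<in> P'.L" using P(2) P'(2) by simp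
    obtain y where y: "{l, y} \<in> P'.E" using P'.leaf_edge[OF l'] .
    have 1: "leaf_side P' {l, y} l = {l}" using P'.leaf_side_leaf[OF l' y] by simp
    then have 2: "leaf_side P' {l, y} y = P'.L - {l}" using P'.leaf_side_other[OF y] by simp
    have "leaf_side P e l = {l}" using P.leaf_side_leaf[OF l(2) e(1) l(1)] .
    then have "C = {l} \<or> C = P'.L - {l}"
      using P.cluster_ends[OF e(1) l(1) e(2)] e(3) P(2) P'(2) by auto
    then show ?thesis using 1 2 y unfolding P'.is_cluster_def by blast
  qed
qed

theorem inw_unique:
  assumes "3 \<le> k" "k < n" "inw_essential_pseudostar n k D P" "inw_essential_pseudostar n k D P'"
  shows "wtree_iso P P'"
proof (rule wtree_iso_of_clusters)
  note P = inwD[OF assms(3)] and P' = inwD[OF assms(4)]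
  interpret P: essential_tree P by (rule P(1))
  interpret P': essential_tree P' by (rule P'(1))
  have "P.is_cluster C \<longleftrightarrow> P'.is_cluster C" for C
    using inw_cluster_imp[OF assms(1-4)] inw_cluster_imp[OF assms(1,2,4,3)] by blast
  then show "cluster_equal_trees P P'"
    by unfold_locales (use P(2) P'(2) assms(1,2) in auto)
  fix e x e' x'
  assume e: "e \<in> P.E" "x \<in> e" "e' \<in> P'.E" "x' \<in> e'" "leaf_side P e x = leaf_side P' e' x'"
  have C: "leaf_side P e x \<subseteq> {1..n}" "leaf_side P e x \<noteq> {}" "leaf_side P e x \<noteq> {1..n}"
    using P.leaf_side_subset[of e x] P.leaf_side_nonempty[OF e(1,2)] P.leaf_side_proper[OF e(1,2)] P(2)
    by simp_all
  have "wt P e = P.split_weight (wt P) (leaf_side P e x)" using P.split_weight_leaf_side[OF e(1,2)] by simp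
  also have "\<dots> = P'.split_weight (wt P') (leaf_side P e x)" by (rule inw_split_weight_eq[OF assms C])
  also have "\<dots> = wt P' e'" unfolding e(5) by (rule P'.split_weight_leaf_side[OF e(3,4)])
  finally show "wt P e = wt P' e'" .
qed

section \<open>Contracting internal edges\<close>

lemma wtree_iso_refl: "wtree_iso T T"
  unfolding wtree_iso_def by (intro exI[of _ id]) auto

lemma (in essential_tree) degree_inner:
  assumes "v \<in> e" "e \<in> E" "v \<notin> L"
  shows "3 \<le> degree T v"
proof -
  have v: "v \<in> V" using edge_endD assms by blast
  have "degree T v \<noteq> 0"
    unfolding degree_def using assms finite_edges_at by (auto simp: card_eq_0_iff)
  moreover have "degree T v \<noteq> 1" using assms(3) v unfolding leaves_def by simp
  moreover have "degree T v \<noteq> 2" using essential v unfolding essential_def by simp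
  ultimately show ?thesis by linarith
qed

text \<open>Both ends have degree at least 3, so the merged vertex has degree at least
  \<open>3 + 3 - 2 = 4\<close>.\<close>

lemma contraction_inner:
  assumes "contraction T a b G" "essential T" "a \<notin> leaves T" "b \<notin> leaves T"
  shows "leaves G = leaves T" "essential G"
proof -
  interpret contraction T a b G by (rule assms)
  interpret essential_tree T using assms(2) by unfold_locales
  have ne: "a \<noteq> b" "a \<in> V" "b \<in> V" using edgeD[OF ab] by auto
  have "3 \<le> degree T a" "3 \<le> degree T b" using degree_inner[OF _ ab] assms by auto
  then have a: "4 \<le> degree G a" using degree_merged by linarith
  have "a \<notin> leaves G" unfolding leaves_def using a by simp
  moreover have "b \<notin> leaves G" unfolding leaves_def verts_contraction by simp
  ultimately have n: "v \<notin> leaves G" if "v = a \<or> v = b" for v using that by blast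
  show "leaves G = L"
  proof (rule set_eqI)
    fix v show "v \<in> leaves G \<longleftrightarrow> v \<in> L"
    proof (cases "v = a \<or> v = b")
      case True
      then show ?thesis using n[OF True] assms(3,4) by metis
    next
      case False
      then show ?thesis unfolding leaves_def verts_contraction using degree_contraction[of v] by simp
    qed
  qed
  show "essential G"
    unfolding essential_def
  proof
    fix v assume "v \<in> verts G"
    then have v: "v \<in> V" "v \<noteq> b" using verts_contraction by auto
    show "degree G v \<noteq> 2"
    proof (cases "v = a")
      case True
      then show ?thesis using a by simp
    next
      case False
      then show ?thesis using degree_contraction[OF False v(2)] essential v unfolding essential_def by simp
    qed
  qed
qed

text \<open>The last clause admits every \<open>X\<close> isomorphic to \<open>T1\<close> because
  the reduction arrives at a prescribed pseudostar only up to isomorphism.\<close>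

lemma contract_zero_edge:
  assumes n: "3 \<le> n" "0 < k" and T: "essential T" "realizes n k T D"
    and e: "internal_edge T e" "wt T e = 0"
  shows "\<exists>T1. essential T1 \<and> realizes n k T1 D \<and> card (edges T1) < card (edges T) \<and>
    (\<forall>X. wtree_on n X \<longrightarrow> wtree_iso T1 X \<longrightarrow> insert_zero_internal n X T)"
proof -
  note tr = realizes_tree[OF T(2)]
  interpret T: essential_tree T using tr(1) T(1) by unfold_locales
  have eT: "e \<in> T.E" "e \<inter> T.L = {}" using T.internal_edge_iff e(1) tr n by auto
  obtain a b where eab: "e = {a, b}" using T.edgeE[OF eT(1)] by metis
  let ?G = "contract a b T"
  have c: "contraction T a b ?G" using contraction_contract tr(1) eT(1) eab by simp
  interpret contraction T a b ?G by (rule c)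
  have inner: "leaves ?G = T.L" "essential ?G"
    using contraction_inner[OF c T(1)] eT eab by auto
  have w: "tree_weight ?G I = D I" if I: "I \<subseteq> {1..n}" "card I = k" for I
  proof -
    have I': "I \<subseteq> T.V" "b \<notin> I" "I \<noteq> {}" using I tr(2) eT eab T.leaves_subset n by auto
    have "tree_weight ?G I
        = (\<Sum>f | f \<in> T.E - {{a, b}} \<and> T.separates f I. wt ?G (merge a b ` f))"
      by (rule tree_weight_contraction[OF c I'])
    also have "\<dots> = (\<Sum>f | f \<in> T.E - {{a, b}} \<and> T.separates f I. wt T f)"
      using wt_contract[OF tr(1), of a b] eT eab by (intro sum.cong) auto
    also have "\<dots> = (\<Sum>f | f \<in> T.E \<and> T.separates f I. wt T f)"
      using e(2) eab T.finite_edges by (intro sum.mono_neutral_left) auto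
    also have "\<dots> = D I" using tree_weight_eq[OF tr(1) I'(1,3)] realizes_weight[OF T(2) I] by simp
    finally show ?thesis .
  qed
  have "realizes n k ?G D"
    using is_tree_quotient inner tr w unfolding realizes_def wtree_on_def by simp
  moreover have "insert_zero_internal n X T" if "wtree_on n X" "wtree_iso ?G X" for X
    using that T(2) e eab unfolding insert_zero_internal_def realizes_def by blast
  ultimately show ?thesis using inner card_edges_contraction by blast
qed

text \<open>This count is the origin of the divisor in \<open>y / k\<close>. The edge at a leaf
  separates \<open>I\<close> exactly if the leaf belongs to \<open>I\<close>, and no edge serves two
  leaves because leaves have nodes as neighbours.\<close>

lemma (in essential_tree) card_separating_leaf_edges:
  assumes "3 \<le> card L" "I \<subseteq> L" "2 \<le> card I"
  shows "card {e \<in> E. separates e I \<and> e \<inter> L \<noteq> {}} = card I"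
proof -
  have ex: "\<exists>e. e \<in> E \<and> l \<in> e" if l: "l \<in> L" for l
  proof -
    obtain y where "{l, y} \<in> E" using leaf_edge[OF l] .
    then show ?thesis by (intro exI[of _ "{l, y}"]) simp
  qed
  define g where "g l = (SOME e. e \<in> E \<and> l \<in> e)" for l
  have g: "g l \<in> E" "l \<in> g l" if "l \<in> L" for l using someI_ex[OF ex[OF that]] unfolding g_def by auto
  have sep: "separates e I \<longleftrightarrow> l \<in> I" if "l \<in> L" "e \<in> E" "l \<in> e" for l e
  proof -
    have "I - {l} \<noteq> {}"
    proof
      assume "I - {l} = {}"
      then have "card I \<le> card {l}" by (intro card_mono) auto
      then show False using assms(3) by simp
    qed
    then show ?thesis
      using separates_iff_cuts[OF assms(2) that(2,3)] leaf_side_leaf[OF that] unfolding cuts_def by auto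
  qed
  have "{e \<in> E. separates e I \<and> e \<inter> L \<noteq> {}} = g ` I"
  proof (intro equalityI subsetI)
    fix e assume "e \<in> {e \<in> E. separates e I \<and> e \<inter> L \<noteq> {}}"
    then obtain l where l: "e \<in> E" "separates e I" "l \<in> e" "l \<in> L" by blast
    then have "e = g l" using leaf_edge_unique[OF l(4,1,3)] g by blast
    then show "e \<in> g ` I" using sep[OF l(4,1,3)] l(2) by blast
  next
    fix e assume "e \<in> g ` I"
    then obtain l where l: "l \<in> I" "e = g l" by blast
    then have "l \<in> L" using assms(2) by blast
    note gl = g[OF this]
    show "e \<in> {e \<in> E. separates e I \<and> e \<inter> L \<noteq> {}}"
      using sep[OF \<open>l \<in> L\<close> gl] gl l \<open>l \<in> L\<close> by blast
  qed
  moreover have "inj_on g I"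
  proof (rule inj_onI, rule ccontr)
    fix l m assume lm: "l \<in> I" "m \<in> I" "g l = g m" "l \<noteq> m"
    then have L: "l \<in> L" "m \<in> L" using assms(2) by auto
    have "g l = {l, m}" using edge_other_end[OF g[OF L(1)]] g(2)[OF L(2)] lm by auto
    then have "is_node T m" using leaf_neighbour_node[OF assms(1) L(1)] g(1)[OF L(1)] by simp
    then show False using leaf_not_node L by blast
  qed
  ultimately show ?thesis by (simp add: card_image)
qed

text \<open>Neither side of \<open>e\<close> has room for a k-subset, so every k-subset loses
  \<open>wt T e\<close> by the contraction. Each of the \<open>k\<close> leaf edges that separate it
  gives back a \<open>k\<close>-th part.\<close>

lemma contract_small_edge:
  assumes k: "3 \<le> k" "k < n" and T: "essential T" "realizes n k T D"
    and e: "e \<in> edges T" "\<And>x. x \<in> e \<Longrightarrow> card (leaf_side T e x) < k"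
  shows "\<exists>T1. essential T1 \<and> realizes n k T1 D \<and> card (edges T1) < card (edges T) \<and>
    (positive_weighted T \<longrightarrow> positive_weighted T1) \<and>
    (\<forall>X. wtree_on n X \<longrightarrow> wtree_iso T1 X \<longrightarrow> k_OI n k X T)"
proof -
  note tr = realizes_tree[OF T(2)]
  interpret T: essential_tree T using tr(1) T(1) by unfold_locales
  have L3: "3 \<le> card T.L" using tr k by simp
  \<comment> \<open>The side opposite to a leaf has \<open>n - 1 \<ge> k\<close> leaves, so a small
    edge is never a leaf edge.\<close>
  have inner_e: "x \<notin> T.L" if x: "x \<in> e" for x
  proof
    assume l: "x \<in> T.L"
    obtain y where y: "e = {x, y}" using T.edge_other_end[OF e(1) x] .
    have "leaf_side T e y = {1..n} - {x}"
      using T.leaf_side_other[of x y] T.leaf_side_leaf[OF l e(1) x] e(1) y tr(2) by simp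
    then have "card (leaf_side T e y) = n - 1" using l tr(2) by simp
    then show False using e(2)[of y] y k by simp
  qed
  obtain a b where eab: "e = {a, b}" using T.edgeE[OF e(1)] by metis
  let ?C = "contract a b T"
  define c where "c = wt T e / real k"
  define G where "G = ?C\<lparr>wt := \<lambda>f. wt ?C f + (if f \<inter> {1..n} \<noteq> {} then c else 0)\<rparr>"
  have G: "verts G = verts ?C" "edges G = edges ?C"
    "wt G = (\<lambda>f. wt ?C f + (if f \<inter> {1..n} \<noteq> {} then c else 0))" unfolding G_def by simp_all
  have cC: "contraction T a b ?C" using contraction_contract tr(1) e(1) eab by simp
  have cG: "contraction T a b G"
    using e(1) eab by unfold_locales (simp_all add: G contract_simps)
  interpret contraction T a b G by (rule cG)
  have nL: "a \<notin> T.L" "b \<notin> T.L" using inner_e eab by auto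
  have inner: "leaves G = {1..n}" "essential G" using contraction_inner[OF cG T(1) nL] tr by auto
  have innerC: "leaves ?C = {1..n}" "essential ?C" using contraction_inner[OF cC T(1) nL] tr by auto
  have meets: "merge a b ` f \<inter> {1..n} \<noteq> {} \<longleftrightarrow> f \<inter> T.L \<noteq> {}" for f
    using nL tr(2) by (auto simp: merge_def)
  have wG: "wt G (merge a b ` f) = wt T f + (if f \<inter> T.L \<noteq> {} then c else 0)"
    if "f \<in> T.E - {{a, b}}" for f
    using wt_contract[OF tr(1), of a b f] that e(1) eab meets[of f] by (simp add: G)
  have w: "tree_weight G I = D I" if I: "I \<subseteq> {1..n}" "card I = k" for I
  proof -
    have I': "I \<subseteq> T.V" "b \<notin> I" "I \<noteq> {}" "I \<subseteq> T.L" "finite I"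
      using I tr(2) nL T.leaves_subset k finite_subset[OF I(1)] by auto
    have sep_e: "T.separates e I"
    proof -
      have fin: "finite (leaf_side T e x)" for x
        using T.leaf_side_subset[of e x] tr(2) finite_subset by fastforce
      have "\<not> I \<subseteq> leaf_side T e x" if "x \<in> e" for x
        using card_mono[OF fin, of I x] e(2)[OF that] I(2) by auto
      then have "\<not> I \<subseteq> leaf_side T e a" "\<not> I \<subseteq> leaf_side T e b" using eab by auto
      moreover have "leaf_side T e b = T.L - leaf_side T e a" using T.leaf_side_other e(1) eab by simp
      ultimately have "cuts (leaf_side T e a) I" using I'(4) unfolding cuts_def by blast
      then show ?thesis using T.separates_iff_cuts[OF I'(4) e(1), of a] eab by simp
    qed
    let ?S = "{f. f \<in> T.E - {{a, b}} \<and> T.separates f I}"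
    have S: "finite ?S" using T.finite_edges by simp
    have "tree_weight G I = (\<Sum>f\<in>?S. wt G (merge a b ` f))"
      by (rule tree_weight_contraction[OF cG I'(1-3)])
    also have "\<dots> = (\<Sum>f\<in>?S. wt T f + (if f \<inter> T.L \<noteq> {} then c else 0))"
      using wG by (intro sum.cong) auto
    also have "\<dots> = (\<Sum>f\<in>?S. wt T f) + (\<Sum>f\<in>?S. if f \<inter> T.L \<noteq> {} then c else 0)"
      by (rule sum.distrib)
    also have "(\<Sum>f\<in>?S. if f \<inter> T.L \<noteq> {} then c else 0) = (\<Sum>f\<in>{f \<in> ?S. f \<inter> T.L \<noteq> {}}. c)"
      using S by (rule sum.inter_filter[symmetric])
    also have "{f \<in> ?S. f \<inter> T.L \<noteq> {}} = {f \<in> T.E. T.separates f I \<and> f \<inter> T.L \<noteq> {}}"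
      using nL by auto
    also have "(\<Sum>f\<in>{f \<in> T.E. T.separates f I \<and> f \<inter> T.L \<noteq> {}}. c) = real k * c"
      using T.card_separating_leaf_edges[OF L3 I'(4)] I k by simp
    also have "real k * c = wt T e" using k unfolding c_def by simp
    also have "(\<Sum>f\<in>?S. wt T f) + wt T e = (\<Sum>f\<in>insert e ?S. wt T f)"
      using S eab by (subst sum.insert) auto
    also have "insert e ?S = {f. f \<in> T.E \<and> T.separates f I}" using e(1) sep_e eab by auto
    also have "(\<Sum>f\<in>{f. f \<in> T.E \<and> T.separates f I}. wt T f) = D I"
      using tree_weight_eq[OF tr(1) I'(1,3)] realizes_weight[OF T(2) I] by simp
    finally show ?thesis .
  qed
  have "realizes n k G D"
    using is_tree_quotient inner w unfolding realizes_def wtree_on_def by simp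
  moreover have "positive_weighted G" if pos: "positive_weighted T"
    unfolding positive_weighted_def
  proof
    fix f assume "f \<in> edges G"
    then obtain g where g: "g \<in> T.E - {{a, b}}" "f = merge a b ` g" unfolding edgesC by blast
    have "0 < wt T g" "0 < wt T e" using pos g e(1) unfolding positive_weighted_def by auto
    then show "0 < wt G f" using wG[OF g(1)] g(2) k unfolding c_def by (auto intro: add_pos_pos)
  qed
  moreover have "k_OI n k X T" if X: "wtree_on n X" "wtree_iso G X" for X
  proof -
    interpret C: contraction T a b ?C by (rule cC)
    interpret C: essential_tree ?C
      using C.is_tree_quotient innerC(2) by (simp add: essential_tree_def essential_tree_axioms_def tree_def)
    have L3': "3 \<le> card C.L" using innerC k by simp
    have "add_to_twigs c ?C G"
      unfolding add_to_twigs_def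
    proof (intro conjI allI impI)
      fix F p assume "twig ?C F p"
      then obtain N where N: "p = [F, N]" "F \<in> C.L" unfolding C.twig_iff[OF L3'] by blast
      have "{F, N} \<inter> {1..n} \<noteq> {}" using N innerC by auto
      then show "sum (wt G) (path_edges p) = sum (wt ?C) (path_edges p) + c"
        using C.path_edges_twig[of F N] N by (simp add: G)
    next
      fix f assume "internal_edge ?C f"
      then have "f \<inter> {1..n} = {}" using C.internal_edge_iff[OF L3'] innerC by simp
      then show "wt G f = wt ?C f" by (simp add: G)
    qed (simp_all add: G)
    then have "k_IO n k T X"
      using X T(2) e eab unfolding k_IO_def realizes_def c_def by blast
    then show ?thesis unfolding k_OI_def .
  qed
  ultimately show ?thesis using inner(2) card_edges_contraction by blast
qed

text \<open>A tree that fails the pseudostar condition has a small edge; any other failure is an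
  internal edge of weight 0. Positive weights exclude the latter, so that \<open>k_OI\<close> alone
  suffices for them.\<close>

lemma reduction_step:
  assumes k: "3 \<le> k" "k < n" and T: "essential T" "realizes n k T D"
    and not: "\<not> inw_essential_pseudostar n k D T"
  shows "\<exists>T1. essential T1 \<and> realizes n k T1 D \<and> card (edges T1) < card (edges T) \<and>
    (\<forall>X. wtree_on n X \<longrightarrow> wtree_iso T1 X \<longrightarrow> k_OI n k X T \<or> insert_zero_internal n X T) \<and>
    (positive_weighted T \<longrightarrow> positive_weighted T1 \<and>
      (\<forall>X. wtree_on n X \<longrightarrow> wtree_iso T1 X \<longrightarrow> k_OI n k X T))"
proof (cases "pseudostar n k T")
  case True
  then have "\<not> internal_nonzero_weighted T"
    using not T unfolding inw_essential_pseudostar_def by simp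
  then obtain e where e: "internal_edge T e" "wt T e = 0" unfolding internal_nonzero_weighted_def by blast
  have "e \<in> edges T" using e(1) unfolding internal_edge_def by simp
  then have "\<not> positive_weighted T" using e(2) unfolding positive_weighted_def by force
  moreover have n: "3 \<le> n" "0 < k" using k by auto
  ultimately show ?thesis using contract_zero_edge[OF n T e] by blast
next
  case False
  then obtain e where e: "e \<in> edges T" "\<And>x. x \<in> e \<Longrightarrow> card (leaf_side T e x) < k"
    using realizes_tree[OF T(2)] unfolding pseudostar_def by (auto simp: not_le)
  then show ?thesis using contract_small_edge[OF k T e] by blast
qed

lemma inw_exists:
  assumes k: "3 \<le> k" "k < n" and T: "essential T" "realizes n k T D"
  shows "\<exists>P. inw_essential_pseudostar n k D P \<and> (positive_weighted T \<longrightarrow> positive_weighted P)"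
  using T
proof (induction "card (edges T)" arbitrary: T rule: less_induct)
  case less
  show ?case
  proof (cases "inw_essential_pseudostar n k D T")
    case False
    obtain T1 where T1: "essential T1" "realizes n k T1 D" "card (edges T1) < card (edges T)"
      "positive_weighted T \<longrightarrow> positive_weighted T1"
      using reduction_step[OF k less.prems False] by blast
    show ?thesis using less.hyps[OF T1(3,1,2)] T1(4) by blast
  qed blast
qed

text \<open>The contractions are read backwards. The first alternative is separate because zero
  steps of the closure would demand \<open>T = P\<close> and not merely an isomorphism.\<close>

lemma reachable:
  assumes k: "3 \<le> k" "k < n" and P: "inw_essential_pseudostar n k D P"
    and T: "essential T" "realizes n k T D"
  shows "wtree_iso T P \<or> (\<lambda>X Y. k_OI n k X Y \<or> insert_zero_internal n X Y)\<^sup>*\<^sup>* P T"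
  using T
proof (induction "card (edges T)" arbitrary: T rule: less_induct)
  case less
  let ?R = "\<lambda>X Y. k_OI n k X Y \<or> insert_zero_internal n X Y"
  show ?case
  proof (cases "inw_essential_pseudostar n k D T")
    case True
    then show ?thesis using inw_unique[OF k True P] by simp
  next
    case False
    obtain T1 where T1: "essential T1" "realizes n k T1 D" "card (edges T1) < card (edges T)"
      "\<And>X. wtree_on n X \<Longrightarrow> wtree_iso T1 X \<Longrightarrow> ?R X T"
      using reduction_step[OF k less.prems False] by metis
    have on: "wtree_on n T1" "wtree_on n P" using T1(2) inwD(3)[OF P] unfolding realizes_def by auto
    from less.hyps[OF T1(3,1,2)] show ?thesis
    proof
      assume "wtree_iso T1 P"
      then have "?R P T" by (rule T1(4)[OF on(2)])
      then have "?R\<^sup>*\<^sup>* P T" by (rule r_into_rtranclp)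
      then show ?thesis ..
    next
      assume "?R\<^sup>*\<^sup>* P T1"
      then have "?R\<^sup>*\<^sup>* P T" by (rule rtranclp.rtrancl_into_rtrancl) (rule T1(4)[OF on(1) wtree_iso_refl])
      then show ?thesis ..
    qed
  qed
qed

lemma reachable_positive:
  assumes k: "3 \<le> k" "k < n" and P: "inw_essential_pseudostar n k D P"
    and T: "essential T" "realizes n k T D" "positive_weighted T"
  shows "wtree_iso T P \<or> (k_OI n k)\<^sup>*\<^sup>* P T"
  using T
proof (induction "card (edges T)" arbitrary: T rule: less_induct)
  case less
  show ?case
  proof (cases "inw_essential_pseudostar n k D T")
    case True
    then show ?thesis using inw_unique[OF k True P] by simp
  next
    case False
    obtain T1 where T1: "essential T1" "realizes n k T1 D" "card (edges T1) < card (edges T)"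
      "positive_weighted T1" "\<And>X. wtree_on n X \<Longrightarrow> wtree_iso T1 X \<Longrightarrow> k_OI n k X T"
      using reduction_step[OF k less.prems(1,2) False] less.prems(3) by metis
    have on: "wtree_on n T1" "wtree_on n P" using T1(2) inwD(3)[OF P] unfolding realizes_def by auto
    from less.hyps[OF T1(3,1,2,4)] show ?thesis
    proof
      assume "wtree_iso T1 P"
      then have "k_OI n k P T" by (rule T1(5)[OF on(2)])
      then have "(k_OI n k)\<^sup>*\<^sup>* P T" by (rule r_into_rtranclp)
      then show ?thesis ..
    next
      assume "(k_OI n k)\<^sup>*\<^sup>* P T1"
      then have "(k_OI n k)\<^sup>*\<^sup>* P T"
        by (rule rtranclp.rtrancl_into_rtrancl) (rule T1(5)[OF on(1) wtree_iso_refl])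
      then show ?thesis ..
    qed
  qed
qed

section \<open>Passing to an essential tree on the labelled leaves\<close>

definition label_realizes ::
    "nat \<Rightarrow> nat \<Rightarrow> (nat set \<Rightarrow> real) \<Rightarrow> 'a wgraph \<Rightarrow> (nat \<Rightarrow> 'a) \<Rightarrow> bool" where
  "label_realizes n k D T \<phi> \<longleftrightarrow> is_tree T \<and> inj_on \<phi> {1..n} \<and> \<phi> ` {1..n} \<subseteq> leaves T \<and>
     (\<forall>I. I \<subseteq> {1..n} \<and> card I = k \<longrightarrow> tree_weight T (\<phi> ` I) = D I)"

lemma (in contraction) leaves_contraction:
  assumes "v \<in> L" "v \<noteq> b" "v = a \<Longrightarrow> degree T b = 2"
  shows "v \<in> leaves G"
proof -
  have v: "v \<in> verts G" "degree T v = 1"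
    using assms leaves_subset verts_contraction unfolding leaves_def by auto
  have "degree G v = 1"
  proof (cases "v = a")
    case True
    then show ?thesis using degree_merged assms(3) v(2) by simp
  next
    case False
    then show ?thesis using degree_contraction[OF False assms(2)] v(2) by simp
  qed
  then show ?thesis using v unfolding leaves_def by simp
qed

text \<open>Deleting a leaf amounts to contracting its edge, which separates no set of labelled
  leaves. The neighbour \<open>a\<close> may become a leaf or get degree 2, which is left to further
  reductions.\<close>

lemma delete_unlabelled_leaf:
  assumes n: "3 \<le> n" "0 < k" and T: "label_realizes n k D T \<phi>"
    and b: "b \<in> leaves T" "b \<notin> \<phi> ` {1..n}"
  shows "\<exists>G. label_realizes n k D G \<phi> \<and> card (edges G) < card (edges T) \<and>
    (positive_weighted T \<longrightarrow> positive_weighted G)"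
proof -
  have T': "is_tree T" "inj_on \<phi> {1..n}" "\<phi> ` {1..n} \<subseteq> leaves T"
    "\<And>I. I \<subseteq> {1..n} \<Longrightarrow> card I = k \<Longrightarrow> tree_weight T (\<phi> ` I) = D I"
    using T unfolding label_realizes_def by auto
  interpret T: tree T using T'(1) by unfold_locales
  obtain a where a: "{a, b} \<in> T.E" using T.leaf_edge[OF b(1)] by (metis insert_commute)
  have aL: "a \<notin> T.L"
  proof
    assume "a \<in> T.L"
    then have "\<phi> ` {1..n} \<subseteq> {a, b}" using T.adjacent_leaves[OF _ b(1) a] T'(3) by blast
    then have "card (\<phi> ` {1..n}) \<le> card {a, b}" by (intro card_mono) auto
    also have "\<dots> \<le> 2" by (simp add: card_insert_if)
    finally show False using card_image[OF T'(2)] n by simp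
  qed
  let ?G = "contract a b T"
  have c: "contraction T a b ?G" using contraction_contract[OF T'(1) a] .
  interpret C: contraction T a b ?G by (rule c)
  have w: "tree_weight ?G (\<phi> ` I) = D I" if I: "I \<subseteq> {1..n}" "card I = k" for I
  proof -
    have I': "\<phi> ` I \<subseteq> T.V" "b \<notin> \<phi> ` I" "\<phi> ` I \<noteq> {}" "\<phi> ` I \<subseteq> T.L"
      using I T'(3) b T.leaves_subset n by auto
    have "\<not> cuts {b} (\<phi> ` I)" using I'(2) unfolding cuts_def by simp
    then have ns: "\<not> T.separates {a, b} (\<phi> ` I)"
      using T.separates_iff_cuts[OF I'(4) a, of b] T.leaf_side_leaf[OF b(1) a] by simp
    have "tree_weight ?G (\<phi> ` I)
        = (\<Sum>f | f \<in> T.E - {{a, b}} \<and> T.separates f (\<phi> ` I). wt ?G (merge a b ` f))"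
      by (rule tree_weight_contraction[OF c I'(1-3)])
    also have "\<dots> = (\<Sum>f | f \<in> T.E \<and> T.separates f (\<phi> ` I). wt T f)"
      using wt_contract[OF T'(1) a] ns by (intro sum.cong) auto
    also have "\<dots> = D I" using tree_weight_eq[OF T'(1) I'(1,3)] T'(4)[OF I] by simp
    finally show ?thesis .
  qed
  have "\<phi> ` {1..n} \<subseteq> leaves ?G"
  proof
    fix v assume v: "v \<in> \<phi> ` {1..n}"
    then have "v \<in> T.L" "v \<noteq> b" "v \<noteq> a" using T'(3) b(2) aL by auto
    then show "v \<in> leaves ?G" using C.leaves_contraction by blast
  qed
  then have "label_realizes n k D ?G \<phi>"
    using C.is_tree_quotient T'(2) w unfolding label_realizes_def by simp
  moreover have "positive_weighted ?G" if pos: "positive_weighted T"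
    unfolding positive_weighted_def
  proof
    fix f assume "f \<in> edges ?G"
    then obtain g where g: "g \<in> T.E - {{a, b}}" "f = merge a b ` g" unfolding C.edgesC by blast
    then show "0 < wt ?G f" using wt_contract[OF T'(1) a, of g] pos unfolding positive_weighted_def by simp
  qed
  ultimately show ?thesis using C.card_edges_contraction by blast
qed

text \<open>Both edges at \<open>b\<close> induce the same split, so a single edge carrying the sum
  of their weights does the work of the two.\<close>

lemma suppress_degree_2:
  assumes n: "0 < k" and T: "label_realizes n k D T \<phi>"
    and b: "b \<in> verts T" "degree T b = 2"
  shows "\<exists>G. label_realizes n k D G \<phi> \<and> card (edges G) < card (edges T) \<and>
    (positive_weighted T \<longrightarrow> positive_weighted G)"
proof -
  have T': "is_tree T" "inj_on \<phi> {1..n}" "\<phi> ` {1..n} \<subseteq> leaves T"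
    "\<And>I. I \<subseteq> {1..n} \<Longrightarrow> card I = k \<Longrightarrow> tree_weight T (\<phi> ` I) = D I"
    using T unfolding label_realizes_def by auto
  interpret T: tree T using T'(1) by unfold_locales
  have bL: "b \<notin> T.L" using b unfolding leaves_def by simp
  obtain e1 e2 where e: "T.edges_at b = {e1, e2}" "e1 \<noteq> e2"
    using b(2) unfolding degree_def card_2_iff by blast
  then have eE: "e1 \<in> T.E" "b \<in> e1" "e2 \<in> T.E" "b \<in> e2" by blast+
  obtain a where a: "e1 = {b, a}" using T.edge_other_end[OF eE(1,2)] .
  have e1: "e1 = {a, b}" using a by (simp add: insert_commute)
  have abE: "{a, b} \<in> T.E" using eE e1 by simp
  let ?C = "contract a b T"
  define G where "G = ?C\<lparr>wt := \<lambda>f. wt ?C f + (if f = merge a b ` e2 then wt T e1 else 0)\<rparr>"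
  have G: "verts G = verts ?C" "edges G = edges ?C"
    "wt G = (\<lambda>f. wt ?C f + (if f = merge a b ` e2 then wt T e1 else 0))" unfolding G_def by simp_all
  have cG: "contraction T a b G"
    using abE by unfold_locales (simp_all add: G contract_simps)
  interpret C: contraction T a b G by (rule cG)
  have wG: "wt G (merge a b ` f) = wt T f + (if f = e2 then wt T e1 else 0)"
    if f: "f \<in> T.E - {{a, b}}" for f
  proof -
    have "e2 \<in> T.E - {{a, b}}" using eE e(2) e1 by simp
    then have "merge a b ` f = merge a b ` e2 \<longleftrightarrow> f = e2"
      using inj_on_eq_iff[OF C.image_inj f] by blast
    then show ?thesis using wt_contract[OF T'(1) abE, of f] f by (simp add: G)
  qed
  \<comment> \<open>Apart from \<open>b\<close> itself, what lies beyond \<open>e1\<close> as seen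
    from \<open>b\<close> is all that remains connected to \<open>b\<close> without
    \<open>e2\<close>.\<close>
  have side: "T.same e2 b v \<longleftrightarrow> T.same e1 a v" if v: "v \<in> T.V" "v \<noteq> b" for v
  proof
    have nab: "\<not> T.same e1 a b" using T.bridge[OF abE] e1 by simp
    assume av: "T.same e1 a v"
    have "T.same e2 a v" by (rule T.nest[OF eE(3) e(2) eE(4) nab av])
    moreover have "T.same e2 b a" by (rule T.edge_ends_same[OF eE(1) e(2) eE(2)]) (simp add: e1)
    ultimately show "T.same e2 b v" by (rule conn_trans[rotated])
  next
    assume bv: "T.same e2 b v"
    obtain z where "{b, z} \<in> {e \<in> T.E. \<not> T.same e b v}"
      using conn_first_edge[OF T.conn_separating_edges[OF b(1) v(1)] v(2)[symmetric]] .
    then have z: "{b, z} \<in> T.edges_at b" "\<not> T.same {b, z} b v" by auto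
    then have "{b, z} = e1" using e(1) bv by auto
    then have "\<not> T.same e1 b v" using z(2) by simp
    then show "T.same e1 a v" using T.two_sides[OF abE v(1)] e1 by auto
  qed
  have w: "tree_weight G (\<phi> ` I) = D I" if I: "I \<subseteq> {1..n}" "card I = k" for I
  proof -
    have I': "\<phi> ` I \<subseteq> T.V" "b \<notin> \<phi> ` I" "\<phi> ` I \<noteq> {}" "\<phi> ` I \<subseteq> T.L"
      using I T'(3) bL T.leaves_subset n by auto
    have "v \<in> leaf_side T e2 b \<longleftrightarrow> v \<in> leaf_side T e1 a" if v: "v \<in> T.L" for v
    proof -
      have "v \<in> T.V" "v \<noteq> b" "a \<in> e1" using v bL T.leaves_subset e1 by auto
      then show ?thesis
        using side T.leaf_side_same[OF eE(3,4,4) v] T.leaf_side_same[OF eE(1) _ _ v, of a] by blast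
    qed
    then have "leaf_side T e2 b = leaf_side T e1 a" using T.leaf_side_subset by blast
    then have se: "T.separates e2 (\<phi> ` I) \<longleftrightarrow> T.separates e1 (\<phi> ` I)"
      using T.separates_iff_cuts[OF I'(4) eE(3,4)] T.separates_iff_cuts[OF I'(4) eE(1), of a] e1 by simp
    let ?S = "{f. f \<in> T.E - {{a, b}} \<and> T.separates f (\<phi> ` I)}"
    have S: "finite ?S" using T.finite_edges by simp
    have e2: "e2 \<in> T.E - {{a, b}}" using eE e(2) e1 by simp
    have "tree_weight G (\<phi> ` I) = (\<Sum>f\<in>?S. wt G (merge a b ` f))"
      by (rule tree_weight_contraction[OF cG I'(1-3)])
    also have "\<dots> = (\<Sum>f\<in>?S. wt T f + (if f = e2 then wt T e1 else 0))"
      using wG by (intro sum.cong) auto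
    also have "\<dots> = (\<Sum>f\<in>?S. wt T f) + (if T.separates e1 (\<phi> ` I) then wt T e1 else 0)"
      using S e2 se by (simp add: sum.distrib)
    also have "\<dots> = (\<Sum>f\<in>{f. f \<in> T.E \<and> T.separates f (\<phi> ` I)}. wt T f)"
    proof (cases "T.separates e1 (\<phi> ` I)")
      case True
      then have "{f. f \<in> T.E \<and> T.separates f (\<phi> ` I)} = insert e1 ?S" using eE(1) e1 by auto
      moreover have "e1 \<notin> ?S" using e1 by simp
      ultimately show ?thesis using S True by simp
    next
      case False
      then have "{f. f \<in> T.E \<and> T.separates f (\<phi> ` I)} = ?S" using e1 by auto
      then show ?thesis using False by simp
    qed
    also have "\<dots> = D I" using tree_weight_eq[OF T'(1) I'(1,3)] T'(4)[OF I] by simp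
    finally show ?thesis .
  qed
  have "\<phi> ` {1..n} \<subseteq> leaves G"
  proof
    fix v assume "v \<in> \<phi> ` {1..n}"
    then have "v \<in> T.L" "v \<noteq> b" using T'(3) bL by auto
    then show "v \<in> leaves G" using C.leaves_contraction b(2) by blast
  qed
  then have "label_realizes n k D G \<phi>"
    using C.is_tree_quotient T'(2) w unfolding label_realizes_def by simp
  moreover have "positive_weighted G" if pos: "positive_weighted T"
    unfolding positive_weighted_def
  proof
    fix f assume "f \<in> edges G"
    then obtain g where g: "g \<in> T.E - {{a, b}}" "f = merge a b ` g" unfolding C.edgesC by blast
    have "0 < wt T g" "0 < wt T e1" using pos g eE(1) unfolding positive_weighted_def by auto
    then show "0 < wt G f" using wG[OF g(1)] g(2) by (auto intro: add_pos_pos)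
  qed
  ultimately show ?thesis using C.card_edges_contraction by blast
qed

lemma relabel_leaves:
  fixes T :: "nat wgraph"
  assumes n: "0 < k" and T: "label_realizes n k D T \<phi>" "leaves T = \<phi> ` {1..n}" "essential T"
  shows "\<exists>G. essential G \<and> realizes n k G D \<and> (positive_weighted T \<longrightarrow> positive_weighted G)"
proof -
  have T': "is_tree T" "inj_on \<phi> {1..n}"
    "\<And>I. I \<subseteq> {1..n} \<Longrightarrow> card I = k \<Longrightarrow> tree_weight T (\<phi> ` I) = D I"
    using T unfolding label_realizes_def by auto
  interpret T: tree T using T'(1) by unfold_locales
  \<comment> \<open>Inner vertices are shifted above \<open>n\<close>, where they cannot collide
    with the labels.\<close>
  define r where "r v = (if v \<in> T.L then the_inv_into {1..n} \<phi> v else n + 1 + v)" for v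
  have r\<phi>: "r (\<phi> i) = i" if "i \<in> {1..n}" for i
    using the_inv_into_f_f[OF T'(2) that] that T(2) unfolding r_def by simp
  have rL: "r v \<in> {1..n} \<and> \<phi> (r v) = v" if v: "v \<in> T.L" for v
  proof -
    have "v \<in> \<phi> ` {1..n}" using v T(2) by simp
    then obtain i where "i \<in> {1..n}" "v = \<phi> i" by blast
    then show ?thesis using r\<phi> by simp
  qed
  have inj: "inj r"
  proof (rule injI)
    fix u v assume eq: "r u = r v"
    have out: "r v \<notin> {1..n}" if "v \<notin> T.L" for v using that unfolding r_def by simp
    consider "u \<in> T.L" "v \<in> T.L" | "u \<notin> T.L" "v \<notin> T.L" using rL out eq by metis
    then show "u = v"
    proof cases
      case 1
      then show ?thesis using rL eq by metis
    next
      case 2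
      then show ?thesis using eq unfolding r_def by simp
    qed
  qed
  define G :: "nat wgraph" where
    "G = \<lparr>verts = r ` T.V, edges = image r ` T.E, wt = \<lambda>f. wt T (the_inv_into T.E (image r) f)\<rparr>"
  have G: "verts G = r ` T.V" "edges G = image r ` T.E"
    "wt G = (\<lambda>f. wt T (the_inv_into T.E (image r) f))" unfolding G_def by simp_all
  \<comment> \<open>With \<open>F0 = E\<close> nothing is collapsed, and the condition on fibres is
    just the injectivity of \<open>r\<close>.\<close>
  interpret Q: tree_quotient T T.E r G
    by unfold_locales (simp_all add: G conn_empty inj_eq[OF inj])
  have wG: "wt G (r ` e) = wt T e" if "e \<in> T.E" for e
    unfolding G using the_inv_into_f_f[OF Q.image_inj that] by simp
  have deg: "degree G (r v) = degree T v" for v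
    using Q.degree_quotient[of v] unfolding degree_def by (simp add: inj_image_mem_iff[OF inj])
  have "leaves G = r ` T.L" unfolding leaves_def G(1) using deg by auto
  also have "\<dots> = {1..n}"
  proof -
    have "r ` \<phi> ` {1..n} = {1..n}" using r\<phi> by (simp add: image_image)
    then show ?thesis using T(2) by simp
  qed
  finally have leavesG: "leaves G = {1..n}" .
  have w: "tree_weight G I = D I" if I: "I \<subseteq> {1..n}" "card I = k" for I
  proof -
    have J: "\<phi> ` I \<subseteq> T.V" "\<phi> ` I \<noteq> {}" using I T(2) T.leaves_subset n by auto
    have "(r \<circ> \<phi>) ` I = id ` I" using r\<phi> I(1) by (intro image_cong) auto
    then have rI: "r ` \<phi> ` I = I" by (simp add: image_comp)
    have I': "I \<subseteq> verts G" "I \<noteq> {}" using I leavesG n unfolding leaves_def by auto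
    have "tree_weight G I = (\<Sum>f | f \<in> edges G \<and> tree.separates G f (r ` \<phi> ` I). wt G f)"
      using tree_weight_eq[OF Q.is_tree_quotient I'] rI by simp
    also have "\<dots> = (\<Sum>f | f \<in> T.E \<and> T.separates f (\<phi> ` I). wt G (r ` f))"
      by (rule Q.sum_quotient[OF J(1)])
    also have "\<dots> = (\<Sum>f | f \<in> T.E \<and> T.separates f (\<phi> ` I). wt T f)"
      using wG by (intro sum.cong) auto
    also have "\<dots> = D I" using tree_weight_eq[OF T'(1) J] T'(3)[OF I] by simp
    finally show ?thesis .
  qed
  have "realizes n k G D"
    using Q.is_tree_quotient leavesG w unfolding realizes_def wtree_on_def by simp
  moreover have "essential G" using T(3) deg unfolding essential_def G(1) by auto
  moreover have "positive_weighted G" if "positive_weighted T"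
    using that wG unfolding positive_weighted_def G(2) by simp
  ultimately show ?thesis by blast
qed

lemma label_realizes_essential:
  fixes T :: "nat wgraph"
  assumes n: "3 \<le> n" "0 < k" and T: "label_realizes n k D T \<phi>"
  shows "\<exists>G. essential G \<and> realizes n k G D \<and> (positive_weighted T \<longrightarrow> positive_weighted G)"
  using T
proof (induction "card (edges T)" arbitrary: T rule: less_induct)
  case less
  consider b where "b \<in> leaves T" "b \<notin> \<phi> ` {1..n}" | b where "b \<in> verts T" "degree T b = 2"
    | "leaves T \<subseteq> \<phi> ` {1..n}" "essential T"
    unfolding essential_def by blast
  then show ?case
  proof cases
    case 1
    obtain G where "label_realizes n k D G \<phi>" "card (edges G) < card (edges T)"
      "positive_weighted T \<longrightarrow> positive_weighted G"
      using delete_unlabelled_leaf[OF n less.prems 1] by blast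
    then show ?thesis using less.hyps[of G] by blast
  next
    case 2
    obtain G where "label_realizes n k D G \<phi>" "card (edges G) < card (edges T)"
      "positive_weighted T \<longrightarrow> positive_weighted G"
      using suppress_degree_2[OF n(2) less.prems 2] by blast
    then show ?thesis using less.hyps[of G] by blast
  next
    case 3
    then have "leaves T = \<phi> ` {1..n}" using less.prems unfolding label_realizes_def by blast
    then show ?thesis using relabel_leaves[OF n(2) less.prems _ 3(2)] by blast
  qed
qed

lemma l_treelike_essential:
  assumes "3 \<le> n" "0 < k" "l_treelike n k D"
  shows "\<exists>G. essential G \<and> realizes n k G D"
proof -
  obtain T :: "nat wgraph" and S \<phi> where "is_tree T" "S \<subseteq> leaves T" "bij_betw \<phi> {1..n} S"
    "\<forall>I. I \<subseteq> {1..n} \<and> card I = k \<longrightarrow> tree_weight T (\<phi> ` I) = D I"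
    using assms(3) unfolding l_treelike_def by blast
  then have "label_realizes n k D T \<phi>" unfolding label_realizes_def bij_betw_def by simp
  then show ?thesis using label_realizes_essential[OF assms(1,2)] by blast
qed

lemma p_l_treelike_essential:
  assumes "3 \<le> n" "0 < k" "p_l_treelike n k D"
  shows "\<exists>G. essential G \<and> realizes n k G D \<and> positive_weighted G"
proof -
  obtain T :: "nat wgraph" and S \<phi> where "positive_weighted T"
    "is_tree T" "S \<subseteq> leaves T" "bij_betw \<phi> {1..n} S"
    "\<forall>I. I \<subseteq> {1..n} \<and> card I = k \<longrightarrow> tree_weight T (\<phi> ` I) = D I"
    using assms(3) unfolding p_l_treelike_def by blast
  moreover from this have "label_realizes n k D T \<phi>" unfolding label_realizes_def bij_betw_def by simp
  ultimately show ?thesis using label_realizes_essential[OF assms(1,2)] by blast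
qed

lemma wtree_iso_positive:
  assumes "wtree_iso T T'" "positive_weighted T"
  shows "positive_weighted T'"
  using assms unfolding wtree_iso_def positive_weighted_def by auto

theorem theorem3p4:
  fixes n k :: nat and D :: "nat set \<Rightarrow> real"
  assumes "3 \<le> k" and "k \<le> n - 1"
    and "l_treelike n k D"
  shows "\<exists>P. inw_essential_pseudostar n k D P \<and>
    (\<forall>P'. inw_essential_pseudostar n k D P' \<longrightarrow> wtree_iso P' P) \<and>
    (\<forall>T. essential T \<and> realizes n k T D \<and> \<not> wtree_iso T P \<longrightarrow>
       (\<lambda>X Y. k_OI n k X Y \<or> insert_zero_internal n X Y)\<^sup>*\<^sup>* P T) \<and>
    (p_l_treelike n k D \<longrightarrow>
       positive_weighted P \<and>
       (\<forall>T. positive_weighted T \<and> essential T \<and> realizes n k T D \<and> \<not> wtree_iso T P \<longrightarrow>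
          (k_OI n k)\<^sup>*\<^sup>* P T))"
proof -
  \<comment> \<open>Subtraction of naturals is truncated, but \<open>3 \<le> k\<close> rules out
    \<open>n = 0\<close>, so the second assumption does give \<open>k < n\<close>.\<close>
  have k: "3 \<le> k" "k < n" and n: "3 \<le> n" "0 < k" using assms(1,2) by auto
  obtain T0 where "essential T0" "realizes n k T0 D" using l_treelike_essential[OF n assms(3)] by blast
  then obtain P where P: "inw_essential_pseudostar n k D P" using inw_exists[OF k] by blast
  \<comment> \<open>\<open>T0\<close> need not be positive. A positive realization reduces to a
    positive pseudostar \<open>P1\<close>, and uniqueness carries positivity over to
    \<open>P\<close>.\<close>
  have "positive_weighted P" if pl: "p_l_treelike n k D"
  proof -
    obtain T1 where "essential T1" "realizes n k T1 D" "positive_weighted T1"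
      using p_l_treelike_essential[OF n pl] by blast
    then obtain P1 where P1: "inw_essential_pseudostar n k D P1" "positive_weighted P1"
      using inw_exists[OF k] by blast
    show ?thesis by (rule wtree_iso_positive[OF inw_unique[OF k P1(1) P] P1(2)])
  qed
  then show ?thesis
    using P inw_unique[OF k _ P] reachable[OF k P] reachable_positive[OF k P] by blast
qed

end
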